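(* Let $\mathsf{A}=\{A_0,A_1\}$ be a pair of $2\times 2$ real matrices which satisfies both the technical hypotheses and the Sturmian hypothesis, with $1$-ratio function $\mathfrak{r}\colon[0,\infty)\to[0,1]$. Then: (i) The function $\mathfrak{r}$ is continuous and monotone non-decreasing, and satisfies $\mathfrak{r}(0)=0$ and $\lim_{\alpha\to\infty}\mathfrak{r}(\alpha)=1$. (ii) For every rational number $\gamma\in(0,1)$, the set $\mathfrak{r}^{-1}(\gamma)$ is a closed interval with nonempty interior. The interval $\mathfrak{r}^{-1}(0)\cap(0,\infty)$ is nonempty if and only if $A_0$ is diagonalisable, and similarly $\mathfrak{r}^{-1}(1)$ is nonempty if and only if $A_1$ is diagonalisable. The intervals $\mathfrak{r}^{-1}(p/q)$ are given as follows. If $A_0$ is diagonalisable, let $P_0:=\lim_{n\to\infty}\rho(A_0)^{-n}A_0^n$. Then $\mathfrak{r}^{-1}(0)=\left[0,\frac{\rho(A_0)}{\rho(P_0A_1)}\right]$. If $A_1$ is diagonalisable, let $P_1:=\lim_{n\to\infty}\rho(A_1)^{-n}A_1^n$. Then $\mathfrak{r}^{-1}(1)=\left[\frac{\rho(P_1A_0)}{\rho(A_1)},+\infty\right)$. If $p/q\in(0,1)$ in least terms, then there exists a standard pair $(u,v)$ such that $\varsigma(uv)=p/q$. Put $q_1:=|u|$, $q_2:=|v|$, $B_1:=\mathcal{A}(u)$, $B_2:=\mathcal{A}(v)$, $A:=B_1B_2$, and let $P:=\lim_{n\to\infty}\rho(A)^{-n}A^n$ be the Perron projection associated to the positive matrix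 $A$. Then \[\mathfrak{r}^{-1}(p/q)=\left[\frac{\rho(B_1P)^q}{\rho(A)^{q_1}},\ \frac{\rho(A)^{q_2}}{\rho(PB_2)^q}\right]\] and $\varrho(\alpha)=\rho(\mathcal{A}_\alpha(uv))^{1/q}$ for all $\alpha\in\mathfrak{r}^{-1}(p/q)$. (iii) The Hausdorff dimension of the set $\mathfrak{r}^{-1}([0,1)\setminus\mathbb{Q})$ is zero. In particular, $\mathfrak{r}^{-1}(\gamma)$ is a singleton for every irrational $\gamma\in(0,1)$.
   Context: Spectral radii. $\rho(B)$ is the spectral radius of a matrix $B$. For a finite set $\mathsf{B}$ of matrices, the joint spectral radius is $\varrho(\mathsf{B}):=\lim_{n\to\infty}\max\{\|B_{i_n}\cdots B_{i_1}\|^{1/n}: B_{i_j}\in\mathsf{B}\}$ (independent of the norm). Words. $\Sigma_2=\{0,1\}^{\mathbb{N}}$ is the set of infinite words $x=(x_i)_{i\ge1}$. For a finite word $u$ over $\{0,1\}$, $|u|$ is its length, $|u|_1$ the number of its entries equal to $1$, and, if $u$ is nonempty, $\varsigma(u):=|u|_1/|u|$ is its slope. Concatenation is written $uv$, and $u^k$ is the $k$-fold concatenation of $u$. A finite word $u$ is balanced if $\big||v_1|_1-|v_2|_1\big|\le1$ for all pairs of (contiguous) subwords $v_1,v_2$ of $u$ with $|v_1|=|v_2|$; it is cyclically balanced if it and all of its cyclic permutations are balanced. Sturmian sets. For $\gamma\in[0,1]$, $X_\gamma\subset\Sigma_2$ is the set of all $x=(x_n)_{n\ge1}$ for which there is $\delta\in\mathbb{R}$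 such that either $x_n=\lfloor\gamma(n+1)+\delta\rfloor-\lfloor\gamma n+\delta\rfloor$ for all $n$, or $x_n=\lceil\gamma(n+1)+\delta\rceil-\lceil\gamma n+\delta\rceil$ for all $n$. Matrix products. Given $\mathsf{A}=\{A_0,A_1\}$ and $\alpha\ge0$, put $A_0^{(\alpha)}:=A_0$, $A_1^{(\alpha)}:=\alpha A_1$, $\mathsf{A}_\alpha:=\{A_0^{(\alpha)},A_1^{(\alpha)}\}$, $\varrho(\alpha):=\varrho(\mathsf{A}_\alpha)$. For a finite word $u$ of length $m\ge1$, $\mathcal{A}_\alpha(u):=A_{u_m}^{(\alpha)}\cdots A_{u_1}^{(\alpha)}$ and $\mathcal{A}(u):=\mathcal{A}_1(u)$. For $x\in\Sigma_2$, $n\ge1$: $\mathcal{A}_\alpha(x,n):=A_{x_n}^{(\alpha)}\cdots A_{x_1}^{(\alpha)}$. A sequence $x\in\Sigma_2$ is weakly extremal for $\mathsf{A}_\alpha$ if $\|\mathcal{A}_\alpha(x,n)\|^{1/n}\to\varrho(\alpha)$. Technical hypotheses on $\mathsf{A}$: (1) $A_0,A_1$ are non-negative, invertible, have positive trace, and have no common invariant subspace (of dimension one); (2) if $u$ is a (nonempty) finite word not of the form $1^n$ or $0^n$, then all entries of $\mathcal{A}(u)$ are positive. Sturmian hypothesis on $\mathsf{A}$: there is a function $\mathfrak{r}\colon[0,\infty)\to[0,1]$ (necessarily unique, called the $1$-ratio function of $\mathsf{A}$) such that for every $\alpha\ge0$: (3) every $x\in X_{\mathfrak{r}(\alpha)}$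 is weakly extremal for $\mathsf{A}_\alpha$; (4) if $x\in\Sigma_2$ is weakly extremal for $\mathsf{A}_\alpha$ then $n^{-1}\#\{1\le i\le n: x_i=1\}\to\mathfrak{r}(\alpha)$; (5) if $u$ is a finite word which is not cyclically balanced then $\rho(\mathcal{A}_\alpha(u))<\varrho(\alpha)^{|u|}$. Standard pairs. The set $\mathcal{P}$ of standard pairs is the smallest set of ordered pairs of finite words such that $(0,1)\in\mathcal{P}$, and whenever $(u,v)\in\mathcal{P}$ then $(uv,v)\in\mathcal{P}$ and $(u,vu)\in\mathcal{P}$. *)

theory Defs
  imports "HOL-Analysis.Analysis" "HOL-Library.Sublist"
begin

text \<open>The type class operation \<open>*\<close> on \<^typ>\<open>real^'n^'n\<close> is entrywise, so products and powers are
  built from \<open>**\<close>. For a list \<open>[B\<^sub>1, \<dots>, B\<^sub>n]\<close> the product is \<open>B\<^sub>n \<cdots> B\<^sub>1\<close>.\<close>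

definition matrix_list_prod :: "(real^'n^'n) list \<Rightarrow> real^'n^'n" where
  "matrix_list_prod Bs = foldl (\<lambda>M B. B ** M) (mat 1) Bs"

definition matrix_power :: "real^'n^'n \<Rightarrow> nat \<Rightarrow> real^'n^'n" where
  "matrix_power A n = (((**) A) ^^ n) (mat 1)"

definition complex_eigenvalues :: "real^'n^'n \<Rightarrow> complex set" where
  "complex_eigenvalues A = {z. \<exists>v. v \<noteq> 0 \<and> map_matrix complex_of_real A *v v = z *s v}"

definition spectral_radius :: "real^'n^'n \<Rightarrow> real" where
  "spectral_radius A = Max (cmod ` complex_eigenvalues A)"

text \<open>\<^const>\<open>norm\<close> is the Frobenius norm here; the limit does not depend on this choice. The value of
  the sequence at \<open>n = 0\<close> is irrelevant.\<close>

definition joint_spectral_radius :: "(real^'n^'n) set \<Rightarrow> real" where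
  "joint_spectral_radius B =
     lim (\<lambda>n. Max {root n (norm (matrix_list_prod Bs)) | Bs. length Bs = n \<and> set Bs \<subseteq> B})"

definition diagonalizable :: "real^'n^'n \<Rightarrow> bool" where
  "diagonalizable A \<longleftrightarrow>
     (\<exists>(S :: real^'n^'n) (D :: real^'n^'n). invertible S \<and> (\<forall>i j. i \<noteq> j \<longrightarrow> D $ i $ j = 0) \<and> A = S ** D ** matrix_inv S)"

text \<open>\<open>P\<close> is the limit of \<open>\<rho>(A)\<^bsup>-n\<^esup> A\<^bsup>n\<^esup>\<close>.\<close>

definition is_perron_limit :: "real^'n^'n \<Rightarrow> real^'n^'n \<Rightarrow> bool" where
  "is_perron_limit A P \<longleftrightarrow>
     (\<lambda>n. inverse (spectral_radius A ^ n) *\<^sub>R matrix_power A n) \<longlonglongrightarrow> P"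

text \<open>Letters are booleans, with \<^const>\<open>True\<close> for \<open>1\<close> and \<^const>\<open>False\<close> for \<open>0\<close>. Infinite words are
  functions \<^typ>\<open>nat \<Rightarrow> bool\<close> indexed from \<open>1\<close>: the value at \<open>0\<close> never matters.\<close>

definition num_ones :: "bool list \<Rightarrow> nat" where
  "num_ones u = count_list u True"

definition slope :: "bool list \<Rightarrow> real" where
  "slope u = real (num_ones u) / real (length u)"

definition balanced :: "bool list \<Rightarrow> bool" where
  "balanced u \<longleftrightarrow>
     (\<forall>v1 v2. sublist v1 u \<and> sublist v2 u \<and> length v1 = length v2 \<longrightarrow>
        \<bar>int (num_ones v1) - int (num_ones v2)\<bar> \<le> 1)"

definition cyclically_balanced :: "bool list \<Rightarrow> bool" where
  "cyclically_balanced u \<longleftrightarrow> (\<forall>k. balanced (rotate k u))"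

definition sturmian_set :: "real \<Rightarrow> (nat \<Rightarrow> bool) set" where
  "sturmian_set \<gamma> = {x. \<exists>\<delta>::real.
      (\<forall>n\<ge>1. of_bool (x n) = \<lfloor>\<gamma> * real (n + 1) + \<delta>\<rfloor> - \<lfloor>\<gamma> * real n + \<delta>\<rfloor>) \<or>
      (\<forall>n\<ge>1. of_bool (x n) = \<lceil>\<gamma> * real (n + 1) + \<delta>\<rceil> - \<lceil>\<gamma> * real n + \<delta>\<rceil>)}"

inductive_set standard_pairs :: "(bool list \<times> bool list) set" where
  base: "([False], [True]) \<in> standard_pairs"
| left: "(u, v) \<in> standard_pairs \<Longrightarrow> (u @ v, v) \<in> standard_pairs"
| right: "(u, v) \<in> standard_pairs \<Longrightarrow> (u, v @ u) \<in> standard_pairs"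

definition letter_matrix :: "real^2^2 \<Rightarrow> real^2^2 \<Rightarrow> real \<Rightarrow> bool \<Rightarrow> real^2^2" where
  "letter_matrix A0 A1 \<alpha> a = (if a then \<alpha> *\<^sub>R A1 else A0)"

text \<open>\<open>A\<^sub>\<alpha>(u) = A\<^sub>u\<^sub>m \<cdots> A\<^sub>u\<^sub>1\<close>: later letters act on the left.\<close>

definition word_matrix :: "real^2^2 \<Rightarrow> real^2^2 \<Rightarrow> real \<Rightarrow> bool list \<Rightarrow> real^2^2" where
  "word_matrix A0 A1 \<alpha> u = matrix_list_prod (map (letter_matrix A0 A1 \<alpha>) u)"

definition prefix_matrix :: "real^2^2 \<Rightarrow> real^2^2 \<Rightarrow> real \<Rightarrow> (nat \<Rightarrow> bool) \<Rightarrow> nat \<Rightarrow> real^2^2" where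
  "prefix_matrix A0 A1 \<alpha> x n = word_matrix A0 A1 \<alpha> (map x [1..<n+1])"

definition jsr :: "real^2^2 \<Rightarrow> real^2^2 \<Rightarrow> real \<Rightarrow> real" where
  "jsr A0 A1 \<alpha> = joint_spectral_radius {A0, \<alpha> *\<^sub>R A1}"

definition weakly_extremal :: "real^2^2 \<Rightarrow> real^2^2 \<Rightarrow> real \<Rightarrow> (nat \<Rightarrow> bool) \<Rightarrow> bool" where
  "weakly_extremal A0 A1 \<alpha> x \<longleftrightarrow>
     (\<lambda>n. root n (norm (prefix_matrix A0 A1 \<alpha> x n))) \<longlonglongrightarrow> jsr A0 A1 \<alpha>"

definition technical_hypotheses :: "real^2^2 \<Rightarrow> real^2^2 \<Rightarrow> bool" where
  "technical_hypotheses A0 A1 \<longleftrightarrow>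
     (\<forall>A \<in> {A0, A1}. (\<forall>i j. A $ i $ j \<ge> 0) \<and> invertible A \<and> trace A > 0) \<and>
     \<not> (\<exists>V::(real^2) set. subspace V \<and> dim V = 1 \<and>
           (\<lambda>x. A0 *v x) ` V \<subseteq> V \<and> (\<lambda>x. A1 *v x) ` V \<subseteq> V) \<and>
     (\<forall>u. u \<noteq> [] \<and> \<not> (\<exists>n. u = replicate n True) \<and> \<not> (\<exists>n. u = replicate n False) \<longrightarrow>
        (\<forall>i j. word_matrix A0 A1 1 u $ i $ j > 0))"

text \<open>The Sturmian hypothesis states that some \<open>r\<close> with the following property exists. Only the values
  of \<open>r\<close> on \<open>[0, \<infinity>)\<close> are constrained.\<close>

definition is_ratio_function :: "real^2^2 \<Rightarrow> real^2^2 \<Rightarrow> (real \<Rightarrow> real) \<Rightarrow> bool" where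
  "is_ratio_function A0 A1 r \<longleftrightarrow> (\<forall>\<alpha>\<ge>0.
     r \<alpha> \<in> {0..1} \<and>
     (\<forall>x \<in> sturmian_set (r \<alpha>). weakly_extremal A0 A1 \<alpha> x) \<and>
     (\<forall>x. weakly_extremal A0 A1 \<alpha> x \<longrightarrow>
        (\<lambda>n. real (card {i. 1 \<le> i \<and> i \<le> n \<and> x i}) / real n) \<longlonglongrightarrow> r \<alpha>) \<and>
     (\<forall>u. \<not> cyclically_balanced u \<longrightarrow>
        spectral_radius (word_matrix A0 A1 \<alpha> u) < jsr A0 A1 \<alpha> ^ length u))"

text \<open>The preimage of \<open>S\<close> under \<open>r\<close>, where \<open>r\<close> is regarded as a function on \<open>[0, \<infinity>)\<close>.\<close>

abbreviation preimage :: "(real \<Rightarrow> real) \<Rightarrow> real set \<Rightarrow> real set" where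
  "preimage r S \<equiv> r -` S \<inter> {0..}"

text \<open>\<open>diam(U)\<^bsup>s\<^esup>\<close> with the usual conventions \<open>diam(\<emptyset>)\<^bsup>s\<^esup> = 0\<close> and \<open>0\<^bsup>0\<^esup> = 1\<close>
  for nonempty sets (note that \<open>0 powr 0 = 0\<close>).\<close>

definition diameter_powr :: "real \<Rightarrow> 'a::metric_space set \<Rightarrow> real" where
  "diameter_powr s U = (if U = {} then 0 else if s = 0 then 1 else diameter U powr s)"

text \<open>Covering sets are required to be bounded since \<^const>\<open>diameter\<close> is unspecified otherwise.\<close>

definition hausdorff_premeasure :: "real \<Rightarrow> real \<Rightarrow> 'a::metric_space set \<Rightarrow> ennreal" where
  "hausdorff_premeasure s \<delta> E =
     (INF U \<in> {U :: nat \<Rightarrow> 'a set. E \<subseteq> (\<Union>i. U i) \<and> (\<forall>i. bounded (U i) \<and> diameter (U i) \<le> \<delta>)}.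
        \<Sum>i. ennreal (diameter_powr s (U i)))"

definition hausdorff_measure :: "real \<Rightarrow> 'a::metric_space set \<Rightarrow> ennreal" where
  "hausdorff_measure s E = (SUP \<delta> \<in> {0<..}. hausdorff_premeasure s \<delta> E)"

definition hausdorff_dimension :: "'a::metric_space set \<Rightarrow> ennreal" where
  "hausdorff_dimension E = (INF s \<in> {s. 0 \<le> s \<and> hausdorff_measure s E = 0}. ennreal s)"

end

theory Submission
  imports Defs
begin

text \<open>For \<open>\<alpha> = e\<^sup>t\<close>, the logarithm of the joint spectral radius is the supremum over words \<open>u\<close> of the affine
  functions \<open>t \<mapsto> slope(u) t + ln \<rho>(A(u)) / |u|\<close>. It is therefore convex in \<open>t\<close>, and since Sturmian sequences
  are weakly extremal, \<open>r(e\<^sup>t)\<close> is one of its subgradients. This gives monotonicity and the limits at \<open>0\<close> and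
  \<open>\<infinity>\<close>. If \<open>\<alpha>\<^sub>n \<rightarrow> \<alpha>\<close> and \<open>r(\<alpha>\<^sub>n) \<rightarrow> \<gamma>\<close>, a compactness argument applied to factors of Sturmian sequences of
  slope \<open>r(\<alpha>\<^sub>n)\<close> yields a sequence of frequency \<open>\<gamma>\<close> that is weakly extremal at \<open>\<alpha>\<close>, so \<open>\<gamma> = r(\<alpha>)\<close> and \<open>r\<close> is
  continuous.

  For a standard pair \<open>(u, v)\<close> the periodic sequences generated by \<open>u\<close> and by \<open>v\<close> are Sturmian. Comparing their growth rates
  bounds the right end of the plateau of \<open>u\<close> and the left end of the plateau of \<open>v\<close>, and applying the bounds to
  the pairs \<open>(u, v u\<^sup>k)\<close> and \<open>(u v\<^sup>k, v)\<close> with \<open>k \<rightarrow> \<infinity>\<close> makes them sharp. A plateau that degenerates to a point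
  would give \<open>A(u)\<close> and \<open>A(v)\<close> a common eigenvector, hence also \<open>A\<^sub>0\<close> and \<open>A\<^sub>1\<close>.

  The words \<open>uv\<close> and \<open>vu\<close> differ only in their first two letters. The Perron vectors of \<open>A(u)\<close> and \<open>A(v)\<close> hence
  lie in the image of the positive quadrant under a long common product, so that they are projectively
  exponentially close, and the gap between the plateaus of \<open>u\<close> and \<open>v\<close> is exponentially small in \<open>|uv|\<close>. As there
  are only polynomially many standard pairs of a given length, the irrational values of \<open>r\<close> are taken on a
  set of dimension zero.\<close>

section \<open>Non-negative 2 by 2 matrices\<close>

text \<open>Most estimates are made in logarithms, because \<open>\<alpha>\<close> enters a product
  only through the factor \<open>\<alpha> ^ num_ones u\<close>; the parameter 0 is treated by hand.
  The slopes of a standard pair are Farey neighbours, so when the affine functions of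
  \<open>u\<close> and \<open>v\<close> are compared, the coefficient of \<open>ln \<alpha>\<close>
  is exactly 1 and the plateau ends come out in closed form.

  If the plateau of \<open>uv\<close> degenerates, the formulas for its ends give trace(P B1)
  trace(P B2) = rho(B1 B2). In an eigenbasis of B1 B2 the right side is that product plus a product
  of two off-diagonal entries. One of these must vanish, so an eigenvector of B1 B2 is also one of
  B1 or of B2, and invertibility passes it to the other factor.

  The obstacle in the dimension estimate is that contraction is not uniform for slopes near 0 or 1,
  where long blocks of one letter occur. Hence the ratio is first confined between 1/N and 1 - 1/N:
  in long words every window of a length depending only on N then contains both letters and
  contracts by a fixed factor. A countable union over N concludes.\<close>

definition nonneg_mat :: "real^'n^'m \<Rightarrow> bool" where
  "nonneg_mat M \<longleftrightarrow> (\<forall>i j. 0 \<le> M $ i $ j)"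

definition pos_mat :: "real^'n^'m \<Rightarrow> bool" where
  "pos_mat M \<longleftrightarrow> (\<forall>i j. 0 < M $ i $ j)"

text \<open>On non-negative matrices this is the entrywise 1-norm: submultiplicative, within a
  factor 4 of \<open>norm\<close>, and linear.\<close>

definition msum :: "real^2^2 \<Rightarrow> real" where
  "msum M = M$1$1 + M$1$2 + M$2$1 + M$2$2"

lemma matrix2_eqI:
  fixes M N :: "'a^2^2"
  assumes "M$1$1 = N$1$1" "M$1$2 = N$1$2" "M$2$1 = N$2$1" "M$2$2 = N$2$2"
  shows "M = N"
  using assms by (simp add: vec_eq_iff forall_2)

lemma vec2_eqI:
  fixes x y :: "'a^2"
  assumes "x$1 = y$1" "x$2 = y$2"
  shows "x = y"
  using assms by (simp add: vec_eq_iff forall_2)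

lemma mult2_entry [simp]:
  fixes M N :: "'a::semiring_1^2^2"
  shows "(M ** N)$i$j = M$i$1 * N$1$j + M$i$2 * N$2$j"
  by (simp add: matrix_matrix_mult_def sum_2)

lemma mult_vec2_entry [simp]:
  fixes M :: "'a::semiring_1^2^2" and x :: "'a^2"
  shows "(M *v x)$i = M$i$1 * x$1 + M$i$2 * x$2"
  by (simp add: matrix_vector_mult_def sum_2)

lemma mat2_entry [simp]:
  "(mat c :: 'a::zero^2^2)$1$1 = c" "(mat c :: 'a::zero^2^2)$1$2 = 0"
  "(mat c :: 'a::zero^2^2)$2$1 = 0" "(mat c :: 'a::zero^2^2)$2$2 = c"
  by (simp_all add: mat_def)

lemma trace2: "trace (M :: 'a::comm_semiring_1^2^2) = M$1$1 + M$2$2"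
  by (simp add: trace_def sum_2)

lemma nonneg_mat_2: "nonneg_mat (M :: real^2^2) \<longleftrightarrow> 0 \<le> M$1$1 \<and> 0 \<le> M$1$2 \<and> 0 \<le> M$2$1 \<and> 0 \<le> M$2$2"
  by (auto simp: nonneg_mat_def forall_2)

lemma pos_mat_2: "pos_mat (M :: real^2^2) \<longleftrightarrow> 0 < M$1$1 \<and> 0 < M$1$2 \<and> 0 < M$2$1 \<and> 0 < M$2$2"
  by (auto simp: pos_mat_def forall_2)

lemma pos_mat_imp_nonneg: "pos_mat M \<Longrightarrow> nonneg_mat M"
  by (simp add: pos_mat_def nonneg_mat_def less_imp_le)

lemma nonneg_mat_mult: "nonneg_mat M \<Longrightarrow> nonneg_mat N \<Longrightarrow> nonneg_mat (M ** N)" for M N :: "real^2^2"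
  by (auto simp: nonneg_mat_2)

lemma nonneg_mat_scale: "nonneg_mat M \<Longrightarrow> 0 \<le> c \<Longrightarrow> nonneg_mat (c *\<^sub>R M)" for M :: "real^2^2"
  by (auto simp: nonneg_mat_2)

lemma nonneg_mat_one: "nonneg_mat (mat 1 :: real^2^2)"
  by (auto simp: nonneg_mat_2)

lemma msum_scale: "msum (c *\<^sub>R M) = c * msum M"
  by (simp add: msum_def algebra_simps)

lemma msum_mult_le:
  assumes "nonneg_mat M" "nonneg_mat N"
  shows "msum (M ** N) \<le> msum M * msum N"
  using assms by (auto simp: nonneg_mat_2 msum_def algebra_simps)

lemma norm_le_msum:
  assumes "nonneg_mat M"
  shows "norm M \<le> msum M"
proof -
  have "norm M \<le> norm (M$1) + norm (M$2)"
  proof -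
    have "norm M \<le> (\<Sum>i\<in>UNIV. norm (M$i))"
      by (simp add: norm_vec_def L2_set_le_sum)
    then show ?thesis by (simp add: sum_2)
  qed
  moreover have "norm (M$i) \<le> \<bar>M$i$1\<bar> + \<bar>M$i$2\<bar>" for i
    using norm_le_l1_cart[of "M$i"] by (simp add: sum_2)
  ultimately show ?thesis
    using assms unfolding msum_def nonneg_mat_2 by (smt (verit) abs_of_nonneg)
qed

lemma entry_le_norm:
  fixes M :: "real^'n^'m"
  shows "\<bar>M$i$j\<bar> \<le> norm M"
  by (rule order_trans[OF component_le_norm_cart Finite_Cartesian_Product.norm_nth_le])

lemma msum_le_norm: "msum M \<le> 4 * norm M"
  using entry_le_norm[of M 1 1] entry_le_norm[of M 1 2] entry_le_norm[of M 2 1] entry_le_norm[of M 2 2]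
  by (simp add: msum_def)

text \<open>The discriminant of the characteristic polynomial, written so that it is visibly
  non-negative for a non-negative matrix.\<close>

definition disc2 :: "real^2^2 \<Rightarrow> real" where
  "disc2 M = (M$1$1 - M$2$2)\<^sup>2 + 4 * M$1$2 * M$2$1"

text \<open>The larger root of the characteristic polynomial, which is the spectral radius of a
  non-negative matrix. The closed form makes continuity, homogeneity and
  \<open>perron (M ** N) = perron (N ** M)\<close> immediate.\<close>

definition perron :: "real^2^2 \<Rightarrow> real" where
  "perron M = (trace M + sqrt (disc2 M)) / 2"

definition coperron :: "real^2^2 \<Rightarrow> real" where
  "coperron M = (trace M - sqrt (disc2 M)) / 2"

lemma disc2_trace_det: "disc2 M = (trace M)\<^sup>2 - 4 * det M"
  by (simp add: disc2_def trace2 det_2 power2_eq_square algebra_simps)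

lemma disc2_nonneg: "nonneg_mat M \<Longrightarrow> 0 \<le> disc2 M"
  by (simp add: disc2_def nonneg_mat_2)

lemma perron_trace: "perron M + coperron M = trace M"
  by (simp add: perron_def coperron_def field_simps)

lemma perron_det:
  assumes "nonneg_mat M"
  shows "perron M * coperron M = det M"
proof -
  have "perron M * coperron M = ((trace M)\<^sup>2 - (sqrt (disc2 M))\<^sup>2) / 4"
    by (simp add: perron_def coperron_def power2_eq_square algebra_simps)
  then show ?thesis
    using disc2_nonneg[OF assms] by (simp add: disc2_trace_det)
qed

lemma complex_eigenvalues_2:
  "complex_eigenvalues (M :: real^2^2) =
     {z. (of_real (M$1$1) - z) * (of_real (M$2$2) - z) = of_real (M$1$2) * of_real (M$2$1)}"
    (is "_ = ?R")
proof (intro set_eqI iffI)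
  fix z
  assume "z \<in> complex_eigenvalues M"
  then obtain v :: "complex^2" where v: "v \<noteq> 0" and ev: "map_matrix complex_of_real M *v v = z *s v"
    by (auto simp: complex_eigenvalues_def)
  have e: "of_real (M$1$1) * v$1 + of_real (M$1$2) * v$2 = z * v$1"
          "of_real (M$2$1) * v$1 + of_real (M$2$2) * v$2 = z * v$2"
    using arg_cong[OF ev, of "\<lambda>w. w$1"] arg_cong[OF ev, of "\<lambda>w. w$2"]
    by (simp_all add: map_matrix_def)
  let ?a = "of_real (M$1$1) - z" and ?d = "of_real (M$2$2) - z"
  let ?b = "complex_of_real (M$1$2)" and ?c = "complex_of_real (M$2$1)"
  have "(?a * ?d - ?b * ?c) * v$1 = 0" "(?a * ?d - ?b * ?c) * v$2 = 0"
    using e by algebra+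
  moreover have "v$1 \<noteq> 0 \<or> v$2 \<noteq> 0"
    using v vec2_eqI[of v 0] by auto
  ultimately show "z \<in> ?R" by auto
next
  fix z
  assume z: "z \<in> ?R"
  let ?a = "of_real (M$1$1) - z" and ?d = "of_real (M$2$2) - z"
  let ?b = "complex_of_real (M$1$2)" and ?c = "complex_of_real (M$2$1)"
  have d0: "?a * ?d = ?b * ?c" using z by simp
  \<comment> \<open>A kernel vector of a singular matrix can be read off from a non-zero
    row.\<close>
  have "\<exists>x y. (x \<noteq> 0 \<or> y \<noteq> 0) \<and> ?a * x + ?b * y = 0 \<and> ?c * x + ?d * y = 0"
  proof (cases "?a = 0 \<and> ?b = 0")
    case True
    show ?thesis
    proof (cases "?c = 0 \<and> ?d = 0")
      case True
      with \<open>?a = 0 \<and> ?b = 0\<close> show ?thesis by (intro exI[of _ 1]) auto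
    next
      case False
      with \<open>?a = 0 \<and> ?b = 0\<close> show ?thesis
        by (intro exI[of _ "?d"] exI[of _ "- ?c"]) (auto simp: algebra_simps)
    qed
  next
    case False
    then show ?thesis using d0
      by (intro exI[of _ "- ?b"] exI[of _ "?a"]) (auto simp: algebra_simps)
  qed
  then obtain x y where xy: "x \<noteq> 0 \<or> y \<noteq> 0" "?a * x + ?b * y = 0" "?c * x + ?d * y = 0"
    by blast
  define v :: "complex^2" where "v = vector [x, y]"
  have "v \<noteq> 0" using xy(1) by (auto simp: v_def vec_eq_iff forall_2)
  moreover have "map_matrix complex_of_real M *v v = z *s v"
    using xy(2,3) by (intro vec2_eqI) (auto simp: v_def map_matrix_def algebra_simps)
  ultimately show "z \<in> complex_eigenvalues M" by (auto simp: complex_eigenvalues_def)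
qed

lemma spectral_radius_perron:
  assumes "nonneg_mat M"
  shows "spectral_radius M = perron M"
proof -
  have "complex_eigenvalues M = {of_real (perron M), of_real (coperron M)}"
  proof -
    have "(of_real (M$1$1) - z) * (of_real (M$2$2) - z) - of_real (M$1$2) * of_real (M$2$1)
       = (z - of_real (perron M)) * (z - of_real (coperron M))" for z :: complex
    proof -
      have "(of_real (M$1$1) - z) * (of_real (M$2$2) - z) - of_real (M$1$2) * of_real (M$2$1)
        = z * z - of_real (trace M) * z + of_real (det M)"
        by (simp add: trace2 det_2 algebra_simps)
      also have "\<dots> = z * z - of_real (perron M + coperron M) * z + of_real (perron M * coperron M)"
        by (simp only: perron_trace perron_det[OF assms])
      finally show ?thesis by (simp add: algebra_simps)
    qed
    then have "(of_real (M$1$1) - z) * (of_real (M$2$2) - z) = of_real (M$1$2) * of_real (M$2$1) \<longleftrightarrow>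
      z = of_real (perron M) \<or> z = of_real (coperron M)" for z :: complex
      by (metis (no_types, lifting) eq_iff_diff_eq_0 mult_eq_0_iff)
    then show ?thesis unfolding complex_eigenvalues_2 by auto
  qed
  then have "spectral_radius M = max \<bar>perron M\<bar> \<bar>coperron M\<bar>"
    by (simp add: spectral_radius_def)
  moreover have "0 \<le> trace M" using assms by (simp add: trace2 nonneg_mat_2)
  then have "\<bar>perron M\<bar> = perron M" "\<bar>coperron M\<bar> \<le> perron M"
    using real_sqrt_ge_zero[OF disc2_nonneg[OF assms]]
    unfolding perron_def coperron_def abs_le_iff abs_of_nonneg by (simp_all add: field_simps)
  ultimately show ?thesis by simp
qed

lemma perron_mult_commute: "perron (M ** N) = perron (N ** M)"
proof -
  have "trace (M ** N) = trace (N ** M)" by (simp add: trace2 algebra_simps)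
  moreover have "det (M ** N) = det (N ** M)" by (simp add: det_mul)
  ultimately show ?thesis by (simp add: perron_def disc2_trace_det)
qed

lemma perron_transpose: "perron (transpose M) = perron M"
  by (simp add: perron_def disc2_def trace2 transpose_def algebra_simps)

lemma perron_scale: "0 \<le> c \<Longrightarrow> perron (c *\<^sub>R M) = c * perron M"
proof -
  assume "0 \<le> c"
  have "disc2 (c *\<^sub>R M) = c\<^sup>2 * disc2 M" by (simp add: disc2_def power2_eq_square algebra_simps)
  then show ?thesis using \<open>0 \<le> c\<close>
    by (simp add: perron_def trace2 real_sqrt_mult algebra_simps)
qed

lemma perron_ge_half_trace: "nonneg_mat M \<Longrightarrow> trace M / 2 \<le> perron M"
  using disc2_nonneg[of M] by (simp add: perron_def)

lemma perron_nonneg: "nonneg_mat M \<Longrightarrow> 0 \<le> perron M"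
  using perron_ge_half_trace[of M] by (simp add: trace2 nonneg_mat_2)

lemma perron_pos: "nonneg_mat M \<Longrightarrow> 0 < trace M \<Longrightarrow> 0 < perron M"
  using perron_ge_half_trace[of M] by simp

lemma abs_coperron_le: "nonneg_mat M \<Longrightarrow> \<bar>coperron M\<bar> \<le> perron M"
  using real_sqrt_ge_zero[OF disc2_nonneg[of M]]
  unfolding perron_def coperron_def trace2 nonneg_mat_2 abs_le_iff by (simp add: field_simps)

lemma abs_coperron_less: 
  assumes "nonneg_mat M" "0 < trace M" "disc2 M > 0"
  shows "\<bar>coperron M\<bar> < perron M"
  using real_sqrt_gt_zero[OF assms(3)] assms(2)
  unfolding perron_def coperron_def abs_less_iff by (auto simp: field_simps)

lemma perron_ge_diag:
  assumes "nonneg_mat M"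
  shows "M$1$1 \<le> perron M" "M$2$2 \<le> perron M"
proof -
  have "\<bar>M$1$1 - M$2$2\<bar> \<le> sqrt (disc2 M)"
    using assms by (intro real_le_rsqrt) (simp add: disc2_def nonneg_mat_2)
  then show "M$1$1 \<le> perron M" "M$2$2 \<le> perron M"
    by (auto simp: perron_def trace2 field_simps)
qed

lemma perron_charpoly:
  assumes "nonneg_mat M"
  shows "(perron M - M$1$1) * (perron M - M$2$2) = M$1$2 * M$2$1"
proof -
  have "(perron M - M$1$1) * (perron M - M$2$2) = perron M * perron M - perron M * trace M + det M + M$1$2 * M$2$1"
    by (simp add: trace2 det_2 algebra_simps)
  also have "\<dots> = M$1$2 * M$2$1"
    by (simp add: perron_trace[symmetric] perron_det[OF assms, symmetric] algebra_simps)
  finally show ?thesis .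
qed

lemma perron_eigenvector:
  assumes "nonneg_mat M"
  obtains x :: "real^2" where "\<And>i. 0 \<le> x$i" "x \<noteq> 0" "M *v x = perron M *\<^sub>R x"
proof -
  note g = perron_ge_diag[OF assms] perron_charpoly[OF assms]
  have nn: "0 \<le> M$1$1" "0 \<le> M$1$2" "0 \<le> M$2$1" "0 \<le> M$2$2"
    using assms by (auto simp: nonneg_mat_2)
  let ?p = "perron M"
  have "\<exists>a b. 0 \<le> a \<and> 0 \<le> b \<and> (a \<noteq> 0 \<or> b \<noteq> 0) \<and> M$1$1 * a + M$1$2 * b = ?p * a \<and> M$2$1 * a + M$2$2 * b = ?p * b"
  proof (cases "?p = M$1$1 \<and> M$1$2 = 0")
    case True
    show ?thesis
    proof (cases "?p = M$2$2 \<and> M$2$1 = 0")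
      case True
      with \<open>?p = M$1$1 \<and> M$1$2 = 0\<close> show ?thesis by (intro exI[of _ 1] exI[of _ 0]) auto
    next
      case False
      with \<open>?p = M$1$1 \<and> M$1$2 = 0\<close> g nn show ?thesis
        by (intro exI[of _ "?p - M$2$2"] exI[of _ "M$2$1"]) (auto simp: algebra_simps)
    qed
  next
    case False
    with g nn show ?thesis
      by (intro exI[of _ "M$1$2"] exI[of _ "?p - M$1$1"]) (auto simp: algebra_simps)
  qed
  then obtain a b where ab: "0 \<le> a" "0 \<le> b" "a \<noteq> 0 \<or> b \<noteq> 0"
     "M$1$1 * a + M$1$2 * b = ?p * a" "M$2$1 * a + M$2$2 * b = ?p * b" by blast
  let ?x = "vector [a, b] :: real^2"
  show ?thesis
  proof
    show "0 \<le> ?x$i" for i using ab exhaust_2[of i] by auto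
    show "?x \<noteq> 0" using ab by (auto simp: vec_eq_iff forall_2)
    show "M *v ?x = ?p *\<^sub>R ?x" using ab by (intro vec2_eqI) auto
  qed
qed

text \<open>Pair the inequality with a non-negative left eigenvector \<open>y\<close>:
  \<open>perron M\<close> times the scalar product of \<open>y\<close> and \<open>x\<close> is at
  most \<open>k\<close> times it, and this product is positive because \<open>x\<close> is.\<close>

lemma perron_le_collatz:
  fixes x :: "real^2"
  assumes "nonneg_mat M" and x: "\<And>i. 0 < x$i" and le: "\<And>i. (M *v x)$i \<le> k * x$i"
  shows "perron M \<le> k"
proof -
  have "nonneg_mat (transpose M)" using assms(1) by (auto simp: nonneg_mat_2 transpose_def)
  then obtain y :: "real^2" where y: "\<And>i. 0 \<le> y$i" "y \<noteq> 0" "transpose M *v y = perron (transpose M) *\<^sub>R y"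
    using perron_eigenvector[of "transpose M"] by metis
  have e: "M$1$1 * y$1 + M$2$1 * y$2 = perron M * y$1" "M$1$2 * y$1 + M$2$2 * y$2 = perron M * y$2"
    using arg_cong[OF y(3), of "\<lambda>w. w$1"] arg_cong[OF y(3), of "\<lambda>w. w$2"]
    unfolding perron_transpose by (simp_all add: transpose_def del: transpose_matrix_vector)
  have pos: "0 < y$1 * x$1 + y$2 * x$2"
  proof -
    have "y$1 > 0 \<or> y$2 > 0" using y(1)[of 1] y(1)[of 2] y(2) vec2_eqI[of y 0] by force
    then show ?thesis
      using x[of 1] x[of 2] y(1)[of 1] y(1)[of 2]
      by (auto intro: add_pos_nonneg add_nonneg_pos)
  qed
  have "perron M * (y$1 * x$1 + y$2 * x$2) = y$1 * (M *v x)$1 + y$2 * (M *v x)$2"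
  proof -
    have "perron M * (y$1 * x$1 + y$2 * x$2) = (perron M * y$1) * x$1 + (perron M * y$2) * x$2"
      by (simp add: algebra_simps)
    also have "\<dots> = y$1 * (M *v x)$1 + y$2 * (M *v x)$2"
      by (simp add: e[symmetric] algebra_simps)
    finally show ?thesis .
  qed
  also have "\<dots> \<le> y$1 * (k * x$1) + y$2 * (k * x$2)"
    using y(1) le by (intro add_mono mult_left_mono) auto
  also have "\<dots> = k * (y$1 * x$1 + y$2 * x$2)" by (simp add: algebra_simps)
  finally show ?thesis using pos by simp
qed

lemma perron_le_msum:
  assumes "nonneg_mat M"
  shows "perron M \<le> msum M"
proof -
  have "0 < (vector [1,1] :: real^2)$i" "(M *v vector [1,1])$i \<le> msum M * (vector [1,1] :: real^2)$i" for i
    using assms exhaust_2[of i] by (auto simp: msum_def nonneg_mat_2)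
  then show ?thesis by (rule perron_le_collatz[OF assms])
qed


section \<open>Powers of non-negative matrices and the Perron projection\<close>

lemma matrix_power_0 [simp]: "matrix_power M 0 = mat 1"
  by (simp add: matrix_power_def)

lemma matrix_power_Suc: "matrix_power M (Suc n) = M ** matrix_power M n"
  by (simp add: matrix_power_def)

lemma matrix_power_1 [simp]: "matrix_power M (Suc 0) = M"
  by (simp add: matrix_power_def)

lemma matrix_power_add: "matrix_power M (m + n) = matrix_power M m ** matrix_power M n"
  by (induction m) (simp_all add: matrix_power_Suc matrix_mul_assoc)

lemma matrix_power_Suc2: "matrix_power M (Suc n) = matrix_power M n ** M"
  using matrix_power_add[of M n 1] by simp

lemma nonneg_matrix_power: "nonneg_mat M \<Longrightarrow> nonneg_mat (matrix_power M n)" for M :: "real^2^2"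
  by (induction n) (simp_all add: matrix_power_Suc nonneg_mat_one nonneg_mat_mult)

lemma matrix_power_eigenvector:
  fixes M :: "real^2^2"
  assumes "M *v x = c *\<^sub>R x"
  shows "matrix_power M n *v x = c ^ n *\<^sub>R x"
proof (induction n)
  case (Suc n)
  have "matrix_power M (Suc n) *v x = M *v (c ^ n *\<^sub>R x)"
    using Suc by (simp add: matrix_power_Suc matrix_vector_mul_assoc[symmetric])
  also have "\<dots> = c ^ n *\<^sub>R (M *v x)"
    by (simp add: matrix_vector_mult_scaleR)
  finally show ?case using assms by (simp add: algebra_simps)
qed simp

text \<open>Apply the power to a non-negative eigenvector and look at its largest
  coordinate.\<close>

lemma perron_power_le_msum:
  assumes "nonneg_mat M"
  shows "perron M ^ n \<le> msum (matrix_power M n)"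
proof -
  obtain x :: "real^2" where x: "\<And>i. 0 \<le> x$i" "x \<noteq> 0" "M *v x = perron M *\<^sub>R x"
    using perron_eigenvector[OF assms] by metis
  define N where "N = matrix_power M n"
  have N: "nonneg_mat N" unfolding N_def by (rule nonneg_matrix_power[OF assms])
  have e: "perron M ^ n * x$i = N$i$1 * x$1 + N$i$2 * x$2" for i
    using arg_cong[OF matrix_power_eigenvector[OF x(3), of n], of "\<lambda>w. w$i"] by (simp add: N_def)
  have "\<exists>i. 0 < x$i \<and> x$1 \<le> x$i \<and> x$2 \<le> x$i"
    using x(1)[of 1] x(1)[of 2] x(2) vec2_eqI[of x 0]
    by (cases "x$1 \<le> x$2") (force intro: exI[of _ 1] exI[of _ 2])+
  then obtain i where i: "0 < x$i" "x$1 \<le> x$i" "x$2 \<le> x$i" by blast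
  have "perron M ^ n * x$i \<le> N$i$1 * x$i + N$i$2 * x$i"
    unfolding e using N i by (intro add_mono mult_left_mono) (auto simp: nonneg_mat_def)
  also have "\<dots> \<le> msum N * x$i"
  proof -
    have "N$i$1 + N$i$2 \<le> msum N" using N exhaust_2[of i] by (auto simp: msum_def nonneg_mat_2)
    then show ?thesis using i(1) by (simp add: distrib_right[symmetric])
  qed
  finally show ?thesis using i(1) by (simp add: N_def)
qed

text \<open>Cayley-Hamilton: the product of \<open>M - perron M\<close> and
  \<open>M - coperron M\<close> vanishes.\<close>

lemma perron_resolvent:
  assumes "nonneg_mat M"
  shows "M ** (M - coperron M *\<^sub>R mat 1) = perron M *\<^sub>R (M - coperron M *\<^sub>R mat 1)"
    and "M ** (M - perron M *\<^sub>R mat 1) = coperron M *\<^sub>R (M - perron M *\<^sub>R mat 1)"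
proof -
  note e = perron_trace[of M, unfolded trace2] perron_det[OF assms, unfolded det_2]
  show "M ** (M - coperron M *\<^sub>R mat 1) = perron M *\<^sub>R (M - coperron M *\<^sub>R mat 1)"
    by (rule matrix2_eqI; simp; use e in algebra)
  show "M ** (M - perron M *\<^sub>R mat 1) = coperron M *\<^sub>R (M - perron M *\<^sub>R mat 1)"
    by (rule matrix2_eqI; simp; use e in algebra)
qed

text \<open>The linear factor allows for a Jordan block, which \<open>A0\<close> and
  \<open>A1\<close> may be; it disappears under n-th roots.\<close>

lemma msum_power_le:
  assumes "nonneg_mat M" "0 < perron M"
  obtains c where "0 \<le> c" "\<And>n. msum (matrix_power M n) \<le> (4 + c * real n) * perron M ^ n"
proof -
  let ?p = "perron M" and ?m = "coperron M"
  define R where "R = M - ?m *\<^sub>R mat 1"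
  have step: "matrix_power M (Suc n) = ?m *\<^sub>R matrix_power M n + ?p ^ n *\<^sub>R R" for n
  proof (induction n)
    case 0
    then show ?case by (simp add: R_def)
  next
    case (Suc n)
    have "matrix_power M (Suc (Suc n)) = M ** (?m *\<^sub>R matrix_power M n + ?p ^ n *\<^sub>R R)"
      unfolding matrix_power_Suc[of M "Suc n"] Suc ..
    also have "\<dots> = ?m *\<^sub>R matrix_power M (Suc n) + ?p ^ n *\<^sub>R (M ** R)"
      by (rule matrix2_eqI) (simp_all add: matrix_power_Suc algebra_simps)
    also have "M ** R = ?p *\<^sub>R R" unfolding R_def by (rule perron_resolvent[OF assms(1)])
    finally show ?case by (simp add: algebra_simps)
  qed
  define K where "K = \<bar>R$1$1\<bar> + \<bar>R$1$2\<bar> + \<bar>R$2$1\<bar> + \<bar>R$2$2\<bar>"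
  have K: "\<bar>R$i$j\<bar> \<le> K" for i j using exhaust_2[of i] exhaust_2[of j] by (auto simp: K_def)
  have K0: "0 \<le> K" by (simp add: K_def)
  have bnd: "\<bar>matrix_power M n $ i $ j\<bar> \<le> (1 + K / ?p * real n) * ?p ^ n" for n i j
  proof (induction n)
    case 0
    then show ?case by (auto simp: mat_def)
  next
    case (Suc n)
    have "\<bar>matrix_power M (Suc n) $ i $ j\<bar> \<le> \<bar>?m\<bar> * \<bar>matrix_power M n $ i $ j\<bar> + ?p ^ n * \<bar>R$i$j\<bar>"
      unfolding step using assms(2) abs_triangle_ineq[of "?m * matrix_power M n $ i $ j" "?p ^ n * R$i$j"]
      by (simp add: abs_mult)
    also have "\<dots> \<le> ?p * ((1 + K / ?p * real n) * ?p ^ n) + ?p ^ n * K"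
      using assms K abs_coperron_le[OF assms(1)] Suc by (intro add_mono mult_mono) auto
    also have "\<dots> = (1 + K / ?p * real (Suc n)) * ?p ^ Suc n"
      using assms(2) by (simp add: field_simps)
    finally show ?case .
  qed
  show ?thesis
  proof
    show "0 \<le> 4 * K / ?p" using K0 assms(2) by simp
    show "msum (matrix_power M n) \<le> (4 + 4 * K / ?p * real n) * ?p ^ n" for n
    proof -
      define b where "b = (1 + K / ?p * real n) * ?p ^ n"
      have "matrix_power M n $ i $ j \<le> b" for i j
        using bnd[of n i j] by (simp add: b_def abs_le_iff)
      from this[of 1 1] this[of 1 2] this[of 2 1] this[of 2 2] have "msum (matrix_power M n) \<le> 4 * b"
        by (simp add: msum_def)
      then show ?thesis by (simp add: b_def algebra_simps)
    qed
  qed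
qed

text \<open>The projection onto the Perron eigenspace along the other eigenspace, as a Lagrange
  interpolation polynomial in \<open>M\<close>; meaningful for positive discriminant.\<close>

definition perron_proj :: "real^2^2 \<Rightarrow> real^2^2" where
  "perron_proj M = inverse (perron M - coperron M) *\<^sub>R (M - coperron M *\<^sub>R mat 1)"

lemma coperron_less: "0 < disc2 M \<Longrightarrow> coperron M < perron M"
  by (simp add: perron_def coperron_def)

lemma perron_proj_eigen:
  assumes "nonneg_mat M" "0 < disc2 M"
  shows "M ** perron_proj M = perron M *\<^sub>R perron_proj M"
    and "M ** (mat 1 - perron_proj M) = coperron M *\<^sub>R (mat 1 - perron_proj M)"
    and "perron_proj M ** M = perron M *\<^sub>R perron_proj M"
proof -
  let ?d = "perron M - coperron M"
  have d: "?d \<noteq> 0" using coperron_less[OF assms(2)] by simp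
  have 1: "M ** perron_proj M = inverse ?d *\<^sub>R (M ** (M - coperron M *\<^sub>R mat 1))"
    by (rule matrix2_eqI) (simp_all add: perron_proj_def algebra_simps)
  then show "M ** perron_proj M = perron M *\<^sub>R perron_proj M"
    by (simp add: perron_resolvent[OF assms(1)] perron_proj_def)
  have 2: "mat 1 - perron_proj M = (- inverse ?d) *\<^sub>R (M - perron M *\<^sub>R mat 1)"
    using d by (intro matrix2_eqI) (simp_all add: perron_proj_def field_simps)
  have "M ** (mat 1 - perron_proj M) = (- inverse ?d) *\<^sub>R (M ** (M - perron M *\<^sub>R mat 1))"
    unfolding 2 by (rule matrix2_eqI) (simp_all add: algebra_simps)
  also have "\<dots> = coperron M *\<^sub>R (mat 1 - perron_proj M)"
    unfolding perron_resolvent(2)[OF assms(1)] 2 by simp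
  finally show "M ** (mat 1 - perron_proj M) = coperron M *\<^sub>R (mat 1 - perron_proj M)" .
  have "perron_proj M ** M = M ** perron_proj M"
    by (rule matrix2_eqI) (simp_all add: perron_proj_def algebra_simps)
  then show "perron_proj M ** M = perron M *\<^sub>R perron_proj M"
    using \<open>M ** perron_proj M = perron M *\<^sub>R perron_proj M\<close> by simp
qed

lemma matrix_power_decomp:
  assumes "nonneg_mat M" "0 < disc2 M"
  shows "matrix_power M n = perron M ^ n *\<^sub>R perron_proj M + coperron M ^ n *\<^sub>R (mat 1 - perron_proj M)"
proof (induction n)
  case (Suc n)
  have "matrix_power M (Suc n) = M ** (perron M ^ n *\<^sub>R perron_proj M + coperron M ^ n *\<^sub>R (mat 1 - perron_proj M))"
    by (simp only: matrix_power_Suc Suc)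
  also have "\<dots> = perron M ^ n *\<^sub>R (M ** perron_proj M) + coperron M ^ n *\<^sub>R (M ** (mat 1 - perron_proj M))"
    by (rule matrix2_eqI) (simp_all add: algebra_simps)
  finally show ?case unfolding perron_proj_eigen[OF assms] by (simp add: algebra_simps)
qed simp

lemma perron_proj_limit:
  assumes "nonneg_mat M" "0 < trace M" "0 < disc2 M"
  shows "(\<lambda>n. inverse (perron M ^ n) *\<^sub>R matrix_power M n) \<longlonglongrightarrow> perron_proj M"
proof -
  have p: "0 < perron M" by (rule perron_pos[OF assms(1,2)])
  have "(\<lambda>n. (coperron M / perron M) ^ n) \<longlonglongrightarrow> 0"
  proof (intro LIMSEQ_power_zero)
    show "norm (coperron M / perron M) < 1"
      using abs_coperron_less[OF assms] p by (simp add: divide_less_eq)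
  qed
  then have "(\<lambda>n. perron_proj M + (coperron M / perron M) ^ n *\<^sub>R (mat 1 - perron_proj M))
     \<longlonglongrightarrow> perron_proj M + 0 *\<^sub>R (mat 1 - perron_proj M)"
    by (rule tendsto_add[OF tendsto_const tendsto_scaleR[OF _ tendsto_const]])
  moreover have "inverse (perron M ^ n) *\<^sub>R matrix_power M n =
     perron_proj M + (coperron M / perron M) ^ n *\<^sub>R (mat 1 - perron_proj M)" for n
    unfolding matrix_power_decomp[OF assms(1,3)] using p
    by (simp add: scaleR_add_right power_divide divide_inverse mult.commute power_mult_distrib power_inverse)
  ultimately show ?thesis by simp
qed

lemma is_perron_limit_proj:
  assumes "nonneg_mat M" "0 < trace M" "0 < disc2 M"
  shows "is_perron_limit M (perron_proj M)"
  using perron_proj_limit[OF assms] by (simp add: is_perron_limit_def spectral_radius_perron[OF assms(1)])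

lemma perron_proj_trace: "0 < disc2 M \<Longrightarrow> trace (perron_proj M) = 1"
proof -
  assume "0 < disc2 M"
  define k where "k = inverse (perron M - coperron M)"
  have "k * (perron M - coperron M) = 1" using coperron_less[OF \<open>0 < disc2 M\<close>] by (simp add: k_def)
  then show ?thesis
    using perron_trace[of M] unfolding perron_proj_def k_def[symmetric] trace2 by simp algebra
qed

lemma perron_proj_det:
  assumes "nonneg_mat M" "0 < disc2 M"
  shows "det (perron_proj M) = 0"
proof -
  note e = perron_trace[of M, unfolded trace2] perron_det[OF assms(1), unfolded det_2]
  have "(M$1$1 - coperron M) * (M$2$2 - coperron M) = M$1$2 * M$2$1"
    using e by algebra
  then show ?thesis by (simp add: perron_proj_def det_2 mult.commute mult.left_commute) algebra?
qed

lemma perron_proj_nonneg: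
  assumes "nonneg_mat M" "0 < disc2 M"
  shows "nonneg_mat (perron_proj M)"
proof -
  have "M$1$1 \<le> perron M" "M$2$2 \<le> perron M" using perron_ge_diag[OF assms(1)] .
  then have "coperron M \<le> M$1$1" "coperron M \<le> M$2$2" using perron_trace[of M] by (simp_all add: trace2)
  then show ?thesis using assms coperron_less[OF assms(2)]
    by (auto simp: nonneg_mat_2 perron_proj_def)
qed

lemma perron_rank_one:
  assumes "nonneg_mat M" "det M = 0"
  shows "perron M = trace M"
proof -
  have "0 \<le> trace M" using assms(1) by (simp add: trace2 nonneg_mat_2)
  then show ?thesis using assms(2) by (simp add: perron_def disc2_trace_det)
qed

text \<open>The projection has rank one, so a product with it has at most one non-zero eigenvalue,
  its trace. This turns the spectral radii in the plateau formulas into linear functions of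
  \<open>B\<close>.\<close>

lemma perron_proj_mult:
  assumes "nonneg_mat M" "0 < disc2 M" "nonneg_mat B"
  shows "perron (perron_proj M ** B) = trace (perron_proj M ** B)"
    and "perron (B ** perron_proj M) = trace (perron_proj M ** B)"
proof -
  show "perron (perron_proj M ** B) = trace (perron_proj M ** B)"
    using perron_proj_nonneg[OF assms(1,2)] perron_proj_det[OF assms(1,2)] assms(3)
    by (intro perron_rank_one nonneg_mat_mult) (simp_all add: det_mul)
  then show "perron (B ** perron_proj M) = trace (perron_proj M ** B)"
    by (simp add: perron_mult_commute)
qed

text \<open>\<open>B\<close> alone may have zero entries. Since the projection absorbs
  \<open>M\<close> up to the factor \<open>perron M\<close>, one can replace \<open>B\<close> by the
  positive matrix \<open>M ** B\<close>; a diagonal entry of the projection is positive because its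
  trace is 1.\<close>

lemma trace_perron_proj_mult_pos:
  assumes "nonneg_mat M" "0 < trace M" "0 < disc2 M" "pos_mat (M ** B)"
  shows "0 < trace (perron_proj M ** B)"
proof -
  define P C where "P = perron_proj M" and "C = M ** B"
  have P: "nonneg_mat P" "trace P = 1"
    unfolding P_def using perron_proj_nonneg[OF assms(1,3)] perron_proj_trace[OF assms(3)] .
  have "P ** C = perron M *\<^sub>R (P ** B)"
    unfolding C_def matrix_mul_assoc P_def perron_proj_eigen(3)[OF assms(1,3)]
    by (rule matrix2_eqI) (simp_all add: algebra_simps)
  then have "trace (P ** C) = perron M * trace (P ** B)"
    by (simp add: trace2 algebra_simps)
  moreover have "0 < trace (P ** C)"
  proof -
    have C: "0 < C$1$1" "0 < C$2$2" "0 < C$1$2" "0 < C$2$1" using assms(4) by (auto simp: C_def pos_mat_def)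
    have "0 < P$1$1 * C$1$1 + P$2$2 * C$2$2"
    proof (cases "P$1$1 = 0")
      case True
      then show ?thesis using P C by (simp add: trace2)
    next
      case False
      then show ?thesis using P C by (auto simp: nonneg_mat_2 intro!: add_pos_nonneg)
    qed
    moreover have "0 \<le> P$1$2 * C$2$1" "0 \<le> P$2$1 * C$1$2" using P C by (auto simp: nonneg_mat_2)
    ultimately show ?thesis by (simp add: trace2)
  qed
  ultimately show ?thesis
    using perron_pos[OF assms(1,2)] by (simp add: P_def zero_less_mult_iff)
qed

lemma tendsto_perron:
  assumes "(X \<longlongrightarrow> M) F"
  shows "((\<lambda>n. perron (X n)) \<longlongrightarrow> perron M) F"
  unfolding perron_def disc2_def trace2 by (intro tendsto_intros assms) auto

lemma tendsto_matrix_mult_2: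
  fixes M B :: "real^2^2"
  assumes "(X \<longlongrightarrow> M) F"
  shows "((\<lambda>n. X n ** B) \<longlongrightarrow> M ** B) F"
proof -
  have "((\<lambda>n. (X n ** B)$i$j) \<longlongrightarrow> (M ** B)$i$j) F" for i j
    unfolding mult2_entry by (intro tendsto_intros assms)
  then have "((\<lambda>n. (X n ** B)$i) \<longlongrightarrow> (M ** B)$i) F" for i
    by (rule vec_tendstoI)
  then show ?thesis by (rule vec_tendstoI)
qed

lemma perron_power_mult_limit:
  assumes "nonneg_mat M" "0 < trace M" "0 < disc2 M" "nonneg_mat B"
  shows "(\<lambda>n. perron (matrix_power M n ** B) / perron M ^ n) \<longlonglongrightarrow> trace (perron_proj M ** B)"
proof -
  have "(\<lambda>n. perron ((inverse (perron M ^ n) *\<^sub>R matrix_power M n) ** B)) \<longlonglongrightarrow> perron (perron_proj M ** B)"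
    by (intro tendsto_perron tendsto_matrix_mult_2 perron_proj_limit assms)
  moreover have "perron ((inverse (perron M ^ n) *\<^sub>R matrix_power M n) ** B) = perron (matrix_power M n ** B) / perron M ^ n" for n
  proof -
    have "(inverse (perron M ^ n) *\<^sub>R matrix_power M n) ** B = inverse (perron M ^ n) *\<^sub>R (matrix_power M n ** B)"
      by (rule matrix2_eqI) (simp_all add: algebra_simps)
    then show ?thesis using perron_nonneg[OF assms(1)] by (simp add: perron_scale field_simps)
  qed
  ultimately show ?thesis by (simp add: perron_proj_mult[OF assms(1,3,4)])
qed

section \<open>Diagonalisability in terms of the discriminant\<close>

lemma matrix_inv_invertible:
  assumes "invertible S"
  shows "S ** matrix_inv S = mat 1" "matrix_inv S ** S = mat 1"
  using someI_ex[OF assms[unfolded invertible_def]] by (simp_all add: matrix_inv_def)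

text \<open>A scalar matrix is diagonalisable with zero discriminant. Otherwise the diagonal entries
  of \<open>D\<close> differ, and the discriminant is the square of their difference.\<close>

lemma diagonalizable_imp_disc2:
  assumes "diagonalizable M" "nonneg_mat M" "\<And>c. M \<noteq> c *\<^sub>R mat 1"
  shows "0 < disc2 M"
proof -
  obtain S D :: "real^2^2" where S: "invertible S" and D: "\<And>i j. i \<noteq> j \<Longrightarrow> D $ i $ j = 0"
    and M: "M = S ** D ** matrix_inv S"
    using assms(1) by (auto simp: diagonalizable_def)
  have SS: "S ** matrix_inv S = mat 1" "matrix_inv S ** S = mat 1"
    using matrix_inv_invertible[OF S] by simp_all
  have "trace M = trace (matrix_inv S ** (S ** D))" unfolding M by (simp add: trace2 algebra_simps)
  then have t: "trace M = trace D" by (simp add: matrix_mul_assoc SS)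
  have "det M = det (matrix_inv S ** (S ** D))" unfolding M by (simp add: det_mul)
  then have d: "det M = det D" by (simp add: matrix_mul_assoc SS)
  have "disc2 M = (D$1$1 - D$2$2)\<^sup>2"
    unfolding disc2_trace_det t d using D[of 1 2] D[of 2 1] by (simp add: trace2 det_2 power2_eq_square algebra_simps)
  moreover have "D$1$1 \<noteq> D$2$2"
  proof
    assume "D$1$1 = D$2$2"
    then have "D = D$1$1 *\<^sub>R mat 1" using D[of 1 2] D[of 2 1] by (intro matrix2_eqI) auto
    then have "M = S ** (D$1$1 *\<^sub>R mat 1) ** matrix_inv S" using M by simp
    also have "\<dots> = D$1$1 *\<^sub>R (S ** matrix_inv S)" by (rule matrix2_eqI) (simp_all add: algebra_simps)
    finally show False using assms(3) SS by simp
  qed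
  ultimately show ?thesis by simp
qed

lemma disc2_imp_diagonalizable:
  assumes "nonneg_mat M" "0 < disc2 M"
  shows "diagonalizable M"
proof -
  have lt: "coperron M < perron M" by (rule coperron_less[OF assms(2)])
  note e = perron_trace[of M, unfolded trace2] perron_det[OF assms(1), unfolded det_2]
  have diag: "diagonalizable M" if S: "det S \<noteq> 0" and MS: "M ** S = S ** D" and D: "\<forall>i j. i \<noteq> j \<longrightarrow> D$i$j = 0" for S D :: "real^2^2"
  proof -
    have i: "invertible S" using S by (simp add: invertible_det_nz)
    then have "S ** matrix_inv S = mat 1" by (rule matrix_inv_invertible)
    then have "M = S ** D ** matrix_inv S" by (metis MS matrix_mul_assoc matrix_mul_rid)
    with i D show ?thesis unfolding diagonalizable_def by blast
  qed
  define D :: "real^2^2" where "D = vector [vector [perron M, 0], vector [0, coperron M]]"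
  have D: "\<forall>i j. i \<noteq> j \<longrightarrow> D$i$j = 0" by (simp add: D_def forall_2)
  consider "M$1$2 \<noteq> 0" | "M$2$1 \<noteq> 0" | "M$1$2 = 0" "M$2$1 = 0" by blast
  then show ?thesis
  proof cases
    case 1
    \<comment> \<open>The columns solve the first row of the eigenvector equation for the two
      eigenvalues; the next case uses the second row.\<close>
    let ?S = "vector [vector [M$1$2, M$1$2], vector [perron M - M$1$1, coperron M - M$1$1]] :: real^2^2"
    have "det ?S = M$1$2 * (coperron M - perron M)" by (simp add: det_2 algebra_simps)
    then have "det ?S \<noteq> 0" using 1 lt by simp
    moreover have "M ** ?S = ?S ** D"
      by (rule matrix2_eqI; simp add: D_def algebra_simps; use e in algebra)
    ultimately show ?thesis using D by (rule diag)
  next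
    case 2
    let ?S = "vector [vector [perron M - M$2$2, coperron M - M$2$2], vector [M$2$1, M$2$1]] :: real^2^2"
    have "det ?S = M$2$1 * (perron M - coperron M)" by (simp add: det_2 algebra_simps)
    then have "det ?S \<noteq> 0" using 2 lt by simp
    moreover have "M ** ?S = ?S ** D"
      by (rule matrix2_eqI; simp add: D_def algebra_simps; use e in algebra)
    ultimately show ?thesis using D by (rule diag)
  next
    case 3
    then show ?thesis by (intro diag[of "mat 1" M] ) (simp_all add: forall_2)
  qed
qed

section \<open>Words and standard pairs\<close>

lemma num_ones_append [simp]: "num_ones (u @ v) = num_ones u + num_ones v"
  by (simp add: num_ones_def)

lemma num_ones_simps [simp]: "num_ones [] = 0" "num_ones (a # u) = of_bool a + num_ones u"
  by (simp_all add: num_ones_def)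

lemma num_ones_le_length: "num_ones u \<le> length u"
  by (simp add: num_ones_def count_le_length)

section \<open>Powers of words and the combinatorics of standard pairs\<close>

definition wpow :: "bool list \<Rightarrow> nat \<Rightarrow> bool list" where
  "wpow w k = concat (replicate k w)"

lemma wpow_simps [simp]: "wpow w 0 = []" "wpow w (Suc k) = w @ wpow w k"
  by (simp_all add: wpow_def)

lemma wpow_comm: "w @ wpow w k = wpow w k @ w"
  by (induction k) simp_all

lemma length_wpow [simp]: "length (wpow w k) = k * length w"
  by (induction k) simp_all

lemma num_ones_wpow [simp]: "num_ones (wpow w k) = k * num_ones w"
  by (induction k) simp_all

text \<open>Infinite words are indexed from \<open>1\<close>.\<close>

definition per :: "bool list \<Rightarrow> nat \<Rightarrow> bool" where
  "per w n = w ! ((n - 1) mod length w)"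

lemma per_prefix:
  assumes "w \<noteq> []"
  shows "map (per w) [1..<k * length w + 1] = wpow w k"
proof (induction k)
  case 0
  then show ?case by simp
next
  case (Suc k)
  have "[1..<Suc k * length w + 1] = [1..<k * length w + 1] @ map (\<lambda>i. i + (k * length w + 1)) [0..<length w]"
    using upt_add_eq_append[of 1 "k * length w + 1" "length w"] map_add_upt[of "k * length w + 1" "length w"]
    by (simp add: algebra_simps)
  moreover have "map (per w) (map (\<lambda>i. i + (k * length w + 1)) [0..<length w]) = w"
    by (rule nth_equalityI) (simp_all add: per_def)
  ultimately have "map (per w) [1..<Suc k * length w + 1] = wpow w k @ w"
    using Suc by simp
  then show ?case by (simp add: wpow_comm)
qed

text \<open>The slopes of \<open>u\<close> and \<open>v\<close> are Farey neighbours; both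
  generating rules preserve this determinant.\<close>

lemma standard_pair_det:
  assumes "(u, v) \<in> standard_pairs"
  shows "num_ones v * length u = num_ones u * length v + 1"
  using assms by induction (simp_all add: algebra_simps)

lemma standard_pair_nonempty:
  assumes "(u, v) \<in> standard_pairs"
  shows "u \<noteq> []" "v \<noteq> []"
  using assms by induction simp_all

lemma standard_pair_bounds:
  assumes "(u, v) \<in> standard_pairs"
  shows "num_ones u < length u" "0 < num_ones v"
proof -
  note d = standard_pair_det[OF assms]
  show "0 < num_ones v" using d by (cases "num_ones v") auto
  show "num_ones u < length u"
  proof (rule ccontr)
    assume "\<not> ?thesis"
    then have "num_ones u = length u" using num_ones_le_length[of u] by simp
    then have "num_ones v * length u = length u * length v + 1" using d by simp
    moreover have "num_ones v * length u \<le> length v * length u" using num_ones_le_length by simp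
    ultimately show False by (simp add: mult.commute)
  qed
qed

lemma standard_pair_slope_less:
  assumes "(u, v) \<in> standard_pairs"
  shows "slope v - slope u = 1 / (real (length u) * real (length v))"
proof -
  have "real (num_ones v) * real (length u) = real (num_ones u) * real (length v) + 1"
    using arg_cong[OF standard_pair_det[OF assms], of real] by simp
  then show ?thesis
    using standard_pair_nonempty[OF assms] by (simp add: slope_def field_simps)
qed

lemma standard_pair_iterate:
  assumes "(u, v) \<in> standard_pairs"
  shows "(u @ wpow v k, v) \<in> standard_pairs" "(u, v @ wpow u k) \<in> standard_pairs"
proof (induction k)
  case (Suc k)
  {
    case 1
    show ?case using standard_pairs.left[OF Suc(1)] by (simp add: wpow_comm)
  next
    case 2
    show ?case using standard_pairs.right[OF Suc(2)] by (simp add: wpow_comm)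
  }
qed (use assms in simp_all)

text \<open>Each component is a letter or a product from an earlier pair, so facts about products
  such as \<open>standard_pair_per_product\<close> pass to \<open>u\<close> and \<open>v\<close>
  themselves.\<close>

lemma standard_pair_members:
  assumes "(u, v) \<in> standard_pairs"
  shows "u = [False] \<or> (\<exists>a b. (a, b) \<in> standard_pairs \<and> u = a @ b)"
    and "v = [True] \<or> (\<exists>a b. (a, b) \<in> standard_pairs \<and> v = b @ a)"
proof -
  have "(u = [False] \<or> (\<exists>a b. (a, b) \<in> standard_pairs \<and> u = a @ b)) \<and>
     (v = [True] \<or> (\<exists>a b. (a, b) \<in> standard_pairs \<and> v = b @ a))"
    using assms by induction blast+
  then show "u = [False] \<or> (\<exists>a b. (a, b) \<in> standard_pairs \<and> u = a @ b)"
    and "v = [True] \<or> (\<exists>a b. (a, b) \<in> standard_pairs \<and> v = b @ a)" by auto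
qed

lemma standard_pair_common_suffix:
  assumes "(u, v) \<in> standard_pairs"
  obtains a b z where "u @ v = [a, b] @ z" "v @ u = [b, a] @ z"
proof -
  have "\<exists>a b z. u @ v = [a, b] @ z \<and> v @ u = [b, a] @ z"
    using assms
  proof induction
    case base
    have "[False] @ [True] = [False, True] @ []" "[True] @ [False] = [True, False] @ []" by simp_all
    then show ?case by blast
  next
    case (left u v)
    then obtain a b z where "u @ v = [a, b] @ z" "v @ u = [b, a] @ z" by blast
    then have "(u @ v) @ v = [a, b] @ z @ v" "v @ u @ v = [b, a] @ z @ v"
      by (metis append.assoc)+
    then show ?case by blast
  next
    case (right u v)
    then obtain a b z where "u @ v = [a, b] @ z" "v @ u = [b, a] @ z" by blast
    then have "u @ v @ u = [a, b] @ z @ u" "(v @ u) @ u = [b, a] @ z @ u"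
      by (metis append.assoc)+
    then show ?case by blast
  qed
  then show ?thesis using that by blast
qed

text \<open>\<open>z\<close> is a suffix of \<open>z w\<close>, hence of \<open>z w^k\<close> for
  every \<open>k\<close>; once \<open>w^k\<close> is at least as long as \<open>z\<close>, it
  contains this suffix.\<close>

lemma suffix_wpow:
  assumes "w \<noteq> []" "z @ w = y @ z"
  shows "\<exists>m y'. wpow w m = y' @ z"
proof -
  have "\<exists>y'. z @ wpow w m = y' @ z" for m
  proof (induction m)
    case (Suc m)
    then obtain y' where "z @ wpow w m = y' @ z" by blast
    then have "z @ wpow w (Suc m) = y' @ y @ z"
      by (metis append.assoc assms(2) wpow_comm wpow_simps(2))
    then show ?case by (metis append.assoc)
  qed simp
  then obtain y' where y': "z @ wpow w (length z) = y' @ z" by blast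
  have "length z \<le> length (wpow w (length z))" using assms(1) by (cases w) simp_all
  then obtain y'' where "wpow w (length z) = y'' @ z"
    using y' by (metis suffix_def suffix_length_suffix suffixI)
  then show ?thesis by blast
qed

text \<open>The word \<open>u v u\<close> reads both \<open>[a, b] z u\<close> and
  \<open>u [b, a] z\<close>, so \<open>z\<close> and \<open>z u\<close> are suffixes of the same
  word and \<open>z\<close> is a suffix of \<open>z u\<close>. As later letters act on the left,
  this puts the Perron vectors of \<open>u\<close> and \<open>v\<close> into the image of
  \<open>W 1 z\<close>.\<close>

lemma standard_pair_suffix_powers:
  assumes "(u, v) \<in> standard_pairs" "u @ v = [a, b] @ z" "v @ u = [b, a] @ z"
  shows "\<exists>m y. wpow u m = y @ z" "\<exists>m y. wpow v m = y @ z"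
proof -
  have suf: "\<exists>y. z @ w = y @ z" if "[c, d] @ z @ w = w @ [d, c] @ z" for w c d
  proof -
    have "suffix z (w @ [d, c] @ z)" by (auto simp: suffix_def intro!: exI[of _ "w @ [d, c]"])
    then have "suffix z ([c, d] @ z @ w)" unfolding that .
    moreover have "suffix (z @ w) ([c, d] @ z @ w)" by (rule suffixI) (rule refl)
    ultimately have "suffix z (z @ w)" by (rule suffix_length_suffix) simp
    then show ?thesis by (simp add: suffix_def)
  qed
  have "[a, b] @ z @ u = u @ [b, a] @ z" "[b, a] @ z @ v = v @ [a, b] @ z"
    using assms(2,3) by (metis append.assoc)+
  then show "\<exists>m y. wpow u m = y @ z" "\<exists>m y. wpow v m = y @ z"
    using suf suffix_wpow standard_pair_nonempty[OF assms(1)] by metis+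
qed

text \<open>\<open>offset_word e p q w\<close> says that the number of ones among the first \<open>n\<close> letters of \<open>w\<close> is
  \<open>\<lceil>((n - 1) p + e) / q\<rceil>\<close>. For a standard pair \<open>(u, v)\<close> of total length \<open>q\<close> with \<open>p\<close> ones, the
  product \<open>uv\<close> has this property with \<open>e = 0\<close> and \<open>vu\<close> has it with \<open>e = 1\<close>.\<close>

definition offset_word :: "int \<Rightarrow> int \<Rightarrow> int \<Rightarrow> bool list \<Rightarrow> bool" where
  "offset_word e p q w \<longleftrightarrow> (\<forall>n\<le>length w. (int (num_ones (take n w)) - 1) * q < (int n - 1) * p + e \<and>
      (int n - 1) * p + e \<le> int (num_ones (take n w)) * q)"

text \<open>For Farey neighbours \<open>p / q\<close> and \<open>p' / q'\<close>, the values
  \<open>m p / q\<close> and \<open>m p' / q'\<close> differ by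
  \<open>|m| / (q q') < 1 / q'\<close>, too little to change the ceiling. For \<open>e = 1\<close>
  the offset shrinks from \<open>1 / q\<close> to \<open>1 / q'\<close>, which \<open>q < q'\<close>
  absorbs.\<close>

lemma offset_word_transfer:
  assumes w: "offset_word e p q w" "int (length w) \<le> q" and e: "e = 0 \<or> e = 1"
    and det: "p' * q = p * q' + d" "\<bar>d\<bar> = 1" and q: "1 < q" "q < q'"
  shows "offset_word e p' q' w"
  unfolding offset_word_def
proof (intro allI impI)
  fix n assume n: "n \<le> length w"
  define m c where "m = int n - 1" and "c = int (num_ones (take n w))"
  have m: "-1 \<le> m" "m < q" using n w(2) by (auto simp: m_def)
  have lo: "(c - 1) * q + 1 \<le> m * p + e" and up: "m * p + e \<le> c * q"
    using w(1) n by (auto simp: offset_word_def m_def c_def)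
  have eq: "(m * p') * q = m * p * q' + d * m"
    using det(1) by (metis (no_types, opaque_lifting) distrib_left mult.assoc mult.commute)
  have "\<bar>d * m\<bar> = \<bar>m\<bar>" using det(2) by (simp add: abs_mult)
  then have dm: "d * m < q" "- q < d * m" using m q by linarith+
  have q0: "0 < q" "0 \<le> q'" using q by auto
  have "((c - 1) * q + 1) * q' \<le> (m * p + e) * q'" using lo q0 by (intro mult_right_mono) auto
  then have "((c - 1) * q') * q + q' \<le> m * p * q' + e * q'" by (simp add: algebra_simps)
  then have "((c - 1) * q') * q < (m * p') * q + e * q"
    unfolding eq using e dm q by (elim disjE; hypsubst; linarith)
  then have "((c - 1) * q') * q < (m * p' + e) * q" by (simp add: distrib_right)
  moreover have "(m * p + e) * q' \<le> c * q * q'" using up q0 by (intro mult_right_mono) auto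
  then have "m * p * q' + e * q' \<le> (c * q') * q" by (simp add: algebra_simps)
  then have "(m * p') * q + e * q < (c * q') * q + q"
    unfolding eq using e dm q by (elim disjE; hypsubst; linarith)
  then have "(m * p' + e) * q < (c * q' + 1) * q" by (simp add: distrib_right)
  ultimately show "(int (num_ones (take n w)) - 1) * q' < (int n - 1) * p' + e \<and>
      (int n - 1) * p' + e \<le> int (num_ones (take n w)) * q'"
    using q0 by (simp add: m_def c_def)
qed

lemma offset_word_prefix: "offset_word e p q (u @ v) \<Longrightarrow> offset_word e p q u"
  unfolding offset_word_def by (metis (no_types, lifting) length_append take_append
      diff_is_0_eq' take0 append_Nil2 trans_le_add1)

text \<open>Reading \<open>u\<close> advances the numerator by a multiple of \<open>q\<close> plus
  \<open>1 - 2 e\<close>, so the rest is read with offset \<open>1 - e\<close>. For a standard pair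
  the length condition is the determinant identity.\<close>

lemma offset_word_append:
  assumes "offset_word e p q u" "offset_word (1 - e) p q v" "int (length u) * p = int (num_ones u) * q + 1 - 2 * e"
  shows "offset_word e p q (u @ v)"
  unfolding offset_word_def
proof (intro allI impI)
  fix n assume n: "n \<le> length (u @ v)"
  show "(int (num_ones (take n (u @ v))) - 1) * q < (int n - 1) * p + e \<and>
      (int n - 1) * p + e \<le> int (num_ones (take n (u @ v))) * q"
  proof (cases "n \<le> length u")
    case True
    then show ?thesis using assms(1) by (simp add: offset_word_def)
  next
    case False
    define j where "j = n - length u"
    have j: "n = length u + j" "j \<le> length v" using False n by (auto simp: j_def)
    let ?c = "int (num_ones (take j v))"
    have "(?c - 1) * q < (int j - 1) * p + (1 - e)" "(int j - 1) * p + (1 - e) \<le> ?c * q"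
      using assms(2) j by (auto simp: offset_word_def)
    moreover have "(int n - 1) * p = int (num_ones u) * q + 1 - 2 * e + (int j - 1) * p"
      using assms(3) by (simp add: j algebra_simps)
    ultimately show ?thesis by (simp add: j distrib_right left_diff_distrib)
  qed
qed

lemma standard_pair_offset_word:
  assumes "(u, v) \<in> standard_pairs"
  shows "offset_word 0 (int (num_ones (u @ v))) (int (length (u @ v))) (u @ v)"
    and "offset_word 1 (int (num_ones (u @ v))) (int (length (u @ v))) (v @ u)"
proof -
  let ?Q = "\<lambda>u v. offset_word 0 (int (num_ones (u @ v))) (int (length (u @ v))) (u @ v) \<and>
      offset_word 1 (int (num_ones (u @ v))) (int (length (u @ v))) (v @ u)"
  have "?Q u v"
    using assms
  proof induction
    case base
    show ?case by (auto simp: offset_word_def le_Suc_eq)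
  next
    case (left u v)
    define p1 q1 p2 q2 where "p1 = int (num_ones u)" "q1 = int (length u)" "p2 = int (num_ones v)" "q2 = int (length v)"
    note defs = this
    have d: "p2 * q1 = p1 * q2 + 1"
      using standard_pair_det[OF left.hyps] unfolding defs by (metis of_nat_1 of_nat_add of_nat_mult)
    have q: "0 < q1" "0 < q2" using standard_pair_nonempty[OF left.hyps] by (auto simp: defs)
    let ?p = "p1 + p2 + p2" and ?q = "q1 + q2 + q2"
    \<comment> \<open>The old and the new slope are Farey neighbours, so the words already built can
      be re-read with the new slope before the last factor is appended. In the other rule the
      determinant is -1.\<close>
    have det: "?p * (q1 + q2) = (p1 + p2) * ?q + 1" using d by (simp add: algebra_simps)
    have "offset_word 0 (p1 + p2) (q1 + q2) (u @ v)" "offset_word 1 (p1 + p2) (q1 + q2) v"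
      using left.IH by (auto simp: defs intro: offset_word_prefix)
    note w0 = this
    have w: "offset_word 0 ?p ?q (u @ v)" "offset_word 1 ?p ?q v"
      by (rule offset_word_transfer[OF w0(1) _ _ det] offset_word_transfer[OF w0(2) _ _ det];
          use q in \<open>simp add: defs del: length_greater_0_conv\<close>)+
    have "offset_word 0 ?p ?q ((u @ v) @ v)" "offset_word 1 ?p ?q (v @ (u @ v))"
      by (rule offset_word_append; use w d in \<open>simp add: defs algebra_simps\<close>)+
    then show ?case by (simp add: defs algebra_simps)
  next
    case (right u v)
    define p1 q1 p2 q2 where "p1 = int (num_ones u)" "q1 = int (length u)" "p2 = int (num_ones v)" "q2 = int (length v)"
    note defs = this
    have d: "p2 * q1 = p1 * q2 + 1"
      using standard_pair_det[OF right.hyps] unfolding defs by (metis of_nat_1 of_nat_add of_nat_mult)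
    have q: "0 < q1" "0 < q2" using standard_pair_nonempty[OF right.hyps] by (auto simp: defs)
    let ?p = "p1 + p2 + p1" and ?q = "q1 + q2 + q1"
    have det: "?p * (q1 + q2) = (p1 + p2) * ?q + (-1)" using d by (simp add: algebra_simps)
    have "offset_word 0 (p1 + p2) (q1 + q2) u" "offset_word 1 (p1 + p2) (q1 + q2) (v @ u)"
      using right.IH by (auto simp: defs intro: offset_word_prefix)
    note w0 = this
    have w: "offset_word 0 ?p ?q u" "offset_word 1 ?p ?q (v @ u)"
      by (rule offset_word_transfer[OF w0(1) _ _ det] offset_word_transfer[OF w0(2) _ _ det];
          use q in \<open>simp add: defs del: length_greater_0_conv\<close>)+
    have "offset_word 0 ?p ?q (u @ (v @ u))" "offset_word 1 ?p ?q ((v @ u) @ u)"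
      by (rule offset_word_append; use w d in \<open>simp add: defs algebra_simps\<close>)+
    then show ?case by (simp add: defs algebra_simps)
  qed
  then show "offset_word 0 (int (num_ones (u @ v))) (int (length (u @ v))) (u @ v)"
    and "offset_word 1 (int (num_ones (u @ v))) (int (length (u @ v))) (v @ u)" by auto
qed

lemma offset_word_per:
  assumes "offset_word e (int (num_ones w)) (int (length w)) w" "w \<noteq> []"
  shows "per w \<in> sturmian_set (slope w)"
proof -
  define p q where "p = int (num_ones w)" and "q = int (length w)"
  have q: "0 < q" using assms(2) by (simp add: q_def)
  have sl: "slope w = of_int p / of_int q" by (simp add: slope_def p_def q_def)
  have ceil: "\<lceil>slope w * (real k * real (length w) + real i - 1) + of_int e / of_int q\<rceil> = int k * p + int (num_ones (take i w))"
    if "i \<le> length w" for i k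
  proof -
    let ?c = "int (num_ones (take i w))"
    have "(?c - 1) * q < (int i - 1) * p + e" "(int i - 1) * p + e \<le> ?c * q"
      using assms(1) that by (auto simp: offset_word_def p_def q_def)
    then have "real_of_int ((?c - 1) * q) < of_int ((int i - 1) * p + e)" "real_of_int ((int i - 1) * p + e) \<le> of_int (?c * q)"
      by (simp_all only: of_int_less_iff of_int_le_iff)
    then have "real_of_int (?c - 1) < of_int ((int i - 1) * p + e) / of_int q"
      "of_int ((int i - 1) * p + e) / of_int q \<le> real_of_int ?c"
      using q by (simp_all add: pos_less_divide_eq pos_divide_le_eq del: of_int_diff of_int_add of_int_of_nat_eq)
    moreover have "slope w * (real k * real (length w) + real i - 1) + of_int e / of_int q
        = of_int (int k * p) + of_int ((int i - 1) * p + e) / of_int q"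
      using q by (simp add: sl q_def field_simps)
    ultimately show ?thesis
      by (intro ceiling_unique) simp_all
  qed
  \<comment> \<open>\<open>offset_word\<close> uses \<open>n - 1\<close> for the first
    \<open>n\<close> letters, and letter \<open>n\<close> is the difference of the counts for
    \<open>n\<close> and \<open>n - 1\<close>; together this shifts the intercept by
    \<open>2 * slope w\<close>.\<close>
  let ?\<delta> = "- 2 * slope w + of_int e / of_int q"
  have "of_bool (per w n) = \<lceil>slope w * real (n + 1) + ?\<delta>\<rceil> - \<lceil>slope w * real n + ?\<delta>\<rceil>" if "1 \<le> n" for n
  proof -
    define k i where "k = (n - 1) div length w" and "i = (n - 1) mod length w"
    have i: "i < length w" using assms(2) by (simp add: i_def)
    have "n - 1 = k * length w + i" by (simp add: k_def i_def)
    then have n: "real n = real k * real (length w) + real i + 1"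
      using that by (metis (no_types, lifting) Suc_diff_1 Suc_le_eq add.commute One_nat_def of_nat_Suc of_nat_add of_nat_mult)
    have e1: "slope w * real (n + 1) + ?\<delta> = slope w * (real k * real (length w) + real (Suc i) - 1) + of_int e / of_int q"
      using n by (simp add: algebra_simps)
    have e2: "slope w * real n + ?\<delta> = slope w * (real k * real (length w) + real i - 1) + of_int e / of_int q"
      using n by (simp add: algebra_simps)
    have "per w n = w ! i" by (simp add: per_def i_def)
    then show ?thesis unfolding e1 e2 using ceil[of "Suc i" k] ceil[of i k] i
      by (simp add: take_Suc_conv_app_nth)
  qed
  then show ?thesis unfolding sturmian_set_def by blast
qed

lemma standard_pair_per_product:
  assumes "(u, v) \<in> standard_pairs"
  shows "per (u @ v) \<in> sturmian_set (slope (u @ v))" "per (v @ u) \<in> sturmian_set (slope (v @ u))"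
  using offset_word_per[of 0 "u @ v"] offset_word_per[of 1 "v @ u"]
    standard_pair_offset_word[OF assms] standard_pair_nonempty[OF assms]
  by (simp_all add: add.commute)

lemma standard_pair_per:
  assumes "(u, v) \<in> standard_pairs"
  shows "per u \<in> sturmian_set (slope u)" "per v \<in> sturmian_set (slope v)"
proof -
  have "per [False] \<in> sturmian_set (slope [False])"
    unfolding sturmian_set_def by (auto simp: per_def slope_def)
  then show "per u \<in> sturmian_set (slope u)"
    using standard_pair_members(1)[OF assms] standard_pair_per_product(1) by metis
  have "per [True] \<in> sturmian_set (slope [True])"
    unfolding sturmian_set_def by (auto simp: per_def slope_def intro!: exI[of _ 0])
  then show "per v \<in> sturmian_set (slope v)"
    using standard_pair_members(2)[OF assms] standard_pair_per_product(2) by metis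
qed

text \<open>A window of length \<open>L\<close> contains \<open>L p / q\<close> ones up to an error
  below 1. The two numerical hypotheses say that on average it contains at least one of each
  letter.\<close>

lemma standard_pair_windows:
  assumes "(u, v) \<in> standard_pairs" "sublist w (u @ v)"
  defines "p \<equiv> num_ones (u @ v)" and "q \<equiv> length (u @ v)"
  assumes "q \<le> length w * p" "q \<le> length w * (q - p)"
  shows "0 < num_ones w" "num_ones w < length w"
proof -
  obtain a b where ab: "u @ v = a @ w @ b" using assms(2) by (auto simp: sublist_def)
  define L where "L = length w"
  have c: "offset_word 0 (int p) (int q) (a @ w @ b)"
    using standard_pair_offset_word(1)[OF assms(1)] by (simp add: ab p_def q_def)
  have pq: "p < q" using standard_pair_bounds[OF assms(1)] num_ones_le_length[of v] by (simp add: p_def q_def)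
  have q0: "0 < int q" using pq by simp
  have "(int (num_ones a) - 1) * int q < (int (length a) - 1) * int p" "(int (length a) - 1) * int p \<le> int (num_ones a) * int q"
    using c[unfolded offset_word_def, rule_format, of "length a"] by auto
  moreover have "(int (num_ones a + num_ones w) - 1) * int q < (int (length a + L) - 1) * int p"
     "(int (length a + L) - 1) * int p \<le> int (num_ones a + num_ones w) * int q"
    using c[unfolded offset_word_def, rule_format, of "length a + L"] by (auto simp: L_def)
  ultimately have lo: "int L * int p < (int (num_ones w) + 1) * int q" and up: "(int (num_ones w) - 1) * int q < int L * int p"
    by (simp_all add: algebra_simps)
  have h1: "int q \<le> int L * int p" using assms(5) by (metis L_def of_nat_le_iff of_nat_mult)
  have h2: "int q \<le> int L * (int q - int p)"
    using assms(6) pq by (metis L_def less_imp_le of_nat_diff of_nat_le_iff of_nat_mult)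
  have "1 * int q < (int (num_ones w) + 1) * int q" using lo h1 by simp
  then show "0 < num_ones w" using q0 by simp
  have "(int (num_ones w) - 1) * int q < (int L - 1) * int q" using up h2 by (simp add: algebra_simps)
  then show "num_ones w < length w" using q0 by (simp add: L_def)
qed

section \<open>Standard pairs and Farey fractions\<close>

lemma coprime_diff:
  fixes a b :: nat
  assumes "coprime a b"
  shows "a < b \<Longrightarrow> coprime a (b - a)" "a < b \<Longrightarrow> coprime (b - a) a" "b < a \<Longrightarrow> coprime (a - b) b"
  using assms gcd_diff1_nat[of a b] gcd_diff1_nat[of b a]
  by (simp_all add: coprime_iff_gcd_eq_1 gcd.commute[of a])

text \<open>Subtractive Euclidean algorithm on \<open>(a, b)\<close>: the combination
  \<open>a u + b v\<close> equals \<open>a (uv) + (b - a) v\<close> or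
  \<open>(a - b) u + b (vu)\<close>, a smaller combination of a later pair.\<close>

lemma exists_standard_pair_combination:
  fixes a b :: nat
  assumes "(u, v) \<in> standard_pairs" "0 < a" "0 < b" "coprime a b"
  shows "\<exists>u' v'. (u', v') \<in> standard_pairs \<and>
     num_ones (u' @ v') = a * num_ones u + b * num_ones v \<and> length (u' @ v') = a * length u + b * length v"
  using assms
proof (induction "a + b" arbitrary: a b u v rule: less_induct)
  case less
  consider "a = b" | "a < b" | "b < a" by linarith
  then show ?case
  proof cases
    case 1
    then have "a = 1" "b = 1" using less.prems by auto
    then show ?thesis using less.prems(1) by (intro exI[of _ u] exI[of _ v]) simp
  next
    case 2
    have "\<exists>u' v'. (u', v') \<in> standard_pairs \<and>
       num_ones (u' @ v') = a * num_ones (u @ v) + (b - a) * num_ones v \<and> length (u' @ v') = a * length (u @ v) + (b - a) * length v"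
      using 2 less.prems by (intro less.hyps standard_pairs.left)
        (simp_all add: coprime_diff)
    moreover have "a * x + (b - a) * x = b * x" for x :: nat
      using 2 by (metis add_diff_inverse_nat add_mult_distrib not_less_iff_gr_or_eq)
    ultimately show ?thesis by (simp add: distrib_left add.assoc)
  next
    case 3
    have "\<exists>u' v'. (u', v') \<in> standard_pairs \<and>
       num_ones (u' @ v') = (a - b) * num_ones u + b * num_ones (v @ u) \<and> length (u' @ v') = (a - b) * length u + b * length (v @ u)"
      using 3 less.prems by (intro less.hyps standard_pairs.right)
        (simp_all add: coprime_diff)
    moreover have "(a - b) * x + (b * y + b * x) = a * x + b * y" for x y :: nat
      using 3 by (metis add.commute add.left_commute add_diff_inverse_nat add_mult_distrib not_less_iff_gr_or_eq)
    ultimately show ?thesis by (simp add: distrib_left)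
  qed
qed

lemma exists_standard_pair:
  assumes "0 < p" "p < q" "coprime p q"
  shows "\<exists>u v. (u, v) \<in> standard_pairs \<and> num_ones (u @ v) = p \<and> length (u @ v) = q"
proof -
  have "coprime (q - p) p" using assms by (simp add: coprime_diff)
  from exists_standard_pair_combination[OF standard_pairs.base _ _ this]
  show ?thesis using assms by auto
qed

lemma standard_pair_coprime:
  assumes "(u, v) \<in> standard_pairs"
  shows "coprime (num_ones (u @ v)) (length (u @ v))"
proof (rule coprimeI)
  fix c assume c: "c dvd num_ones (u @ v)" "c dvd length (u @ v)"
  have "c dvd length u * num_ones (u @ v)" "c dvd num_ones u * length (u @ v)" using c by auto
  moreover have "length u * num_ones (u @ v) = num_ones u * length (u @ v) + 1"
    using standard_pair_det[OF assms] by (simp add: algebra_simps)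
  ultimately show "is_unit c" by (metis dvd_add_right_iff)
qed

lemma standard_pair_of_slope:
  assumes "(u, v) \<in> standard_pairs" "slope (u @ v) = real p / real q" "coprime p q" "0 < q"
  shows "num_ones (u @ v) = p" "length (u @ v) = q"
proof -
  let ?p = "num_ones (u @ v)" and ?q = "length (u @ v)"
  have q: "0 < ?q" using standard_pair_nonempty[OF assms(1)] by simp
  have "real ?p * real q = real p * real ?q"
    using assms(2,4) q unfolding slope_def by (simp add: frac_eq_eq del: of_nat_add length_append num_ones_append)
  then have e: "?p * q = p * ?q" by (metis of_nat_eq_iff of_nat_mult)
  have "?q dvd ?p * q" "q dvd p * ?q" using e by (metis dvd_triv_right)+
  then have "?q dvd q" "q dvd ?q"
    using standard_pair_coprime[OF assms(1)] assms(3) by (metis coprime_commute coprime_dvd_mult_right_iff)+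
  then show "?q = q" by (rule dvd_antisym)
  with e q assms(4) show "?p = p" by auto
qed

text \<open>The slopes are the neighbours of \<open>\<gamma>\<close> among the fractions of
  denominator at most \<open>m\<close>. Passing to \<open>m + 1\<close> splits this Farey interval
  at the mediant exactly when the mediant has length \<open>m + 1\<close>.\<close>

lemma irrational_farey:
  assumes "\<gamma> \<notin> \<rat>" "0 < \<gamma>" "\<gamma> < 1" "1 \<le> m"
  shows "\<exists>u v. (u, v) \<in> standard_pairs \<and> slope u < \<gamma> \<and> \<gamma> < slope v \<and>
     length u \<le> m \<and> length v \<le> m \<and> m < length u + length v"
  using assms(4)
proof (induction m rule: dec_induct)
  case base
  show ?case using assms by (intro exI[of _ "[False]"] exI[of _ "[True]"]) (simp add: standard_pairs.base slope_def)
next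
  case (step m)
  then obtain u v where uv: "(u, v) \<in> standard_pairs" "slope u < \<gamma>" "\<gamma> < slope v"
     "length u \<le> m" "length v \<le> m" "m < length u + length v" by blast
  show ?case
  proof (cases "Suc m < length u + length v")
    case True
    then show ?thesis using uv by (intro exI[of _ u] exI[of _ v]) auto
  next
    case False
    then have l: "length u + length v = Suc m" using uv by simp
    have ne: "0 < length u" "0 < length v" using standard_pair_nonempty[OF uv(1)] by auto
    have "slope (u @ v) \<in> \<rat>" by (simp add: slope_def)
    then have "\<gamma> < slope (u @ v) \<or> slope (u @ v) < \<gamma>" using assms(1) linorder_cases by blast
    then show ?thesis
    proof
      assume "\<gamma> < slope (u @ v)"
      then have "\<gamma> < slope (v @ u)" by (simp add: slope_def add.commute)
      then show ?thesis using uv l ne standard_pairs.right[OF uv(1)]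
        by (intro exI[of _ u] exI[of _ "v @ u"]) (auto simp del: length_greater_0_conv)
    next
      assume "slope (u @ v) < \<gamma>"
      then show ?thesis using uv l ne standard_pairs.left[OF uv(1)]
        by (intro exI[of _ "u @ v"] exI[of _ v]) (auto simp del: length_greater_0_conv)
    qed
  qed
qed

section \<open>Growth of matrix products\<close>

lemma matrix_list_prod_append:
  "matrix_list_prod (Bs @ Cs) = matrix_list_prod Cs ** matrix_list_prod Bs"
proof (induction Cs rule: rev_induct)
  case (snoc C Cs)
  have "matrix_list_prod (Ds @ [C]) = C ** matrix_list_prod Ds" for Ds
    by (simp add: matrix_list_prod_def)
  then show ?case using snoc by (metis append.assoc matrix_mul_assoc)
qed (simp add: matrix_list_prod_def)

lemma word_matrix_Nil [simp]: "word_matrix A0 A1 \<alpha> [] = mat 1"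
  by (simp add: word_matrix_def matrix_list_prod_def)

lemma word_matrix_append: "word_matrix A0 A1 \<alpha> (u @ v) = word_matrix A0 A1 \<alpha> v ** word_matrix A0 A1 \<alpha> u"
  by (simp add: word_matrix_def matrix_list_prod_append)

lemma word_matrix_single: "word_matrix A0 A1 \<alpha> [a] = letter_matrix A0 A1 \<alpha> a"
  by (simp add: word_matrix_def matrix_list_prod_def)

lemma word_matrix_Cons: "word_matrix A0 A1 \<alpha> (a # u) = word_matrix A0 A1 \<alpha> u ** letter_matrix A0 A1 \<alpha> a"
  using word_matrix_append[of A0 A1 \<alpha> "[a]" u] by (simp add: word_matrix_single)

lemma word_matrix_scale: "word_matrix A0 A1 \<alpha> u = \<alpha> ^ num_ones u *\<^sub>R word_matrix A0 A1 1 u"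
  by (induction u) (auto simp: word_matrix_Cons letter_matrix_def intro!: matrix2_eqI simp: algebra_simps)

lemma word_matrix_wpow: "word_matrix A0 A1 \<alpha> (wpow w k) = matrix_power (word_matrix A0 A1 \<alpha> w) k"
  by (induction k) (simp_all add: word_matrix_append matrix_power_Suc2)

lemma perron_pos_det:
  assumes "nonneg_mat M" "det M \<noteq> 0"
  shows "0 < perron M"
proof (rule ccontr)
  assume "\<not> ?thesis"
  then have "perron M = 0" using perron_nonneg[OF assms(1)] by simp
  then show False using perron_det[OF assms(1)] assms(2) by simp
qed

lemma root_norm_power_limit:
  assumes "nonneg_mat M" "0 < perron M"
  shows "(\<lambda>n. root n (norm (matrix_power M n))) \<longlonglongrightarrow> perron M"
proof -
  obtain c where c: "0 \<le> c" "\<And>n. msum (matrix_power M n) \<le> (4 + c * real n) * perron M ^ n"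
    using msum_power_le[OF assms] by blast
  let ?p = "perron M"
  have lo: "?p * root n (1/4) \<le> root n (norm (matrix_power M n))" if "n > 0" for n
  proof -
    have "?p * root n (1/4) = root n (?p ^ n * (1/4))"
      using that assms(2) by (simp only: real_root_mult real_root_power_cancel[of n "perron M"] less_imp_le)
    also have "?p ^ n * (1/4) \<le> norm (matrix_power M n)"
      using perron_power_le_msum[OF assms(1), of n] msum_le_norm[of "matrix_power M n"] by simp
    finally show ?thesis using that by simp
  qed
  have up: "root n (norm (matrix_power M n)) \<le> ?p * (root n (4 + c) * root n (real n))" if "n > 0" for n
  proof -
    have "norm (matrix_power M n) \<le> (4 + c * real n) * ?p ^ n"
      using norm_le_msum[OF nonneg_matrix_power[OF assms(1)], of n] c(2)[of n] by simp
    also have "4 + c * real n \<le> (4 + c) * real n" using that c(1) by (simp add: algebra_simps)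
    finally have "norm (matrix_power M n) \<le> ?p ^ n * ((4 + c) * real n)"
      using assms(2) by (simp add: mult.commute mult_right_mono)
    then have "root n (norm (matrix_power M n)) \<le> root n (?p ^ n * ((4 + c) * real n))"
      using that by simp
    also have "\<dots> = ?p * (root n (4 + c) * root n (real n))"
      using that assms(2) by (simp add: real_root_mult real_root_power_cancel)
    finally show ?thesis .
  qed
  have l1: "(\<lambda>n. ?p * root n (1/4)) \<longlonglongrightarrow> ?p * 1"
    by (intro tendsto_mult tendsto_const LIMSEQ_root_const) simp
  have l2: "(\<lambda>n. ?p * (root n (4 + c) * root n (real n))) \<longlonglongrightarrow> ?p * (1 * 1)"
    using c(1) by (intro tendsto_mult tendsto_const LIMSEQ_root_const LIMSEQ_root) simp
  show ?thesis
  proof (rule tendsto_sandwich)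
    show "\<forall>\<^sub>F n in sequentially. ?p * root n (1/4) \<le> root n (norm (matrix_power M n))"
      using eventually_gt_at_top[of 0] by eventually_elim (rule lo)
    show "\<forall>\<^sub>F n in sequentially. root n (norm (matrix_power M n)) \<le> ?p * (root n (4 + c) * root n (real n))"
      using eventually_gt_at_top[of 0] by eventually_elim (rule up)
  qed (use l1 l2 in simp_all)
qed

lemma num_ones_replicate: "num_ones (replicate n a) = n * of_bool a"
  by (induction n) auto

lemma finite_words: "finite {w :: bool list. length w = n}"
  using finite_lists_length_eq[of "UNIV :: bool set" n] by simp

lemma nonempty_words: "{w :: bool list. length w = n} \<noteq> {}"
  by (auto intro: exI[of _ "replicate n True"])

lemma jsr_words:
  "jsr A0 A1 \<alpha> = lim (\<lambda>n. Max ((\<lambda>w. root n (norm (word_matrix A0 A1 \<alpha> w))) ` {w. length w = n}))"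
proof -
  have "{Bs. length Bs = n \<and> set Bs \<subseteq> {A0, \<alpha> *\<^sub>R A1}} = map (letter_matrix A0 A1 \<alpha>) ` {w. length w = n}" (is "?L = ?R") for n
  proof (intro set_eqI iffI)
    fix Bs assume "Bs \<in> ?L"
    then have Bs: "length Bs = n" "set Bs \<subseteq> range (letter_matrix A0 A1 \<alpha>)"
      by (auto simp: letter_matrix_def UNIV_bool)
    then obtain w where "Bs = map (letter_matrix A0 A1 \<alpha>) w" by (metis ex_map_conv image_iff subset_iff)
    then show "Bs \<in> ?R" using Bs by auto
  qed (auto simp: letter_matrix_def)
  then have "{root n (norm (matrix_list_prod Bs)) | Bs. length Bs = n \<and> set Bs \<subseteq> {A0, \<alpha> *\<^sub>R A1}} =
     (\<lambda>w. root n (norm (word_matrix A0 A1 \<alpha> w))) ` {w. length w = n}" for n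
    unfolding word_matrix_def by (auto simp: setcompr_eq_image image_image)
  then show ?thesis by (simp add: jsr_def joint_spectral_radius_def)
qed

definition prefix_of :: "(nat \<Rightarrow> bool) \<Rightarrow> nat \<Rightarrow> bool list" where
  "prefix_of x n = map x [1..<n+1]"

lemma length_prefix_of [simp]: "length (prefix_of x n) = n"
  by (simp add: prefix_of_def)

lemma prefix_of_Suc: "prefix_of x (Suc n) = prefix_of x n @ [x (Suc n)]"
  by (simp add: prefix_of_def)

lemma prefix_of_0 [simp]: "prefix_of x 0 = []"
  by (simp add: prefix_of_def)

lemma num_ones_prefix: "num_ones (prefix_of x n) = card {i. 1 \<le> i \<and> i \<le> n \<and> x i}"
proof (induction n)
  case (Suc n)
  have "{i. 1 \<le> i \<and> i \<le> Suc n \<and> x i} = (if x (Suc n) then insert (Suc n) {i. 1 \<le> i \<and> i \<le> n \<and> x i} else {i. 1 \<le> i \<and> i \<le> n \<and> x i})"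
    by (auto simp: le_Suc_eq)
  moreover have "finite {i. 1 \<le> i \<and> i \<le> n \<and> x i}" by (rule finite_subset[of _ "{..n}"]) auto
  ultimately show ?case using Suc by (simp add: prefix_of_Suc)
next
  case 0
  have "{i. 1 \<le> i \<and> i \<le> 0 \<and> x i} = {}" by auto
  then show ?case by (simp only: prefix_of_0 num_ones_simps card.empty)
qed

locale matrix_pair =
  fixes A0 A1 :: "real^2^2"
  assumes technical: "technical_hypotheses A0 A1"
begin

abbreviation W :: "real \<Rightarrow> bool list \<Rightarrow> real^2^2" where
  "W \<equiv> word_matrix A0 A1"

abbreviation \<rho> :: "bool list \<Rightarrow> real" where
  "\<rho> u \<equiv> perron (W 1 u)"

lemma nonneg_A: "nonneg_mat A0" "nonneg_mat A1"
  and det_A: "det A0 \<noteq> 0" "det A1 \<noteq> 0"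
  and trace_A: "0 < trace A0" "0 < trace A1"
  using technical by (auto simp: technical_hypotheses_def nonneg_mat_def invertible_det_nz)

lemma no_common_eigenvector:
  fixes x :: "real^2"
  assumes "A0 *v x = s *\<^sub>R x" "A1 *v x = t *\<^sub>R x"
  shows "x = 0"
proof (rule ccontr)
  assume x: "x \<noteq> 0"
  have "dim (span {x}) = 1"
    using x dim_eq_card_independent[of "{x}"] by (simp only: dim_span) simp
  moreover have "(\<lambda>y. A *v y) ` span {x} \<subseteq> span {x}" if "A *v x = c *\<^sub>R x" for A :: "real^2^2" and c
    using that by (auto simp: span_singleton matrix_vector_mult_scaleR)
  moreover have "\<not> (\<exists>V::(real^2) set. subspace V \<and> dim V = 1 \<and>
           (\<lambda>x. A0 *v x) ` V \<subseteq> V \<and> (\<lambda>x. A1 *v x) ` V \<subseteq> V)"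
    using technical unfolding technical_hypotheses_def by (elim conjE)
  ultimately show False
    using assms subspace_span[of "{x}"] by blast
qed

lemma nonneg_W: "0 \<le> \<alpha> \<Longrightarrow> nonneg_mat (W \<alpha> u)"
  by (induction u)
     (simp_all add: nonneg_mat_one word_matrix_Cons letter_matrix_def nonneg_mat_mult nonneg_A nonneg_mat_scale)

lemma pos_W:
  assumes "0 < num_ones u" "num_ones u < length u"
  shows "pos_mat (W 1 u)"
proof -
  have "u \<noteq> []" using assms by auto
  moreover have "u \<noteq> replicate n True" for n
    using assms(2) by (auto simp: num_ones_replicate)
  moreover have "u \<noteq> replicate n False" for n
    using assms(1) by (auto simp: num_ones_replicate)
  ultimately show ?thesis
    using technical unfolding technical_hypotheses_def pos_mat_def by blast
qed

lemma det_W: "det (W 1 u) \<noteq> 0"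
  by (induction u) (simp_all add: word_matrix_Cons letter_matrix_def det_mul det_A)

lemma \<rho>_pos: "0 < \<rho> u"
  by (intro perron_pos_det nonneg_W det_W) simp

lemma perron_W: "0 \<le> \<alpha> \<Longrightarrow> perron (W \<alpha> u) = \<alpha> ^ num_ones u * \<rho> u"
  by (simp add: word_matrix_scale[of A0 A1 \<alpha> u] perron_scale)

lemma perron_W_pos: "0 < \<alpha> \<Longrightarrow> 0 < perron (W \<alpha> u)"
  by (subst perron_W) (simp_all add: \<rho>_pos)

lemma msum_W_pos: "0 < \<alpha> \<Longrightarrow> 0 < msum (W \<alpha> u)"
  using perron_W_pos[of \<alpha> u] perron_le_msum[OF nonneg_W[of \<alpha> u]] by simp

lemma msum_W_append: "0 \<le> \<alpha> \<Longrightarrow> msum (W \<alpha> (u @ v)) \<le> msum (W \<alpha> v) * msum (W \<alpha> u)"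
  by (simp add: word_matrix_append msum_mult_le nonneg_W)

text \<open>The logarithm of the joint spectral radius. As a supremum of Perron roots it is
  available before the limit in \<open>jsr\<close> is known to exist, and each of its terms is
  affine in \<open>ln \<alpha>\<close>.\<close>

definition growth :: "real \<Rightarrow> real" where
  "growth \<alpha> = (SUP w\<in>{w. w \<noteq> []}. ln (perron (W \<alpha> w)) / length w)"

lemma perron_le_growth:
  assumes "0 < \<alpha>" "w \<noteq> []"
  shows "perron (W \<alpha> w) \<le> exp (real (length w) * growth \<alpha>)"
proof -
  define K where "K = max 1 (max (msum A0) (msum (\<alpha> *\<^sub>R A1)))"
  have K: "1 \<le> K" "\<And>a. msum (letter_matrix A0 A1 \<alpha> a) \<le> K" by (auto simp: K_def letter_matrix_def)
  have ms: "msum (W \<alpha> u) \<le> 2 * K ^ length u" for u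
  proof (induction u)
    case (Cons a u)
    have "msum (W \<alpha> (a # u)) \<le> msum (W \<alpha> u) * msum (letter_matrix A0 A1 \<alpha> a)"
      using msum_W_append[of \<alpha> "[a]" u] assms(1) by (simp add: word_matrix_single)
    also have "\<dots> \<le> (2 * K ^ length u) * K"
      using Cons K msum_W_pos[OF assms(1), of "[a]"] by (intro mult_mono) (auto simp: word_matrix_single)
    finally show ?case by (simp add: mult.commute mult.left_commute)
  qed (simp add: msum_def)
  \<comment> \<open>Without an upper bound the supremum in \<open>growth\<close> would be
    unspecified.\<close>
  have bdd: "bdd_above ((\<lambda>w. ln (perron (W \<alpha> w)) / length w) ` {w. w \<noteq> []})"
  proof (rule bdd_aboveI2)
    fix u :: "bool list" assume "u \<in> {w. w \<noteq> []}"
    then have l: "1 \<le> real (length u)" by (cases u) auto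
    have "ln (perron (W \<alpha> u)) \<le> ln (2 * K ^ length u)"
      using perron_W_pos[OF assms(1), of u] perron_le_msum[OF nonneg_W[of \<alpha> u]] ms[of u] assms(1)
      by (subst ln_le_cancel_iff) auto
    also have "\<dots> = ln 2 + length u * ln K" using K(1) by (simp add: ln_mult ln_realpow)
    also have "\<dots> \<le> length u * (ln 2 + ln K)" using l by (simp add: algebra_simps)
    finally show "ln (perron (W \<alpha> u)) / length u \<le> ln 2 + ln K"
      using l by (subst pos_divide_le_eq) (auto simp add: mult.commute)
  qed
  have "ln (perron (W \<alpha> w)) / length w \<le> growth \<alpha>"
    unfolding growth_def by (rule cSUP_upper[OF _ bdd]) (use assms(2) in simp)
  then have "ln (perron (W \<alpha> w)) \<le> length w * growth \<alpha>"
    using assms(2) by (simp add: field_simps)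
  then show ?thesis using perron_W_pos[OF assms(1), of w] by (metis exp_le_cancel_iff exp_ln)
qed

text \<open>Appending the letters \<open>01\<close> multiplies by a positive matrix, after which the trace is comparable to the sum
  of the entries.\<close>

lemma msum_le_growth:
  assumes "0 < \<alpha>"
  obtains C where "0 < C" "\<And>w. msum (W \<alpha> w) \<le> C * exp (real (length w) * growth \<alpha>)"
proof -
  let ?K = "W \<alpha> [False, True]"
  have "pos_mat (W 1 [False, True])" by (rule pos_W) auto
  then have K: "pos_mat ?K"
    using assms by (simp add: word_matrix_scale[of A0 A1 \<alpha> "[False, True]"] pos_mat_def)
  define k where "k = min (min (?K$1$1) (?K$1$2)) (min (?K$2$1) (?K$2$2))"
  have k: "0 < k" using K by (auto simp: k_def pos_mat_2)
  have kK: "k \<le> ?K$1$1" "k \<le> ?K$1$2" "k \<le> ?K$2$1" "k \<le> ?K$2$2" by (auto simp: k_def)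
  show ?thesis
  proof
    \<comment> \<open>The factor \<open>exp (2 * growth \<alpha>)\<close> pays for the two appended
      letters, \<open>k\<close> is the least entry of their matrix, and 2 comes from the trace being
      at most twice the Perron root.\<close>
    show "0 < 2 * exp (2 * growth \<alpha>) / k" using k by simp
    fix w
    have M: "nonneg_mat (W \<alpha> w)" using assms by (simp add: nonneg_W)
    have "k * msum (W \<alpha> w) \<le> trace (?K ** W \<alpha> w)"
    proof -
      let ?M = "W \<alpha> w"
      have "k * ?M$1$1 \<le> ?K$1$1 * ?M$1$1" "k * ?M$1$2 \<le> ?K$2$1 * ?M$1$2"
         "k * ?M$2$1 \<le> ?K$1$2 * ?M$2$1" "k * ?M$2$2 \<le> ?K$2$2 * ?M$2$2"
        using M kK by (auto simp: nonneg_mat_2 intro!: mult_right_mono)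
      then show ?thesis by (simp add: msum_def trace2 distrib_left)
    qed
    also have "\<dots> \<le> 2 * perron (?K ** W \<alpha> w)"
      using perron_ge_half_trace[of "?K ** W \<alpha> w"] M K by (simp add: nonneg_mat_mult pos_mat_imp_nonneg)
    also have "\<dots> = 2 * perron (W \<alpha> (w @ [False, True]))" by (simp add: word_matrix_append)
    also have "\<dots> \<le> 2 * exp (real (length w + 2) * growth \<alpha>)"
      using perron_le_growth[OF assms, of "w @ [False, True]"] by simp
    also have "\<dots> = 2 * exp (2 * growth \<alpha>) * exp (real (length w) * growth \<alpha>)"
      by (simp add: exp_add[symmetric] algebra_simps)
    finally show "msum (W \<alpha> w) \<le> 2 * exp (2 * growth \<alpha>) / k * exp (real (length w) * growth \<alpha>)"
      using k by (simp add: field_simps)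
  qed
qed

text \<open>Take powers of one nearly optimal word \<open>w\<close> and cut them at length
  \<open>n\<close>. The part cut off is at most as long as \<open>w\<close>, so its product is
  bounded independently of \<open>n\<close>.\<close>

lemma growth_attained_approx:
  assumes "0 < \<alpha>" "0 < e"
  obtains K where "\<And>n. \<exists>w. length w = n \<and> exp (real n * (growth \<alpha> - e) - K) \<le> msum (W \<alpha> w)"
proof -
  obtain C where C: "0 < C" "\<And>w. msum (W \<alpha> w) \<le> C * exp (real (length w) * growth \<alpha>)"
    using msum_le_growth[OF assms(1)] by blast
  have "\<exists>w\<in>{w. w \<noteq> []}. growth \<alpha> - e < ln (perron (W \<alpha> w)) / length w"
  proof (rule ccontr)
    assume "\<not> ?thesis"
    then have "growth \<alpha> \<le> growth \<alpha> - e"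
      unfolding growth_def by (intro cSUP_least) (auto intro: exI[of _ "[True]"] simp: not_less)
    then show False using assms(2) by simp
  qed
  then obtain w where w: "w \<noteq> []" "growth \<alpha> - e < ln (perron (W \<alpha> w)) / length w" by blast
  then have w': "real (length w) * (growth \<alpha> - e) \<le> ln (perron (W \<alpha> w))" by (simp add: field_simps)
  define K where "K = ln C + real (length w) * e"
  show ?thesis
  proof
    fix n
    define k where "k = Suc (n div length w)"
    define u v where "u = take n (wpow w k)" and "v = drop n (wpow w k)"
    have "n \<le> k * length w" "k * length w \<le> n + length w"
      using w(1) by (simp_all add: k_def) (metis add.commute dividend_less_div_times less_imp_le length_greater_0_conv)
    then have lu: "length u = n" and lv: "length v \<le> length w" and nk: "k * length w = n + length v"
      by (auto simp: u_def v_def)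
    have "exp (real k * ln (perron (W \<alpha> w))) = perron (W \<alpha> w) ^ k"
      using perron_W_pos[OF assms(1)] by (simp add: exp_of_nat_mult)
    also have "\<dots> \<le> msum (W \<alpha> (wpow w k))"
      using assms(1) by (simp add: word_matrix_wpow perron_power_le_msum nonneg_W)
    also have "wpow w k = u @ v" by (simp add: u_def v_def)
    also have "msum (W \<alpha> (u @ v)) \<le> msum (W \<alpha> v) * msum (W \<alpha> u)" using assms(1) by (simp add: msum_W_append)
    also have "\<dots> \<le> (C * exp (real (length v) * growth \<alpha>)) * msum (W \<alpha> u)"
      using C(2)[of v] msum_W_pos[OF assms(1), of u] by (simp add: mult_right_mono)
    finally have "exp (real k * ln (perron (W \<alpha> w))) \<le> exp (ln C + real (length v) * growth \<alpha>) * msum (W \<alpha> u)"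
      using C(1) by (simp add: exp_add)
    then have "exp (real k * ln (perron (W \<alpha> w)) - (ln C + real (length v) * growth \<alpha>)) \<le> msum (W \<alpha> u)"
      by (simp add: exp_diff field_simps)
    moreover have "real n * (growth \<alpha> - e) - K \<le> real k * ln (perron (W \<alpha> w)) - (ln C + real (length v) * growth \<alpha>)"
    proof -
      have "real k * (real (length w) * (growth \<alpha> - e)) \<le> real k * ln (perron (W \<alpha> w))"
        using w' by (intro mult_left_mono) auto
      moreover have "real k * (real (length w) * (growth \<alpha> - e)) = (real n + real (length v)) * (growth \<alpha> - e)"
        using arg_cong[OF nk, of real] by (simp add: mult.assoc[symmetric])
      moreover have "real (length v) * e \<le> real (length w) * e" using lv assms(2) by simp
      ultimately show ?thesis by (simp add: K_def algebra_simps)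
    qed
    ultimately show "\<exists>w. length w = n \<and> exp (real n * (growth \<alpha> - e) - K) \<le> msum (W \<alpha> w)"
      using lu by (intro exI[of _ u]) (auto intro: order_trans[rotated])
  qed
qed

lemma root_exp: "0 < n \<Longrightarrow> root n (exp (real n * x)) = exp x"
  by (simp add: exp_of_nat_mult real_root_power_cancel)

text \<open>A form of the Berger-Wang theorem: norms and spectral radii of products have the same
  maximal growth. As \<open>jsr\<close> is a \<open>lim\<close>, convergence has to be established
  along with the value.\<close>

lemma jsr_growth:
  assumes "0 < \<alpha>"
  shows "jsr A0 A1 \<alpha> = exp (growth \<alpha>)"
proof -
  define b where "b n = Max ((\<lambda>w. root n (norm (W \<alpha> w))) ` {w. length w = n})" for n
  obtain C where C: "0 < C" "\<And>w. msum (W \<alpha> w) \<le> C * exp (real (length w) * growth \<alpha>)"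
    using msum_le_growth[OF assms] by blast
  have up: "b n \<le> root n C * exp (growth \<alpha>)" if "0 < n" for n
    unfolding b_def
  proof (subst Max_le_iff; (intro ballI)?)
    fix y assume "y \<in> (\<lambda>w. root n (norm (W \<alpha> w))) ` {w. length w = n}"
    then obtain w where w: "length w = n" "y = root n (norm (W \<alpha> w))" by blast
    have "norm (W \<alpha> w) \<le> C * exp (real n * growth \<alpha>)"
      using norm_le_msum[OF nonneg_W, of \<alpha> w] C(2)[of w] assms w(1) by simp
    then have "y \<le> root n (C * exp (real n * growth \<alpha>))" unfolding w(2) using that by simp
    then show "y \<le> root n C * exp (growth \<alpha>)" using that by (simp add: real_root_mult root_exp)
  qed (use finite_words nonempty_words in simp_all)
  have up_lim: "(\<lambda>n. root n C * exp (growth \<alpha>)) \<longlonglongrightarrow> 1 * exp (growth \<alpha>)"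
    using C(1) by (intro tendsto_mult LIMSEQ_root_const tendsto_const)
  have "b \<longlonglongrightarrow> exp (growth \<alpha>)"
  proof (rule order_tendstoI)
    fix a assume "exp (growth \<alpha>) < a"
    then have "\<forall>\<^sub>F n in sequentially. root n C * exp (growth \<alpha>) < a"
      using order_tendstoD(2)[OF up_lim] by simp
    then show "\<forall>\<^sub>F n in sequentially. b n < a"
      using eventually_gt_at_top[of 0] by eventually_elim (rule le_less_trans[OF up])
  next
    fix a assume a: "a < exp (growth \<alpha>)"
    obtain e where e: "0 < e" "a < exp (growth \<alpha> - e)"
    proof (cases "a \<le> 0")
      case True
      then have "a < exp (growth \<alpha> - 1)" using exp_gt_zero[of "growth \<alpha> - 1"] by linarith
      then show ?thesis using that[of 1] by simp
    next
      case False
      then have "ln a < growth \<alpha>" using a by (metis exp_less_cancel_iff exp_ln not_le)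
      then have "0 < (growth \<alpha> - ln a) / 2" "ln a < growth \<alpha> - (growth \<alpha> - ln a) / 2"
        by (simp_all add: field_simps)
      moreover from this(2) have "a < exp (growth \<alpha> - (growth \<alpha> - ln a) / 2)"
        using False by (metis exp_less_cancel_iff exp_ln not_le)
      ultimately show ?thesis using that by blast
    qed
    obtain K where K: "\<And>n. \<exists>w. length w = n \<and> exp (real n * (growth \<alpha> - e) - K) \<le> msum (W \<alpha> w)"
      using growth_attained_approx[OF assms e(1)] by blast
    have lo: "root n (exp (- K) / 4) * exp (growth \<alpha> - e) \<le> b n" if "0 < n" for n
    proof -
      obtain w where w: "length w = n" "exp (real n * (growth \<alpha> - e) - K) \<le> msum (W \<alpha> w)" using K by blast
      have "exp (- K) / 4 * exp (real n * (growth \<alpha> - e)) \<le> norm (W \<alpha> w)"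
      proof -
        have "exp (- K) * exp (real n * (growth \<alpha> - e)) \<le> 4 * norm (W \<alpha> w)"
          using w(2) msum_le_norm[of "W \<alpha> w"] unfolding exp_add[symmetric] by (simp add: algebra_simps)
        then show ?thesis by simp
      qed
      then have "root n (exp (- K) / 4 * exp (real n * (growth \<alpha> - e))) \<le> root n (norm (W \<alpha> w))"
        using that by (simp only: real_root_le_iff)
      then have "root n (exp (- K) / 4) * exp (growth \<alpha> - e) \<le> root n (norm (W \<alpha> w))"
        using that by (simp only: real_root_mult root_exp)
      also have "\<dots> \<le> b n" unfolding b_def using w(1) by (intro Max_ge) (auto simp: finite_words)
      finally show ?thesis .
    qed
    have "(\<lambda>n. root n (exp (- K) / 4) * exp (growth \<alpha> - e)) \<longlonglongrightarrow> 1 * exp (growth \<alpha> - e)"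
      by (intro tendsto_mult LIMSEQ_root_const tendsto_const) simp
    then have "\<forall>\<^sub>F n in sequentially. a < root n (exp (- K) / 4) * exp (growth \<alpha> - e)"
      using order_tendstoD(1) e(2) by simp
    then show "\<forall>\<^sub>F n in sequentially. a < b n"
      using eventually_gt_at_top[of 0] by eventually_elim (rule less_le_trans[OF _ lo])
  qed
  then show ?thesis unfolding jsr_words b_def by (simp add: limI)
qed

lemma weakly_extremal_log:
  assumes "0 < \<alpha>" "weakly_extremal A0 A1 \<alpha> x"
  shows "(\<lambda>n. ln (msum (W \<alpha> (prefix_of x n))) / n) \<longlonglongrightarrow> growth \<alpha>"
proof -
  let ?M = "\<lambda>n. W \<alpha> (prefix_of x n)"
  have pos: "0 < norm (?M n)" for n
    using msum_W_pos[OF assms(1), of "prefix_of x n"] msum_le_norm[of "?M n"] by linarith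
  have "(\<lambda>n. root n (norm (?M n))) \<longlonglongrightarrow> exp (growth \<alpha>)"
    using assms by (simp add: weakly_extremal_def jsr_growth prefix_matrix_def prefix_of_def)
  then have l: "(\<lambda>n. ln (root n (norm (?M n)))) \<longlonglongrightarrow> ln (exp (growth \<alpha>))"
    by (intro tendsto_ln) auto
  have u: "(\<lambda>n. ln (root n (norm (?M n))) + ln 4 / real n) \<longlonglongrightarrow> ln (exp (growth \<alpha>)) + 0"
    by (intro tendsto_add l lim_const_over_n)
  have b: "ln (root n (norm (?M n))) \<le> ln (msum (?M n)) / n"
     "ln (msum (?M n)) / n \<le> ln (root n (norm (?M n))) + ln 4 / real n" if "0 < n" for n
  proof -
    have e: "ln (root n (norm (?M n))) = ln (norm (?M n)) / n" using that pos[of n] by (simp add: ln_root)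
    have "ln (norm (?M n)) \<le> ln (msum (?M n))"
      using norm_le_msum[OF nonneg_W[OF less_imp_le[OF assms(1)]], of "prefix_of x n"] pos[of n]
        msum_W_pos[OF assms(1), of "prefix_of x n"] by (simp only: ln_le_cancel_iff)
    then show "ln (root n (norm (?M n))) \<le> ln (msum (?M n)) / n" unfolding e by (simp add: divide_right_mono)
    have "ln (msum (?M n)) \<le> ln (norm (?M n) * 4)"
      using msum_le_norm[of "?M n"] msum_W_pos[OF assms(1), of "prefix_of x n"] pos[of n]
      by (subst ln_le_cancel_iff) (simp_all only: mult.commute mult_pos_pos zero_less_numeral)
    also have "\<dots> = ln (norm (?M n)) + ln 4" using pos[of n] by (simp add: ln_mult)
    finally show "ln (msum (?M n)) / n \<le> ln (root n (norm (?M n))) + ln 4 / real n"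
      unfolding e by (simp add: divide_right_mono add_divide_distrib[symmetric])
  qed
  show ?thesis
  proof (rule tendsto_sandwich)
    show "\<forall>\<^sub>F n in sequentially. ln (root n (norm (?M n))) \<le> ln (msum (?M n)) / n"
      using eventually_gt_at_top[of 0] by eventually_elim (rule b)
    show "\<forall>\<^sub>F n in sequentially. ln (msum (?M n)) / n \<le> ln (root n (norm (?M n))) + ln 4 / real n"
      using eventually_gt_at_top[of 0] by eventually_elim (rule b)
  qed (use l u in simp_all)
qed

lemma weakly_extremalI:
  assumes "0 < \<alpha>" "0 < c" "\<And>n. c * exp (real n * growth \<alpha>) \<le> msum (W \<alpha> (prefix_of x n))"
  shows "weakly_extremal A0 A1 \<alpha> x"
proof -
  obtain C where C: "0 < C" "\<And>w. msum (W \<alpha> w) \<le> C * exp (real (length w) * growth \<alpha>)"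
    using msum_le_growth[OF assms(1)] by blast
  let ?M = "\<lambda>n. W \<alpha> (prefix_of x n)"
  have up: "root n (norm (?M n)) \<le> root n C * exp (growth \<alpha>)" if "0 < n" for n
  proof -
    have "norm (?M n) \<le> C * exp (real n * growth \<alpha>)"
      using norm_le_msum[OF nonneg_W, of \<alpha>] C(2)[of "prefix_of x n"] assms(1) by (auto intro: order_trans)
    then have "root n (norm (?M n)) \<le> root n (C * exp (real n * growth \<alpha>))" using that by simp
    then show ?thesis using that by (simp add: real_root_mult root_exp)
  qed
  have lo: "root n (c / 4) * exp (growth \<alpha>) \<le> root n (norm (?M n))" if "0 < n" for n
  proof -
    have "c / 4 * exp (real n * growth \<alpha>) \<le> norm (?M n)"
      using assms(3)[of n] msum_le_norm[of "?M n"] by simp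
    then have "root n (c / 4 * exp (real n * growth \<alpha>)) \<le> root n (norm (?M n))"
      using that by (simp only: real_root_le_iff)
    then show ?thesis using that by (simp only: real_root_mult root_exp)
  qed
  have "(\<lambda>n. root n (norm (?M n))) \<longlonglongrightarrow> exp (growth \<alpha>)"
  proof (rule tendsto_sandwich)
    show "\<forall>\<^sub>F n in sequentially. root n (c / 4) * exp (growth \<alpha>) \<le> root n (norm (?M n))"
      using eventually_gt_at_top[of 0] by eventually_elim (rule lo)
    show "\<forall>\<^sub>F n in sequentially. root n (norm (?M n)) \<le> root n C * exp (growth \<alpha>)"
      using eventually_gt_at_top[of 0] by eventually_elim (rule up)
    have "(\<lambda>n. root n (c / 4) * exp (growth \<alpha>)) \<longlonglongrightarrow> 1 * exp (growth \<alpha>)"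
      using assms(2) by (intro tendsto_mult LIMSEQ_root_const tendsto_const) simp
    then show "(\<lambda>n. root n (c / 4) * exp (growth \<alpha>)) \<longlonglongrightarrow> exp (growth \<alpha>)" by simp
    have "(\<lambda>n. root n C * exp (growth \<alpha>)) \<longlonglongrightarrow> 1 * exp (growth \<alpha>)"
      using C(1) by (intro tendsto_mult LIMSEQ_root_const tendsto_const)
    then show "(\<lambda>n. root n C * exp (growth \<alpha>)) \<longlonglongrightarrow> exp (growth \<alpha>)" by simp
  qed
  then show ?thesis using assms(1) by (simp add: weakly_extremal_def jsr_growth prefix_matrix_def prefix_of_def)
qed

end

section \<open>Periodic sequences and the parameter zero\<close>

context matrix_pair
begin

text \<open>Along multiples of the period the products are powers of \<open>W \<alpha> w\<close>,
  and Gelfand's formula gives the limit.\<close>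

lemma per_extremal:
  assumes "w \<noteq> []" "0 < perron (W \<alpha> w)" "0 \<le> \<alpha>" "weakly_extremal A0 A1 \<alpha> (per w)"
  shows "jsr A0 A1 \<alpha> = root (length w) (perron (W \<alpha> w))"
proof -
  let ?q = "length w"
  have q: "0 < ?q" using assms(1) by simp
  have "(\<lambda>n. root n (norm (prefix_matrix A0 A1 \<alpha> (per w) n))) \<longlonglongrightarrow> jsr A0 A1 \<alpha>"
    using assms(4) by (simp add: weakly_extremal_def)
  moreover have "strict_mono (\<lambda>k. k * ?q)" using q by (simp add: strict_mono_def)
  ultimately have "((\<lambda>n. root n (norm (prefix_matrix A0 A1 \<alpha> (per w) n))) \<circ> (\<lambda>k. k * ?q)) \<longlonglongrightarrow> jsr A0 A1 \<alpha>"
    by (rule LIMSEQ_subseq_LIMSEQ)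
  moreover have "((\<lambda>n. root n (norm (prefix_matrix A0 A1 \<alpha> (per w) n))) \<circ> (\<lambda>k. k * ?q))
      = (\<lambda>k. root ?q (root k (norm (matrix_power (W \<alpha> w) k))))"
  proof
    fix k
    have "root (k * ?q) y = root ?q (root k y)" for y
      unfolding real_root_mult_exp by (rule real_root_commute)
    moreover have "prefix_matrix A0 A1 \<alpha> (per w) (k * ?q) = matrix_power (W \<alpha> w) k"
      unfolding prefix_matrix_def per_prefix[OF assms(1)] by (rule word_matrix_wpow)
    ultimately show "((\<lambda>n. root n (norm (prefix_matrix A0 A1 \<alpha> (per w) n))) \<circ> (\<lambda>k. k * ?q)) k
      = root ?q (root k (norm (matrix_power (W \<alpha> w) k)))" by (simp only: o_def)
  qed
  ultimately have "(\<lambda>k. root ?q (root k (norm (matrix_power (W \<alpha> w) k)))) \<longlonglongrightarrow> jsr A0 A1 \<alpha>"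
    by simp
  moreover have "(\<lambda>k. root ?q (root k (norm (matrix_power (W \<alpha> w) k)))) \<longlonglongrightarrow> root ?q (perron (W \<alpha> w))"
    by (intro tendsto_real_root root_norm_power_limit nonneg_W assms)
  ultimately show ?thesis by (rule LIMSEQ_unique)
qed

text \<open>At parameter 0 every word containing the letter 1 gives the zero matrix, so only the
  powers of \<open>A0\<close> remain in the maximum.\<close>

lemma weakly_extremal_zero: "weakly_extremal A0 A1 0 (\<lambda>_. False)"
proof -
  have z: "W 0 w = (if w = replicate (length w) False then matrix_power A0 (length w) else 0)" for w
  proof (induction w)
    case (Cons a w)
    then show ?case
      by (cases a) (auto simp: word_matrix_Cons letter_matrix_def matrix_power_Suc2)
  qed simp
  have rep: "prefix_of (\<lambda>_. False) n = replicate n False" for n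
    by (induction n) (simp_all add: prefix_of_Suc replicate_append_same)
  define b where "b n = Max ((\<lambda>w. root n (norm (W 0 w))) ` {w. length w = n})" for n
  have b: "b n = root n (norm (matrix_power A0 n))" for n
    unfolding b_def
  proof (rule Max_eqI)
    show "root n (norm (matrix_power A0 n)) \<in> (\<lambda>w. root n (norm (W 0 w))) ` {w. length w = n}"
      by (rule image_eqI[of _ _ "replicate n False"]) (simp_all add: z)
    fix y assume "y \<in> (\<lambda>w. root n (norm (W 0 w))) ` {w. length w = n}"
    then show "y \<le> root n (norm (matrix_power A0 n))"
      by (auto simp: z split: if_splits intro!: real_root_ge_zero)
  qed (simp add: finite_words)
  have "b \<longlonglongrightarrow> perron A0"
    unfolding b using root_norm_power_limit[OF nonneg_A(1)] perron_pos_det[OF nonneg_A(1) det_A(1)] by simp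
  then have "jsr A0 A1 0 = perron A0" "b \<longlonglongrightarrow> perron A0" unfolding jsr_words b_def by (simp_all add: limI)
  then show ?thesis
    unfolding weakly_extremal_def prefix_matrix_def prefix_of_def[symmetric] rep by (simp add: z b[symmetric])
qed

end

section \<open>Regularity of the ratio function\<close>

text \<open>The mechanical sequence of intercept 0, a concrete representative of the Sturmian set of
  slope \<open>\<gamma>\<close>.\<close>

definition mech :: "real \<Rightarrow> nat \<Rightarrow> bool" where
  "mech \<gamma> n \<longleftrightarrow> \<lfloor>\<gamma> * real (n + 1)\<rfloor> - \<lfloor>\<gamma> * real n\<rfloor> = 1"

lemma mech_of_bool:
  assumes "0 \<le> \<gamma>" "\<gamma> \<le> 1"
  shows "of_bool (mech \<gamma> n) = \<lfloor>\<gamma> * real (n + 1)\<rfloor> - \<lfloor>\<gamma> * real n\<rfloor>"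
proof -
  have e: "\<gamma> * real (n + 1) = \<gamma> * real n + \<gamma>" by (simp add: algebra_simps)
  have "\<lfloor>\<gamma> * real n\<rfloor> \<le> \<lfloor>\<gamma> * real (n + 1)\<rfloor>" unfolding e using assms by (intro floor_mono) simp
  moreover have "\<lfloor>\<gamma> * real (n + 1)\<rfloor> \<le> \<lfloor>\<gamma> * real n + 1\<rfloor>" unfolding e using assms by (intro floor_mono) simp
  ultimately show ?thesis by (auto simp: mech_def)
qed

lemma mech_sturmian:
  assumes "0 \<le> \<gamma>" "\<gamma> \<le> 1"
  shows "mech \<gamma> \<in> sturmian_set \<gamma>"
  unfolding sturmian_set_def using mech_of_bool[OF assms] by (auto intro!: exI[of _ 0])

definition factor :: "(nat \<Rightarrow> bool) \<Rightarrow> nat \<Rightarrow> nat \<Rightarrow> bool list" where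
  "factor x a m = map x [a+1..<a+m+1]"

lemma length_factor [simp]: "length (factor x a m) = m"
  by (simp add: factor_def)

lemma factor_Suc: "factor x a (Suc m) = factor x a m @ [x (a + m + 1)]"
  by (simp add: factor_def)

lemma take_factor: "k \<le> m \<Longrightarrow> take k (factor x a m) = factor x a k"
  unfolding factor_def take_map by (subst take_upt) (simp_all add: add.commute)

lemma prefix_of_add: "prefix_of x (a + m) = prefix_of x a @ factor x a m"
proof (induction m)
  case 0
  show ?case by (simp add: factor_def)
qed (simp add: prefix_of_Suc factor_Suc)

lemma num_ones_factor_mech:
  assumes "0 \<le> \<gamma>" "\<gamma> \<le> 1"
  shows "\<bar>real (num_ones (factor (mech \<gamma>) a m)) - \<gamma> * real m\<bar> \<le> 1"
proof -
  have "int (num_ones (factor (mech \<gamma>) a m)) = \<lfloor>\<gamma> * real (a + m + 1)\<rfloor> - \<lfloor>\<gamma> * real (a + 1)\<rfloor>"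
  proof (induction m)
    case 0
    then show ?case by (simp add: factor_def)
  next
    case (Suc m)
    then show ?case using mech_of_bool[OF assms, of "a + m + 1"] by (simp add: factor_Suc)
  qed
  then have "real (num_ones (factor (mech \<gamma>) a m)) = of_int \<lfloor>\<gamma> * real (a + m + 1)\<rfloor> - of_int \<lfloor>\<gamma> * real (a + 1)\<rfloor>"
    by linarith
  moreover have "\<gamma> * real (a + m + 1) = \<gamma> * real (a + 1) + \<gamma> * real m" by (simp add: algebra_simps)
  ultimately show ?thesis by linarith
qed

text \<open>Koenig's lemma: follow a branch through the words that are prefixes of
  \<open>w m\<close> for infinitely many \<open>m\<close>.\<close>

lemma koenig_words:
  assumes "\<And>m. length (w m :: bool list) = m"
  obtains x where "\<And>n. infinite {m. take n (w m) = prefix_of x n}"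
proof -
  define good where "good u \<longleftrightarrow> infinite {m. take (length u) (w m) = u}" for u
  have ex: "\<exists>b. good (u @ [b])" if "good u" for u
  proof (rule ccontr)
    assume "\<not> ?thesis"
    then have "finite {m. take (length (u @ [b])) (w m) = u @ [b]}" for b by (simp add: good_def)
    \<comment> \<open>The second set collects the \<open>m\<close> for which \<open>w m\<close> is
      too short to have a letter after \<open>u\<close>.\<close>
    then have "finite ((\<Union>b. {m. take (length (u @ [b])) (w m) = u @ [b]}) \<union> {..length u})"
      by (intro finite_UnI finite_UN_I) auto
    moreover have "{m. take (length u) (w m) = u} \<subseteq> (\<Union>b. {m. take (length (u @ [b])) (w m) = u @ [b]}) \<union> {..length u}"
      using assms by (auto simp: take_Suc_conv_app_nth not_le)
    ultimately show False using that unfolding good_def by (meson finite_subset)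
  qed
  have "\<exists>f. \<forall>n. (good (f n) \<and> length (f n) = n) \<and> (\<exists>b. f (Suc n) = f n @ [b])"
  proof (rule dependent_nat_choice)
    show "\<exists>u. good u \<and> length u = 0" by (intro exI[of _ "[]"]) (simp add: good_def)
    show "\<exists>v. (good v \<and> length v = Suc n) \<and> (\<exists>b. v = u @ [b])" if "good u \<and> length u = n" for u n
      using ex[of u] that by auto
  qed
  then obtain f where f: "\<And>n. good (f n)" "\<And>n. length (f n) = n" "\<And>n. \<exists>b. f (Suc n) = f n @ [b]" by blast
  define x where "x n = last (f n)" for n
  have "prefix_of x n = f n" for n
  proof (induction n)
    case (Suc n)
    then show ?case using f(3)[of n] by (auto simp: prefix_of_Suc x_def)
  qed (use f(2)[of 0] in simp)
  then show ?thesis using f(1,2) that[of x] by (simp add: good_def)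
qed

locale sturmian_pair = matrix_pair +
  fixes r :: "real \<Rightarrow> real"
  assumes ratio: "is_ratio_function A0 A1 r"
begin

lemma r_range: "0 \<le> \<alpha> \<Longrightarrow> 0 \<le> r \<alpha>" "0 \<le> \<alpha> \<Longrightarrow> r \<alpha> \<le> 1"
  using ratio by (auto simp: is_ratio_function_def)

lemma sturmian_extremal: "0 \<le> \<alpha> \<Longrightarrow> x \<in> sturmian_set (r \<alpha>) \<Longrightarrow> weakly_extremal A0 A1 \<alpha> x"
  using ratio by (auto simp: is_ratio_function_def)

lemma extremal_frequency:
  assumes "0 \<le> \<alpha>" "weakly_extremal A0 A1 \<alpha> x"
  shows "(\<lambda>n. real (num_ones (prefix_of x n)) / real n) \<longlonglongrightarrow> r \<alpha>"
  using ratio assms by (auto simp: is_ratio_function_def num_ones_prefix)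

lemma r_zero: "r 0 = 0"
proof -
  have "(\<lambda>n. real (num_ones (prefix_of (\<lambda>_. False) n)) / real n) \<longlonglongrightarrow> r 0"
    by (intro extremal_frequency weakly_extremal_zero) simp
  moreover have "num_ones (prefix_of (\<lambda>_. False) n) = 0" for n by (induction n) (simp_all add: prefix_of_Suc)
  ultimately have "(\<lambda>n. 0) \<longlonglongrightarrow> r 0" by simp
  then show ?thesis by (simp add: LIMSEQ_const_iff)
qed

text \<open>A sequence extremal at \<open>\<alpha>\<close> has frequency \<open>r \<alpha>\<close>,
  and changing the parameter to \<open>\<beta>\<close> multiplies its products by one factor
  \<open>\<beta> / \<alpha>\<close> per letter 1. The left side is therefore its growth rate at
  \<open>\<beta>\<close>.\<close>

lemma growth_subgradient:
  assumes "0 < \<alpha>" "0 < \<beta>"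
  shows "growth \<alpha> + r \<alpha> * (ln \<beta> - ln \<alpha>) \<le> growth \<beta>"
proof -
  define x where "x = mech (r \<alpha>)"
  have x: "weakly_extremal A0 A1 \<alpha> x"
    unfolding x_def using assms(1) r_range[of \<alpha>] by (intro sturmian_extremal mech_sturmian) auto
  obtain C where C: "0 < C" "\<And>w. msum (W \<beta> w) \<le> C * exp (real (length w) * growth \<beta>)"
    using msum_le_growth[OF assms(2)] by blast
  define c where "c n = real (num_ones (prefix_of x n))" for n
  have ms: "msum (W \<alpha>' w) = \<alpha>' ^ num_ones w * msum (W 1 w)" for \<alpha>' w
    by (simp add: word_matrix_scale[of A0 A1 \<alpha>' w] msum_scale)
  have le: "ln (msum (W \<alpha> (prefix_of x n))) / n + c n / n * (ln \<beta> - ln \<alpha>) \<le> ln C / n + growth \<beta>" if "0 < n" for n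
  proof -
    let ?p = "prefix_of x n"
    have "ln (msum (W \<beta> ?p)) = ln (msum (W \<alpha> ?p)) + c n * (ln \<beta> - ln \<alpha>)"
      using assms msum_W_pos[of 1 ?p] by (simp add: ms[of \<alpha>] ms[of \<beta>] ln_mult ln_realpow c_def algebra_simps)
    moreover have "ln (msum (W \<beta> ?p)) \<le> ln C + n * growth \<beta>"
    proof -
      have "ln (msum (W \<beta> ?p)) \<le> ln (C * exp (real n * growth \<beta>))"
        using C(2)[of ?p] msum_W_pos[OF assms(2), of ?p] C(1) by simp
      then show ?thesis using C(1) by (simp add: ln_mult)
    qed
    ultimately have "(ln (msum (W \<alpha> ?p)) + c n * (ln \<beta> - ln \<alpha>)) / n \<le> (ln C + n * growth \<beta>) / n"
      by (intro divide_right_mono) auto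
    then show ?thesis using that by (simp add: add_divide_distrib)
  qed
  have "(\<lambda>n. ln (msum (W \<alpha> (prefix_of x n))) / n + c n / n * (ln \<beta> - ln \<alpha>)) \<longlonglongrightarrow> growth \<alpha> + r \<alpha> * (ln \<beta> - ln \<alpha>)"
    unfolding c_def using assms(1) x
    by (intro tendsto_add tendsto_mult tendsto_const weakly_extremal_log extremal_frequency) auto
  moreover have "(\<lambda>n. ln C / real n + growth \<beta>) \<longlonglongrightarrow> 0 + growth \<beta>"
    by (intro tendsto_add tendsto_const lim_const_over_n)
  ultimately have "growth \<alpha> + r \<alpha> * (ln \<beta> - ln \<alpha>) \<le> 0 + growth \<beta>"
    by (rule LIMSEQ_le) (use le in \<open>auto intro: exI[of _ 1]\<close>)
  then show ?thesis by simp
qed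

lemma r_mono:
  assumes "0 \<le> \<alpha>" "\<alpha> \<le> \<beta>"
  shows "r \<alpha> \<le> r \<beta>"
proof (cases "\<alpha> = 0 \<or> \<alpha> = \<beta>")
  case True
  then show ?thesis using r_zero r_range assms by auto
next
  case False
  then have ab: "0 < \<alpha>" "\<alpha> < \<beta>" using assms by auto
  then have l: "0 < ln \<beta> - ln \<alpha>" by simp
  \<comment> \<open>Adding the subgradient inequalities at \<open>\<alpha>\<close> and at
    \<open>\<beta>\<close> cancels the growth terms.\<close>
  have "r \<alpha> * (ln \<beta> - ln \<alpha>) \<le> r \<beta> * (ln \<beta> - ln \<alpha>)"
    using growth_subgradient[of \<alpha> \<beta>] growth_subgradient[of \<beta> \<alpha>] ab by (simp add: algebra_simps)
  then show ?thesis using l by simp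
qed

lemma growth_lower:
  assumes "0 < \<alpha>" "w \<noteq> []"
  shows "(ln (\<rho> w) + num_ones w * ln \<alpha>) / length w \<le> growth \<alpha>"
proof -
  have "ln (perron (W \<alpha> w)) \<le> length w * growth \<alpha>"
    using perron_le_growth[OF assms] perron_W_pos[OF assms(1), of w] by (metis exp_gt_zero ln_exp ln_le_cancel_iff)
  moreover have "ln (perron (W \<alpha> w)) = num_ones w * ln \<alpha> + ln (\<rho> w)"
    using assms(1) \<rho>_pos[of w] by (simp add: perron_W[of \<alpha>] ln_mult ln_realpow)
  ultimately show ?thesis using assms(2) by (simp add: pos_divide_le_eq mult.commute add.commute)
qed

lemma r_small:
  assumes "0 < e"
  shows "\<exists>\<alpha>>0. r \<alpha> < e"
proof -
  define K where "K = max 0 (growth 1 - ln (\<rho> [False]))"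
  \<comment> \<open>As \<open>T\<close> grows, \<open>growth (exp (- T))\<close> stays above
    \<open>ln (\<rho> [False])\<close>, so the subgradient inequality bounds
    \<open>r (exp (- T)) * T\<close> by \<open>K\<close>, whatever \<open>T\<close> is.\<close>
  define T where "T = (K + 1) / e"
  define \<alpha> where "\<alpha> = exp (- T)"
  have "growth \<alpha> + r \<alpha> * T \<le> growth 1"
    using growth_subgradient[of \<alpha> 1] unfolding \<alpha>_def ln_exp by simp
  moreover have "ln (\<rho> [False]) \<le> growth \<alpha>"
    using growth_lower[of \<alpha> "[False]"] by (simp add: \<alpha>_def)
  ultimately have "r \<alpha> * T \<le> K" by (simp add: K_def)
  moreover have "e * T = K + 1" using assms by (simp add: T_def)
  ultimately have "r \<alpha> * T < e * T" by simp
  moreover have "0 < T" using assms by (simp add: K_def T_def)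
  ultimately have "r \<alpha> < e" by (simp add: mult_less_cancel_right)
  moreover have "0 < \<alpha>" by (simp add: \<alpha>_def)
  ultimately show ?thesis by blast
qed

lemma r_large:
  assumes "0 < e"
  shows "\<exists>\<alpha>>0. 1 - e < r \<alpha>"
proof -
  define K where "K = max 0 (growth 1 - ln (\<rho> [True]))"
  define T where "T = (K + 1) / e"
  define \<alpha> where "\<alpha> = exp T"
  have "growth \<alpha> - r \<alpha> * T \<le> growth 1"
    using growth_subgradient[of \<alpha> 1] unfolding \<alpha>_def ln_exp by simp
  moreover have "ln (\<rho> [True]) + T \<le> growth \<alpha>"
    using growth_lower[of \<alpha> "[True]"] by (simp add: \<alpha>_def)
  moreover have "(1 - r \<alpha>) * T = T - r \<alpha> * T" by (simp add: left_diff_distrib)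
  ultimately have "(1 - r \<alpha>) * T \<le> K" by (simp add: K_def)
  moreover have "e * T = K + 1" using assms by (simp add: T_def)
  ultimately have "(1 - r \<alpha>) * T < e * T" by simp
  moreover have "0 < T" using assms by (simp add: K_def T_def)
  ultimately have "1 - r \<alpha> < e" by (simp add: mult_less_cancel_right)
  moreover have "0 < \<alpha>" by (simp add: \<alpha>_def)
  ultimately show ?thesis by (intro exI[of _ \<alpha>]) auto
qed

lemma r_tendsto_1: "(r \<longlongrightarrow> 1) at_top"
proof (rule order_tendstoI)
  fix a :: real assume "a < 1"
  then obtain \<alpha> where \<alpha>: "0 < \<alpha>" "a < r \<alpha>" using r_large[of "1 - a"] by auto
  show "\<forall>\<^sub>F x in at_top. a < r x"
    using eventually_ge_at_top[of \<alpha>] by eventually_elim (rule less_le_trans[OF \<alpha>(2) r_mono[OF less_imp_le[OF \<alpha>(1)]]])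
next
  fix a :: real assume "1 < a"
  show "\<forall>\<^sub>F x in at_top. r x < a"
    using eventually_ge_at_top[of 0] by eventually_elim (rule le_less_trans[OF r_range(2) \<open>1 < a\<close>])
qed

text \<open>Otherwise, as there are finitely many words of length \<open>m\<close>, all factors
  would fall short by a common ratio and submultiplicativity would lower the growth rate of
  \<open>x\<close>. The bound carries no error term, so it survives a limit in
  \<open>\<alpha>\<close> at fixed \<open>m\<close>.\<close>

lemma extremal_factor:
  assumes "0 < \<alpha>" "weakly_extremal A0 A1 \<alpha> x" "0 < m"
  shows "\<exists>a. exp (real m * growth \<alpha>) \<le> msum (W \<alpha> (factor x a m))"
proof (rule ccontr)
  assume "\<not> ?thesis"
  then have lt: "msum (W \<alpha> (factor x a m)) < exp (real m * growth \<alpha>)" for a by (simp add: not_le)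
  define S where "S = (\<lambda>a. msum (W \<alpha> (factor x a m))) ` UNIV"
  have "S \<subseteq> (\<lambda>w. msum (W \<alpha> w)) ` {w. length w = m}" by (auto simp: S_def)
  then have fin: "finite S" using finite_words finite_surj by blast
  define \<kappa> where "\<kappa> = Max S"
  have "\<kappa> \<in> S" unfolding \<kappa>_def by (rule Max_in[OF fin]) (simp add: S_def)
  then have \<kappa>: "0 < \<kappa>" "\<kappa> < exp (real m * growth \<alpha>)" using lt msum_W_pos[OF assms(1)] by (auto simp: S_def)
  have le: "msum (W \<alpha> (factor x a m)) \<le> \<kappa>" for a unfolding \<kappa>_def by (rule Max_ge[OF fin]) (simp add: S_def)
  have pre: "msum (W \<alpha> (prefix_of x (k * m))) \<le> 2 * \<kappa> ^ k" for k
  proof (induction k)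
    case (Suc k)
    have "msum (W \<alpha> (prefix_of x (k * m + m))) \<le> msum (W \<alpha> (factor x (k * m) m)) * msum (W \<alpha> (prefix_of x (k * m)))"
      unfolding prefix_of_add using assms(1) by (simp add: msum_W_append)
    also have "\<dots> \<le> \<kappa> * (2 * \<kappa> ^ k)"
      using Suc le \<kappa>(1) msum_W_pos[OF assms(1), of "prefix_of x (k * m)"] by (intro mult_mono) auto
    finally show ?case by (simp add: add.commute mult.left_commute)
  qed (simp add: msum_def)
  have "(\<lambda>n. ln (msum (W \<alpha> (prefix_of x n))) / n) \<longlonglongrightarrow> growth \<alpha>" by (rule weakly_extremal_log[OF assms(1,2)])
  moreover have "strict_mono (\<lambda>k. k * m)" using assms(3) by (simp add: strict_mono_def)
  ultimately have "((\<lambda>n. ln (msum (W \<alpha> (prefix_of x n))) / real n) \<circ> (\<lambda>k. k * m)) \<longlonglongrightarrow> growth \<alpha>"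
    by (rule LIMSEQ_subseq_LIMSEQ)
  then have l1: "(\<lambda>k. ln (msum (W \<alpha> (prefix_of x (k * m)))) / real (k * m)) \<longlonglongrightarrow> growth \<alpha>" by (simp only: o_def)
  have l2: "(\<lambda>k. (ln 2 / m) / real k + ln \<kappa> / m) \<longlonglongrightarrow> 0 + ln \<kappa> / m"
    by (intro tendsto_add tendsto_const lim_const_over_n)
  have "growth \<alpha> \<le> 0 + ln \<kappa> / m"
  proof (rule LIMSEQ_le[OF l1 l2], intro exI[of _ 1] allI impI)
    fix k :: nat assume k: "1 \<le> k"
    have "ln (msum (W \<alpha> (prefix_of x (k * m)))) \<le> ln (2 * \<kappa> ^ k)"
      using pre[of k] msum_W_pos[OF assms(1), of "prefix_of x (k * m)"] \<kappa>(1) by simp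
    also have "\<dots> = ln 2 + k * ln \<kappa>" using \<kappa>(1) by (simp add: ln_mult ln_realpow)
    finally have "ln (msum (W \<alpha> (prefix_of x (k * m)))) / real (k * m) \<le> (ln 2 + k * ln \<kappa>) / real (k * m)"
      by (intro divide_right_mono) auto
    also have "\<dots> = (ln 2 / m) / real k + ln \<kappa> / m" using k assms(3) by (simp add: field_simps)
    finally show "ln (msum (W \<alpha> (prefix_of x (k * m)))) / real (k * m) \<le> (ln 2 / m) / real k + ln \<kappa> / m" .
  qed
  then have "m * growth \<alpha> \<le> ln \<kappa>" using assms(3) by (simp add: field_simps)
  then have "exp (m * growth \<alpha>) \<le> \<kappa>" using \<kappa>(1) by (metis exp_le_cancel_iff exp_ln)
  then show False using \<kappa>(2) by simp
qed

lemma tendsto_msum_W: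
  assumes "X \<longlonglongrightarrow> \<alpha>"
  shows "(\<lambda>n. msum (W (X n) w)) \<longlonglongrightarrow> msum (W \<alpha> w)"
proof -
  have ms: "msum (W \<alpha>' w) = \<alpha>' ^ num_ones w * msum (W 1 w)" for \<alpha>' w
    by (simp add: word_matrix_scale[of A0 A1 \<alpha>' w] msum_scale)
  show ?thesis unfolding ms[of \<alpha>] ms[of "X _"] by (intro tendsto_intros assms)
qed

text \<open>Only finitely many words of length \<open>m\<close> have the required frequencies. If
  all of them failed at \<open>\<alpha>\<close>, they would by continuity fail at \<open>X n\<close>
  for large \<open>n\<close>, against \<open>extremal_factor\<close> at \<open>X n\<close>.\<close>

lemma limit_factor:
  assumes "X \<longlonglongrightarrow> \<alpha>" "0 < \<alpha>" "(\<lambda>n. r (X n)) \<longlonglongrightarrow> \<gamma>" "0 < m"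
  shows "\<exists>w. length w = m \<and> exp (real m * growth \<alpha>) \<le> msum (W \<alpha> w) \<and>
     (\<forall>k\<le>m. \<bar>real (num_ones (take k w)) - \<gamma> * real k\<bar> \<le> 2)"
proof (rule ccontr)
  assume neg: "\<not> ?thesis"
  define B where "B = {w. length w = m \<and> (\<forall>k\<le>m. \<bar>real (num_ones (take k w)) - \<gamma> * real k\<bar> \<le> 2)}"
  have fin: "finite B" unfolding B_def by (rule finite_subset[OF _ finite_words[of m]]) auto
  have lt: "msum (W \<alpha> w) < exp (real m * growth \<alpha>)" if "w \<in> B" for w
  proof (rule ccontr)
    assume "\<not> ?thesis"
    with that have "length w = m \<and> exp (real m * growth \<alpha>) \<le> msum (W \<alpha> w) \<and>
     (\<forall>k\<le>m. \<bar>real (num_ones (take k w)) - \<gamma> * real k\<bar> \<le> 2)"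
      by (simp add: B_def)
    with neg show False by blast
  qed
  \<comment> \<open>A lower bound for \<open>growth (X n)\<close> from the subgradient at
    \<open>\<alpha>\<close>; it visibly tends to \<open>growth \<alpha>\<close>.\<close>
  define L where "L n = growth \<alpha> + r \<alpha> * (ln (X n) - ln \<alpha>)" for n
  have "L \<longlonglongrightarrow> growth \<alpha> + r \<alpha> * (ln \<alpha> - ln \<alpha>)"
    unfolding L_def using assms(1,2) by (intro tendsto_intros) auto
  then have L: "(\<lambda>n. exp (real m * L n)) \<longlonglongrightarrow> exp (real m * growth \<alpha>)"
    by (intro tendsto_exp tendsto_mult tendsto_const) simp
  have "\<forall>\<^sub>F n in sequentially. \<forall>w\<in>B. msum (W (X n) w) < exp (real m * L n)"
  proof (rule eventually_ball_finite[OF fin], rule ballI)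
    fix w assume "w \<in> B"
    then have "0 < exp (real m * growth \<alpha>) - msum (W \<alpha> w)" using lt by simp
    moreover have "(\<lambda>n. exp (real m * L n) - msum (W (X n) w)) \<longlonglongrightarrow> exp (real m * growth \<alpha>) - msum (W \<alpha> w)"
      by (intro tendsto_diff L tendsto_msum_W assms(1))
    ultimately have "\<forall>\<^sub>F n in sequentially. 0 < exp (real m * L n) - msum (W (X n) w)"
      by (rule order_tendstoD(1)[rotated])
    then show "\<forall>\<^sub>F n in sequentially. msum (W (X n) w) < exp (real m * L n)"
      by eventually_elim simp
  qed
  moreover have "\<forall>\<^sub>F n in sequentially. 0 < X n" using order_tendstoD(1)[OF assms(1,2)] .
  moreover have "\<forall>\<^sub>F n in sequentially. dist (r (X n)) \<gamma> < 1 / m"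
    using tendstoD[OF assms(3), of "1 / m"] assms(4) by simp
  ultimately have "\<forall>\<^sub>F n in sequentially. (\<forall>w\<in>B. msum (W (X n) w) < exp (real m * L n)) \<and> 0 < X n \<and> dist (r (X n)) \<gamma> < 1 / m"
    by eventually_elim simp
  then obtain n where n: "\<forall>w\<in>B. msum (W (X n) w) < exp (real m * L n)" "0 < X n" "dist (r (X n)) \<gamma> < 1 / m"
    using eventually_happens'[OF sequentially_bot] by blast
  let ?\<beta> = "X n"
  have r01: "0 \<le> r ?\<beta>" "r ?\<beta> \<le> 1" using r_range[of ?\<beta>] n(2) by auto
  have "weakly_extremal A0 A1 ?\<beta> (mech (r ?\<beta>))"
    using n(2) r01 by (intro sturmian_extremal mech_sturmian) auto
  from extremal_factor[OF n(2) this assms(4)] obtain a where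
    a: "exp (real m * growth ?\<beta>) \<le> msum (W ?\<beta> (factor (mech (r ?\<beta>)) a m))" by blast
  have "factor (mech (r ?\<beta>)) a m \<in> B"
    unfolding B_def
  proof (intro CollectI conjI allI impI)
    fix k assume k: "k \<le> m"
    \<comment> \<open>The tolerance 2 is made of 1 for the mechanical word and 1 for replacing
      \<open>r (X n)\<close> by \<open>\<gamma>\<close>, which differ by less than
      \<open>1 / m\<close>.\<close>
    have "\<bar>r ?\<beta> * real k - \<gamma> * real k\<bar> = dist (r ?\<beta>) \<gamma> * real k"
      by (simp add: dist_real_def abs_mult left_diff_distrib[symmetric])
    also have "\<dots> \<le> 1 / m * real m" using n(3) k by (intro mult_mono) auto
    also have "\<dots> = 1" using assms(4) by simp
    finally have "\<bar>r ?\<beta> * real k - \<gamma> * real k\<bar> \<le> 1" .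
    moreover have "\<bar>real (num_ones (factor (mech (r ?\<beta>)) a k)) - r ?\<beta> * real k\<bar> \<le> 1"
      by (rule num_ones_factor_mech[OF r01])
    ultimately show "\<bar>real (num_ones (take k (factor (mech (r ?\<beta>)) a m))) - \<gamma> * real k\<bar> \<le> 2"
      unfolding take_factor[OF k] by linarith
  qed simp
  then have "msum (W ?\<beta> (factor (mech (r ?\<beta>)) a m)) < exp (real m * L n)" using n(1) by blast
  moreover have "exp (real m * L n) \<le> exp (real m * growth ?\<beta>)"
    using growth_subgradient[OF assms(2) n(2)] by (simp add: L_def mult_left_mono)
  ultimately show False using a by simp
qed

lemma r_closed_graph:
  assumes "X \<longlonglongrightarrow> \<alpha>" "0 < \<alpha>" "(\<lambda>n. r (X n)) \<longlonglongrightarrow> \<gamma>"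
  shows "\<gamma> = r \<alpha>"
proof -
  have "\<exists>w. length w = m \<and> (0 < m \<longrightarrow> exp (real m * growth \<alpha>) \<le> msum (W \<alpha> w)) \<and>
     (\<forall>k\<le>m. \<bar>real (num_ones (take k w)) - \<gamma> * real k\<bar> \<le> 2)" for m
    using limit_factor[OF assms, of m] by (cases "m = 0") auto
  then obtain w where w: "\<And>m. length (w m) = m" "\<And>m. 0 < m \<Longrightarrow> exp (real m * growth \<alpha>) \<le> msum (W \<alpha> (w m))"
     "\<And>m k. k \<le> m \<Longrightarrow> \<bar>real (num_ones (take k (w m))) - \<gamma> * real k\<bar> \<le> 2"
    by metis
  obtain x where x: "\<And>n. infinite {m. take n (w m) = prefix_of x n}"
    using koenig_words[of w] w(1) by blast
  obtain C where C: "0 < C" "\<And>w. msum (W \<alpha> w) \<le> C * exp (real (length w) * growth \<alpha>)"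
    using msum_le_growth[OF assms(2)] by blast
  have ex: "\<exists>m>n. take n (w m) = prefix_of x n" for n
  proof -
    have "infinite {m. take n (w m) = prefix_of x n}" by (rule x)
    then show ?thesis unfolding infinite_nat_iff_unbounded by blast
  qed
  \<comment> \<open>If a long word has maximal growth up to a constant, so has each of its prefixes,
    because the remainder obeys the upper bound with constant \<open>C\<close>.\<close>
  have low: "1 / C * exp (real n * growth \<alpha>) \<le> msum (W \<alpha> (prefix_of x n))" for n
  proof -
    obtain m where m: "n < m" "take n (w m) = prefix_of x n" using ex by blast
    have "exp (real m * growth \<alpha>) \<le> msum (W \<alpha> (take n (w m) @ drop n (w m)))" using w(2)[of m] m(1) by simp
    also have "\<dots> \<le> msum (W \<alpha> (drop n (w m))) * msum (W \<alpha> (prefix_of x n))"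
      unfolding m(2) using assms(2) by (simp add: msum_W_append)
    also have "\<dots> \<le> (C * exp (real (m - n) * growth \<alpha>)) * msum (W \<alpha> (prefix_of x n))"
      using C(2)[of "drop n (w m)"] w(1)[of m] msum_W_pos[OF assms(2), of "prefix_of x n"]
      by (intro mult_right_mono) auto
    finally have "exp (real m * growth \<alpha>) \<le> (C * exp (real (m - n) * growth \<alpha>)) * msum (W \<alpha> (prefix_of x n))" .
    moreover have "exp (real m * growth \<alpha>) = exp (real (m - n) * growth \<alpha>) * exp (real n * growth \<alpha>)"
      using m(1) by (simp add: exp_add[symmetric] of_nat_diff algebra_simps)
    ultimately have "exp (real n * growth \<alpha>) \<le> C * msum (W \<alpha> (prefix_of x n))"
      by (simp add: mult.assoc mult.left_commute)
    then show ?thesis using C(1) by (simp add: field_simps)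
  qed
  have "weakly_extremal A0 A1 \<alpha> x"
    by (rule weakly_extremalI[OF assms(2) _ low]) (use C(1) in simp)
  then have l: "(\<lambda>n. real (num_ones (prefix_of x n)) / real n) \<longlonglongrightarrow> r \<alpha>"
    using assms(2) by (intro extremal_frequency) auto
  have b: "\<bar>real (num_ones (prefix_of x n)) - \<gamma> * real n\<bar> \<le> 2" for n
    using ex[of n] w(3)[of n] by (metis less_imp_le)
  have "(\<lambda>n. real (num_ones (prefix_of x n)) / real n - \<gamma>) \<longlonglongrightarrow> 0"
  proof (rule Lim_null_comparison)
    show "(\<lambda>n. 2 / real n) \<longlonglongrightarrow> 0" by (rule lim_const_over_n)
    show "\<forall>\<^sub>F n in sequentially. norm (real (num_ones (prefix_of x n)) / real n - \<gamma>) \<le> 2 / real n"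
      using eventually_gt_at_top[of 0]
    proof eventually_elim
      case (elim n)
      have "real (num_ones (prefix_of x n)) / real n - \<gamma> = (real (num_ones (prefix_of x n)) - \<gamma> * real n) / real n"
        using elim by (simp add: field_simps)
      then have "norm (real (num_ones (prefix_of x n)) / real n - \<gamma>) = \<bar>real (num_ones (prefix_of x n)) - \<gamma> * real n\<bar> / real n"
        by (simp add: abs_divide)
      then show ?case using b[of n] by (simp add: divide_right_mono)
    qed
  qed
  then have "(\<lambda>n. real (num_ones (prefix_of x n)) / real n) \<longlonglongrightarrow> \<gamma>" by (simp add: LIM_zero_iff)
  then show ?thesis using l by (rule LIMSEQ_unique)
qed

text \<open>A map into the compact interval from 0 to 1 with closed graph is continuous. At 0, where
  logarithms fail, \<open>r_small\<close> and monotonicity take over.\<close>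

lemma r_continuous: "continuous_on {0..} r"
proof -
  have "continuous_on {0<..} r"
  proof -
    have "closedin (top_of_set ({0<..} \<times> {0..1})) ((\<lambda>x. (x, r x)) ` {0<..})"
      unfolding closedin_limpt islimpt_sequential
    proof (intro conjI allI impI)
      show "(\<lambda>x. (x, r x)) ` {0<..} \<subseteq> {0<..} \<times> {0..1}" using r_range by force
    next
      fix l :: "real \<times> real"
      assume "(\<exists>Y. (\<forall>n. Y n \<in> (\<lambda>x. (x, r x)) ` {0<..} - {l}) \<and> Y \<longlonglongrightarrow> l) \<and> l \<in> {0<..} \<times> {0..1}"
      then obtain Y where a: "\<And>n. Y n \<in> (\<lambda>x. (x, r x)) ` {0<..}" "Y \<longlonglongrightarrow> l" "l \<in> {0<..} \<times> {0..1}"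
        by blast
      have Y: "snd (Y n) = r (fst (Y n))" for n using a(1)[of n] by auto
      have "(\<lambda>n. fst (Y n)) \<longlonglongrightarrow> fst l" "(\<lambda>n. r (fst (Y n))) \<longlonglongrightarrow> snd l"
        using tendsto_fst[OF a(2)] tendsto_snd[OF a(2)] by (simp_all add: Y)
      then have "snd l = r (fst l)" using a(3) by (intro r_closed_graph[of "\<lambda>n. fst (Y n)"]) auto
      then show "l \<in> (\<lambda>x. (x, r x)) ` {0<..}" using a(3) by (cases l) auto
    qed
    moreover have "r \<in> {0<..} \<rightarrow> {0..1}" using r_range by auto
    ultimately show ?thesis using continuous_closed_graph_eq[of "{0..1}" r "{0<..}"] by simp
  qed
  then have pos: "isCont r \<alpha>" if "0 < \<alpha>" for \<alpha>
    using that by (simp add: continuous_on_eq_continuous_at open_greaterThan)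
  have zero: "continuous (at 0 within {0..}) r"
    unfolding continuous_within
  proof (rule order_tendstoI)
    fix a assume "a < r 0"
    then have "a < r x" if "0 \<le> x" for x using r_zero r_range(1)[OF that] by simp
    then show "\<forall>\<^sub>F x in at 0 within {0..}. a < r x"
      unfolding eventually_at_filter by (simp add: always_eventually)
  next
    fix a assume "r 0 < a"
    then obtain \<alpha> where \<alpha>: "0 < \<alpha>" "r \<alpha> < a" using r_small[of a] r_zero by auto
    have "\<forall>\<^sub>F x in nhds 0. x < \<alpha>" by (rule eventually_nhds_in_open[of "{..<\<alpha>}", simplified]) (use \<alpha> in auto)
    then show "\<forall>\<^sub>F x in at 0 within {0..}. r x < a"
      unfolding eventually_at_filter
      by eventually_elim (auto intro!: le_less_trans[OF r_mono \<alpha>(2)])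
  qed
  show ?thesis
    unfolding continuous_on_eq_continuous_within
  proof
    fix x :: real assume "x \<in> {0..}"
    then show "continuous (at x within {0..}) r"
      using zero pos[of x] by (cases "x = 0") (auto intro: continuous_at_imp_continuous_at_within)
  qed
qed

text \<open>The value 1 is left out because it may be approached only as \<open>\<alpha>\<close>
  tends to infinity.\<close>

lemma r_IVT:
  assumes "0 \<le> \<gamma>" "\<gamma> < 1"
  obtains \<alpha> where "0 \<le> \<alpha>" "r \<alpha> = \<gamma>" "0 < \<gamma> \<Longrightarrow> 0 < \<alpha>"
proof -
  obtain \<beta> where \<beta>: "0 < \<beta>" "\<gamma> < r \<beta>" using r_large[of "1 - \<gamma>"] assms by auto
  have "\<exists>x\<ge>0. x \<le> \<beta> \<and> r x = \<gamma>"
    using \<beta> r_zero assms by (intro IVT' continuous_on_subset[OF r_continuous]) auto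
  then obtain x where "0 \<le> x" "r x = \<gamma>" by blast
  then show ?thesis using that[of x] r_zero by (cases "x = 0") auto
qed

lemma jsr_at_word:
  assumes "0 < \<alpha>" "w \<noteq> []" "per w \<in> sturmian_set (slope w)" "r \<alpha> = slope w"
  shows "growth \<alpha> = (ln (\<rho> w) + num_ones w * ln \<alpha>) / length w"
    and "jsr A0 A1 \<alpha> = root (length w) (perron (W \<alpha> w))"
proof -
  have "weakly_extremal A0 A1 \<alpha> (per w)"
    using assms by (intro sturmian_extremal) auto
  then show j: "jsr A0 A1 \<alpha> = root (length w) (perron (W \<alpha> w))"
    using assms by (intro per_extremal perron_W_pos) auto
  have "growth \<alpha> = ln (jsr A0 A1 \<alpha>)" using jsr_growth[OF assms(1)] by simp
  also have "\<dots> = ln (perron (W \<alpha> w)) / length w"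
    unfolding j using assms(2) perron_W_pos[OF assms(1)] by (simp add: ln_root)
  also have "ln (perron (W \<alpha> w)) = num_ones w * ln \<alpha> + ln (\<rho> w)"
    using assms(1) \<rho>_pos[of w] by (simp add: perron_W[of \<alpha>] ln_mult ln_realpow)
  finally show "growth \<alpha> = (ln (\<rho> w) + num_ones w * ln \<alpha>) / length w" by (simp add: add.commute)
qed

end

section \<open>Plateaus\<close>

lemma rank_one_decomp:
  fixes M :: "real^2^2"
  assumes "det M = 0"
  obtains x y :: "real^2" where "\<And>i j. M$i$j = x$i * y$j"
proof -
  have d: "M$1$1 * M$2$2 = M$1$2 * M$2$1" using assms by (simp add: det_2)
  have "\<exists>x1 x2 y1 y2. M$1$1 = x1 * y1 \<and> M$1$2 = x1 * y2 \<and> M$2$1 = x2 * y1 \<and> M$2$2 = x2 * y2"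
  proof (cases "M$1$1 = 0 \<and> M$1$2 = 0")
    case True
    then show ?thesis by (intro exI[of _ 0] exI[of _ 1] exI[of _ "M$2$1"] exI[of _ "M$2$2"]) simp
  next
    case False
    show ?thesis
    proof (cases "M$1$1 = 0")
      case True
      with False d show ?thesis
        by (intro exI[of _ 1] exI[of _ "M$2$2 / M$1$2"] exI[of _ "M$1$1"] exI[of _ "M$1$2"]) auto
    next
      case False
      with d show ?thesis
        by (intro exI[of _ 1] exI[of _ "M$2$1 / M$1$1"] exI[of _ "M$1$1"] exI[of _ "M$1$2"]) (auto simp: field_simps)
    qed
  qed
  then obtain x1 x2 y1 y2 where xy: "M$1$1 = x1 * y1" "M$1$2 = x1 * y2" "M$2$1 = x2 * y1" "M$2$2 = x2 * y2" by blast
  have "M$i$j = (vector [x1, x2] :: real^2)$i * (vector [y1, y2] :: real^2)$j" for i j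
    using xy exhaust_2[of i] exhaust_2[of j] by auto
  then show ?thesis by (rule that)
qed

text \<open>Let \<open>a\<close>, \<open>c\<close> be the eigenvectors of \<open>A\<close> and
  \<open>b\<close>, \<open>d\<close> the dual basis. Inserting the identity between
  \<open>B1\<close> and \<open>B2\<close> splits \<open>b A a\<close> into
  \<open>(b B1 a) (b B2 a) + (b B1 c) (d B2 a)\<close>. Equality kills the second term, so
  \<open>c\<close> is an eigenvector of \<open>B1\<close> or \<open>a\<close> is one of
  \<open>B2\<close>; invertibility gives the other factor.\<close>

lemma trace_product_common_eigenvector:
  fixes B1 B2 :: "real^2^2"
  defines "A \<equiv> B1 ** B2"
  assumes A: "nonneg_mat A" "0 < disc2 A" and det: "det B1 \<noteq> 0" "det B2 \<noteq> 0"
    and eq: "trace (perron_proj A ** B1) * trace (perron_proj A ** B2) = perron A"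
  shows "\<exists>x s t. x \<noteq> 0 \<and> B1 *v x = s *\<^sub>R x \<and> B2 *v x = t *\<^sub>R x"
proof -
  define P Q where "P = perron_proj A" and "Q = mat 1 - P"
  have dP: "det P = 0" "trace P = 1" unfolding P_def using perron_proj_det[OF A] perron_proj_trace[OF A(2)] .
  have dQ: "det Q = 0" "trace Q = 1" using dP by (simp_all add: Q_def det_2 trace2 algebra_simps)
  have AP: "A ** P = perron A *\<^sub>R P" and AQ: "A ** Q = coperron A *\<^sub>R Q"
    unfolding Q_def P_def using perron_proj_eigen[OF A] by auto
  have PA: "P ** A = perron A *\<^sub>R P" unfolding P_def using perron_proj_eigen[OF A] by auto
  obtain a b :: "real^2" where ab: "\<And>i j. P$i$j = a$i * b$j" using rank_one_decomp[OF dP(1)] by blast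
  obtain c d :: "real^2" where cd: "\<And>i j. Q$i$j = c$i * d$j" using rank_one_decomp[OF dQ(1)] by blast
  have ba: "a$1 * b$1 + a$2 * b$2 = 1" and dc: "c$1 * d$1 + c$2 * d$2 = 1"
    using dP(2) dQ(2) by (simp_all add: trace2 ab cd)
  define bil :: "real^2 \<Rightarrow> real^2^2 \<Rightarrow> real^2 \<Rightarrow> real"
    where "bil y B x = y$1 * (B *v x)$1 + y$2 * (B *v x)$2" for y B x
  have PQ: "a$i * b$j + c$i * d$j = (mat 1 :: real^2^2)$i$j" for i j
    unfolding ab[symmetric] cd[symmetric] by (simp add: Q_def)
  have id: "B *v x = bil b B x *\<^sub>R a + bil d B x *\<^sub>R c" for B x
  proof (rule vec2_eqI)
    show "(B *v x) $ 1 = (bil b B x *\<^sub>R a + bil d B x *\<^sub>R c) $ 1"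
      using PQ[of 1 1] PQ[of 1 2] unfolding bil_def by simp algebra
    show "(B *v x) $ 2 = (bil b B x *\<^sub>R a + bil d B x *\<^sub>R c) $ 2"
      using PQ[of 2 1] PQ[of 2 2] unfolding bil_def by simp algebra
  qed
  have "bil b B1 a * bil b B2 a + bil b B1 c * bil d B2 a = trace (P ** A)"
  proof -
    have "trace (P ** A) = b$1 * (B1 *v (B2 *v a))$1 + b$2 * (B1 *v (B2 *v a))$2"
      by (simp add: trace2 ab A_def algebra_simps)
    also have "B1 *v (B2 *v a) = bil b B2 a *\<^sub>R (B1 *v a) + bil d B2 a *\<^sub>R (B1 *v c)"
      unfolding id[of B2 a] by (rule vec2_eqI) (simp_all add: algebra_simps)
    finally show ?thesis by (simp add: bil_def algebra_simps)
  qed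
  moreover have "trace (P ** A) = perron A" unfolding PA using dP(2) by (simp add: trace2 distrib_left[symmetric])
  moreover have "bil b B a = trace (P ** B)" for B by (simp add: bil_def trace2 ab algebra_simps)
  ultimately have "bil b B1 c * bil d B2 a = 0" using eq by (simp add: P_def)
  have a0: "a \<noteq> 0" and c0: "c \<noteq> 0" using ba dc by auto
  have inj: "x = y" if "det B \<noteq> 0" "B *v x = B *v y" for B :: "real^2^2" and x y
    using that by (metis invertible_det_nz invertible_def matrix_left_invertible_injective injD)
  have sc: "\<exists>t. B2 *v x = t *\<^sub>R x" if "B1 *v x = s *\<^sub>R x" "A *v x = m *\<^sub>R x" "x \<noteq> 0" for x s m
  proof -
    have "s \<noteq> 0"
    proof
      assume "s = 0"
      then have "B1 *v x = B1 *v 0" using that(1) by simp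
      then show False using inj[OF det(1)] that(3) by blast
    qed
    then have "B1 *v (B2 *v x) = B1 *v ((m / s) *\<^sub>R x)"
      using that(1,2) by (simp add: A_def matrix_vector_mul_assoc matrix_vector_mult_scaleR)
    then show ?thesis using inj[OF det(1)] by blast
  qed
  have sc': "\<exists>t. B1 *v x = t *\<^sub>R x" if "B2 *v x = s *\<^sub>R x" "A *v x = m *\<^sub>R x" "x \<noteq> 0" for x s m
  proof -
    have "s \<noteq> 0"
    proof
      assume "s = 0"
      then have "B2 *v x = B2 *v 0" using that(1) by simp
      then show False using inj[OF det(2)] that(3) by blast
    qed
    have "s *\<^sub>R (B1 *v x) = m *\<^sub>R x"
      using that(1,2) by (simp add: A_def matrix_vector_mul_assoc[symmetric] matrix_vector_mult_scaleR)
    then have "B1 *v x = (m / s) *\<^sub>R x"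
      using \<open>s \<noteq> 0\<close> by (metis divideR_right scaleR_scaleR divide_inverse mult.commute vector_fraction_eq_iff)
    then show ?thesis by blast
  qed
  have Aa: "A *v a = perron A *\<^sub>R a"
  proof (rule vec2_eqI)
    have "(A ** P)$i$j = perron A * P$i$j" for i j using AP by simp
    then have "(A *v a)$i * b$j = perron A * a$i * b$j" for i j by (simp add: ab algebra_simps)
    moreover have "b$1 \<noteq> 0 \<or> b$2 \<noteq> 0" using ba by auto
    ultimately show "(A *v a)$1 = (perron A *\<^sub>R a)$1" "(A *v a)$2 = (perron A *\<^sub>R a)$2"
      by (metis mult_right_cancel vector_scaleR_component real_scaleR_def)+
  qed
  have Ac: "A *v c = coperron A *\<^sub>R c"
  proof (rule vec2_eqI)
    have "(A ** Q)$i$j = coperron A * Q$i$j" for i j using AQ by simp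
    then have "(A *v c)$i * d$j = coperron A * c$i * d$j" for i j by (simp add: cd algebra_simps)
    moreover have "d$1 \<noteq> 0 \<or> d$2 \<noteq> 0" using dc by auto
    ultimately show "(A *v c)$1 = (coperron A *\<^sub>R c)$1" "(A *v c)$2 = (coperron A *\<^sub>R c)$2"
      by (metis mult_right_cancel vector_scaleR_component real_scaleR_def)+
  qed
  consider "bil b B1 c = 0" | "bil d B2 a = 0" using \<open>bil b B1 c * bil d B2 a = 0\<close> by auto
  then show ?thesis
  proof cases
    case 1
    then have "B1 *v c = bil d B1 c *\<^sub>R c" using id[of B1 c] by simp
    with sc[OF this Ac c0] c0 show ?thesis by blast
  next
    case 2
    then have "B2 *v a = bil b B2 a *\<^sub>R a" using id[of B2 a] by simp
    with sc'[OF this Aa a0] a0 show ?thesis by blast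
  qed
qed

lemma matrix_power_shift: "matrix_power (B1 ** B2) n ** B1 = B1 ** matrix_power (B2 ** B1) n"
  by (induction n) (simp_all add: matrix_power_Suc matrix_mul_assoc[symmetric])

lemma disc2_pos_mat: "pos_mat M \<Longrightarrow> 0 < disc2 M"
  by (simp add: disc2_def pos_mat_2 add_nonneg_pos)

lemma trace_pos_mat: "pos_mat M \<Longrightarrow> 0 < trace M" for M :: "real^2^2"
  by (simp add: trace2 pos_mat_2)

lemma ln_perron_power_mult_limit:
  assumes "nonneg_mat A" "0 < trace A" "0 < disc2 A" "nonneg_mat B" "pos_mat (A ** B)"
    and pos: "\<And>k. 0 < perron (matrix_power A k ** B)"
  shows "(\<lambda>k. ln (perron (matrix_power A k ** B)) - real k * ln (perron A)) \<longlonglongrightarrow> ln (trace (perron_proj A ** B))"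
proof -
  have t: "0 < trace (perron_proj A ** B)" by (rule trace_perron_proj_mult_pos[OF assms(1,2,3,5)])
  have "(\<lambda>k. ln (perron (matrix_power A k ** B) / perron A ^ k)) \<longlonglongrightarrow> ln (trace (perron_proj A ** B))"
    using t by (intro tendsto_ln perron_power_mult_limit assms) auto
  moreover have "ln (perron (matrix_power A k ** B) / perron A ^ k) = ln (perron (matrix_power A k ** B)) - real k * ln (perron A)" for k
    using pos[of k] perron_pos[OF assms(1,2)] by (simp add: ln_div ln_realpow)
  ultimately show ?thesis by simp
qed

text \<open>If the discriminant vanished, \<open>A\<close> would be a Jordan block, and then \<open>\<rho>(A\<^sup>k B)\<close> grows like
  \<open>k \<rho>(A)\<^sup>k\<close> because its off-diagonal entry meets a non-zero entry of \<open>B\<close>.\<close>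

lemma disc2_pos_if_power_product_bounded:
  assumes A: "nonneg_mat A" "0 < trace A" "\<And>c. A \<noteq> c *\<^sub>R mat 1" and B: "nonneg_mat B"
    and irr: "\<And>x s t. A *v x = s *\<^sub>R x \<Longrightarrow> B *v x = t *\<^sub>R x \<Longrightarrow> x = (0 :: real^2)"
    and bounded: "\<And>k. perron (matrix_power A k ** B) \<le> c * perron A ^ k"
  shows "0 < disc2 A"
proof (rule ccontr)
  assume "\<not> ?thesis"
  then have disc: "disc2 A = 0" using disc2_nonneg[OF A(1)] by simp
  define a where "a = perron A"
  have nn: "0 \<le> A$1$1" "0 \<le> A$1$2" "0 \<le> A$2$1" "0 \<le> A$2$2" using A(1) by (auto simp: nonneg_mat_2)
  \<comment> \<open>Both summands of the discriminant are non-negative, so both vanish: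
    \<open>A\<close> is triangular with equal diagonal entries.\<close>
  have "(A$1$1 - A$2$2)\<^sup>2 = 0" "A$1$2 * A$2$1 = 0"
    using disc nn mult_nonneg_nonneg[OF nn(2,3)] zero_le_power2[of "A$1$1 - A$2$2"]
    unfolding disc2_def by linarith+
  then have d: "A$1$1 = A$2$2" and od: "A$1$2 = 0 \<or> A$2$1 = 0" by auto
  have aA: "A$1$1 = a" "A$2$2 = a" using d disc by (simp_all add: a_def perron_def trace2)
  have a0: "0 < a" using A(2) aA by (simp add: trace2)
  have nz: "A$1$2 \<noteq> 0 \<or> A$2$1 \<noteq> 0"
  proof (rule ccontr)
    assume "\<not> ?thesis"
    then have "A = a *\<^sub>R mat 1" using aA by (intro matrix2_eqI) auto
    then show False using A(3) by blast
  qed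
  define s where "s = A$1$2 + A$2$1"
  have s0: "0 < s" using nz nn by (auto simp: s_def add_pos_nonneg add_nonneg_pos)
  have ent: "matrix_power A k $1$1 = a ^ k \<and> matrix_power A k $2$2 = a ^ k \<and>
      a * matrix_power A k $1$2 = real k * a ^ k * A$1$2 \<and> a * matrix_power A k $2$1 = real k * a ^ k * A$2$1" for k
  proof (induction k)
    case (Suc k)
    have z: "A$1$2 * matrix_power A k $2$1 = 0" "A$2$1 * matrix_power A k $1$2 = 0"
      using Suc od a0 by auto
    show ?case using Suc z by (simp add: matrix_power_Suc aA algebra_simps)
  qed simp
  define t where "t = A$1$2 * B$2$1 + A$2$1 * B$1$2"
  have Bnn: "0 \<le> B$1$1" "0 \<le> B$1$2" "0 \<le> B$2$1" "0 \<le> B$2$2" using B by (auto simp: nonneg_mat_2)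
  \<comment> \<open>If the off-diagonal entry of \<open>A\<close> met a zero of \<open>B\<close>,
    both matrices would be triangular of the same kind and share a coordinate vector as
    eigenvector.\<close>
  have t0: "0 < t"
  proof (rule ccontr)
    assume "\<not> ?thesis"
    then have z: "A$1$2 * B$2$1 = 0" "A$2$1 * B$1$2 = 0"
      using nn Bnn mult_nonneg_nonneg[OF nn(2) Bnn(3)] mult_nonneg_nonneg[OF nn(3) Bnn(2)] unfolding t_def by linarith+
    show False
    proof (cases "A$1$2 = 0")
      case True
      then have "A$2$1 \<noteq> 0" "B$1$2 = 0" using nz z by auto
      then have "A *v vector [0, 1] = a *\<^sub>R vector [0, 1]" "B *v vector [0, 1] = (B$2$2) *\<^sub>R vector [0, 1]"
        using True aA by (auto intro!: vec2_eqI)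
      then have "vector [0, 1] = (0 :: real^2)" by (rule irr)
      then show False by (simp add: vec_eq_iff forall_2)
    next
      case False
      then have "A$2$1 = 0" "B$2$1 = 0" using od z by auto
      then have "A *v vector [1, 0] = a *\<^sub>R vector [1, 0]" "B *v vector [1, 0] = (B$1$1) *\<^sub>R vector [1, 0]"
        using aA by (auto intro!: vec2_eqI)
      then have "vector [1, 0] = (0 :: real^2)" by (rule irr)
      then show False by (simp add: vec_eq_iff forall_2)
    qed
  qed
  have "real k * t \<le> 2 * a * c" for k
  proof -
    let ?M = "matrix_power A k"
    have M: "nonneg_mat ?M" by (rule nonneg_matrix_power[OF A(1)])
    have "real k * a ^ k * t = a * (?M$1$2 * B$2$1 + ?M$2$1 * B$1$2)"
      using ent[of k] by (simp add: t_def distrib_left mult.assoc[symmetric])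
    also have "\<dots> \<le> a * trace (?M ** B)"
      using M Bnn a0 by (intro mult_left_mono) (auto simp: trace2 nonneg_mat_2)
    also have "\<dots> \<le> a * (2 * (c * a ^ k))"
      using perron_ge_half_trace[OF nonneg_mat_mult[OF M B]] bounded[of k] a0
      by (intro mult_left_mono) (auto simp: a_def)
    finally have "(real k * t) * a ^ k \<le> (2 * a * c) * a ^ k" by (simp add: ac_simps)
    then show ?thesis using a0 by simp
  qed
  moreover obtain k where "2 * a * c / t < real k" using reals_Archimedean2 by blast
  then have "2 * a * c < real k * t" using t0 by (simp add: field_simps)
  ultimately show False by (simp add: not_less[symmetric])
qed

context matrix_pair
begin

text \<open>Both generating rules can be undone: an eigenvector of \<open>W 1 (u @ v)\<close> and
  \<open>W 1 v\<close> is also one of \<open>W 1 u\<close>, by invertibility. A common eigenvector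
  thus descends to \<open>A0\<close> and \<open>A1\<close>.\<close>

lemma standard_pair_no_common_eigenvector:
  fixes x :: "real^2"
  assumes "(u, v) \<in> standard_pairs" "W 1 u *v x = s *\<^sub>R x" "W 1 v *v x = t *\<^sub>R x"
  shows "x = 0"
proof (rule ccontr)
  assume x: "x \<noteq> 0"
  have inj: "y = z" if "W 1 w *v y = W 1 w *v z" for w y z
    using that det_W[of w] by (metis invertible_det_nz invertible_def matrix_left_invertible_injective injD)
  have step: "\<exists>t'. W 1 b *v x = t' *\<^sub>R x" if "W 1 a *v (W 1 b *v x) = m *\<^sub>R x" "W 1 a *v x = n *\<^sub>R x" for a b m n
  proof -
    have "n \<noteq> 0"
    proof
      assume "n = 0"
      then have "W 1 a *v x = W 1 a *v 0" using that(2) by simp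
      then show False using inj x by blast
    qed
    then have "W 1 a *v (W 1 b *v x) = W 1 a *v ((m / n) *\<^sub>R x)"
      using that by (simp add: matrix_vector_mult_scaleR)
    then show ?thesis using inj by blast
  qed
  have "\<not> ((\<exists>s. W 1 u *v x = s *\<^sub>R x) \<and> (\<exists>t. W 1 v *v x = t *\<^sub>R x))"
    using assms(1)
  proof induction
    case base
    show ?case using no_common_eigenvector[of x] x
      by (auto simp: word_matrix_single letter_matrix_def)
  next
    case (left u v)
    then show ?case using step[of v u]
      by (auto simp: word_matrix_append matrix_vector_mul_assoc[symmetric])
  next
    case (right u v)
    then show ?case using step[of u v]
      by (auto simp: word_matrix_append matrix_vector_mul_assoc[symmetric])
  qed
  then show False using assms by blast
qed

text \<open>\<open>exp (log_ratio u v)\<close> is the parameter \<open>\<alpha>\<close> at which \<open>\<rho>(A\<^sub>\<alpha>(u))\<^bsup>1/|u|\<^esup> = \<rho>(A\<^sub>\<alpha>(v))\<^bsup>1/|v|\<^esup>\<close>, provided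
  that \<open>(u, v)\<close> is a standard pair.\<close>

definition log_ratio :: "bool list \<Rightarrow> bool list \<Rightarrow> real" where
  "log_ratio u v = real (length v) * ln (\<rho> u) - real (length u) * ln (\<rho> v)"

end

section \<open>Slopes in standard pairs and the ends of the plateaus\<close>

lemma slope_append_commute: "slope (v @ u) = slope (u @ v)"
  by (simp add: slope_def add.commute)

lemma slope_nonneg: "0 \<le> slope u" and slope_le_1: "slope u \<le> 1"
  using num_ones_le_length[of u] by (auto simp: slope_def divide_le_eq_1)

lemma standard_pair_slope_bounds:
  assumes "(u, v) \<in> standard_pairs"
  shows "slope u < slope v" "slope u < 1" "0 < slope v"
proof -
  have "0 < 1 / (real (length u) * real (length v))" using standard_pair_nonempty[OF assms] by simp
  then show "slope u < slope v" using standard_pair_slope_less[OF assms] by linarith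
  then show "slope u < 1" "0 < slope v" using slope_le_1[of v] slope_nonneg[of u] by linarith+
qed

lemma slope_wpow_limit:
  assumes "v \<noteq> []"
  shows "(\<lambda>k. slope (u @ wpow v k)) \<longlonglongrightarrow> slope v"
proof -
  have q: "0 < real (length v)" using assms by simp
  have "(\<lambda>k. (real (num_ones u) / real k + real (num_ones v)) / (real (length u) / real k + real (length v)))
     \<longlonglongrightarrow> (0 + real (num_ones v)) / (0 + real (length v))"
    using q by (intro tendsto_divide tendsto_add lim_const_over_n tendsto_const) simp
  moreover have "\<forall>\<^sub>F k in sequentially. (real (num_ones u) / real k + real (num_ones v)) / (real (length u) / real k + real (length v)) = slope (u @ wpow v k)"
    using eventually_gt_at_top[of 0]
  proof eventually_elim
    case (elim k)
    have "slope (u @ wpow v k) = ((real (num_ones u) + real k * real (num_ones v)) / real k) / ((real (length u) + real k * real (length v)) / real k)"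
      using elim by (simp add: slope_def)
    then show ?case using elim by (simp add: add_divide_distrib)
  qed
  ultimately show ?thesis by (simp add: slope_def[of v] Lim_transform_eventually)
qed

context sturmian_pair
begin

text \<open>On the plateau of \<open>v\<close> the growth is the affine function of
  \<open>v\<close>, which therefore dominates that of \<open>u\<close> there, and conversely. The
  determinant 1 of the pair makes the coefficient of \<open>ln \<alpha>\<close> in this comparison
  equal to 1.\<close>

lemma plateau_bounds:
  assumes "(u, v) \<in> standard_pairs" "0 < \<alpha>"
  shows "r \<alpha> = slope v \<Longrightarrow> log_ratio u v \<le> ln \<alpha>"
    and "r \<alpha> = slope u \<Longrightarrow> ln \<alpha> \<le> log_ratio u v"
proof -
  define p1 q1 p2 q2 where "p1 = real (num_ones u)" "q1 = real (length u)" "p2 = real (num_ones v)" "q2 = real (length v)"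
  note defs = this
  have q: "0 < q1" "0 < q2" using standard_pair_nonempty[OF assms(1)] by (auto simp: defs)
  have d: "p2 * q1 = p1 * q2 + 1"
    using arg_cong[OF standard_pair_det[OF assms(1)], of real] by (simp add: defs)
  have lu: "ln (\<rho> u) + p1 * ln \<alpha> \<le> q1 * growth \<alpha>"
    using growth_lower[OF assms(2) standard_pair_nonempty(1)[OF assms(1)]] q by (simp add: defs field_simps)
  have lv: "ln (\<rho> v) + p2 * ln \<alpha> \<le> q2 * growth \<alpha>"
    using growth_lower[OF assms(2) standard_pair_nonempty(2)[OF assms(1)]] q by (simp add: defs field_simps)
  show "log_ratio u v \<le> ln \<alpha>" if "r \<alpha> = slope v"
  proof -
    have "growth \<alpha> = (ln (\<rho> v) + p2 * ln \<alpha>) / q2"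
      using jsr_at_word(1)[OF assms(2) standard_pair_nonempty(2)[OF assms(1)] standard_pair_per(2)[OF assms(1)] that]
      by (simp add: defs)
    then have g: "q2 * growth \<alpha> = ln (\<rho> v) + p2 * ln \<alpha>" using q by simp
    have "q2 * (ln (\<rho> u) + p1 * ln \<alpha>) \<le> q2 * (q1 * growth \<alpha>)" using lu q by simp
    also have "\<dots> = q1 * (ln (\<rho> v) + p2 * ln \<alpha>)" using g by (simp add: mult.left_commute)
    finally have "q2 * ln (\<rho> u) - q1 * ln (\<rho> v) \<le> (p2 * q1 - p1 * q2) * ln \<alpha>" by (simp add: algebra_simps)
    then show ?thesis using d by (simp add: log_ratio_def defs)
  qed
  show "ln \<alpha> \<le> log_ratio u v" if "r \<alpha> = slope u"
  proof -
    have "growth \<alpha> = (ln (\<rho> u) + p1 * ln \<alpha>) / q1"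
      using jsr_at_word(1)[OF assms(2) standard_pair_nonempty(1)[OF assms(1)] standard_pair_per(1)[OF assms(1)] that]
      by (simp add: defs)
    then have g: "q1 * growth \<alpha> = ln (\<rho> u) + p1 * ln \<alpha>" using q by simp
    have "q1 * (ln (\<rho> v) + p2 * ln \<alpha>) \<le> q1 * (q2 * growth \<alpha>)" using lv q by simp
    also have "\<dots> = q2 * (ln (\<rho> u) + p1 * ln \<alpha>)" using g by (simp add: mult.left_commute)
    finally have "(p2 * q1 - p1 * q2) * ln \<alpha> \<le> q2 * ln (\<rho> u) - q1 * ln (\<rho> v)" by (simp add: algebra_simps)
    then show ?thesis using d by (simp add: log_ratio_def defs)
  qed
qed

text \<open>The slopes of \<open>u v^k\<close> tend to that of \<open>v\<close>, so for large
  \<open>k\<close> the plateau of \<open>u v^k\<close> lies to the right of \<open>\<alpha>\<close>;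
  a point \<open>\<beta>\<close> on it is bounded through the pair
  \<open>(u v^k, v)\<close>.\<close>

lemma r_less_slope:
  assumes "(u, v) \<in> standard_pairs" "0 < \<alpha>" "r \<alpha> < slope v"
  shows "\<forall>\<^sub>F k in sequentially. ln \<alpha> \<le> log_ratio (u @ wpow v k) v"
proof -
  have "\<forall>\<^sub>F k in sequentially. r \<alpha> < slope (u @ wpow v k)"
    by (rule order_tendstoD(1)[OF slope_wpow_limit assms(3)]) (rule standard_pair_nonempty(2)[OF assms(1)])
  then show ?thesis
  proof eventually_elim
    case (elim k)
    have st: "(u @ wpow v k, v) \<in> standard_pairs" by (rule standard_pair_iterate(1)[OF assms(1)])
    have pos: "0 < slope (u @ wpow v k)" using elim r_range(1)[of \<alpha>] assms(2) by simp
    obtain \<beta> where \<beta>: "0 < \<beta>" "r \<beta> = slope (u @ wpow v k)"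
      using r_IVT[OF slope_nonneg standard_pair_slope_bounds(2)[OF st]] pos by metis
    have "\<alpha> < \<beta>" using r_mono[of \<beta> \<alpha>] \<beta> elim by (smt (verit))
    then have "ln \<alpha> \<le> ln \<beta>" using assms(2) by simp
    also have "\<dots> \<le> log_ratio (u @ wpow v k) v" by (rule plateau_bounds(2)[OF st \<beta>])
    finally show ?case .
  qed
qed

lemma r_greater_slope:
  assumes "(u, v) \<in> standard_pairs" "0 < \<alpha>" "slope u < r \<alpha>"
  shows "\<forall>\<^sub>F k in sequentially. log_ratio u (v @ wpow u k) \<le> ln \<alpha>"
proof -
  have "\<forall>\<^sub>F k in sequentially. slope (v @ wpow u k) < r \<alpha>"
    by (rule order_tendstoD(2)[OF slope_wpow_limit assms(3)]) (rule standard_pair_nonempty(1)[OF assms(1)])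
  then show ?thesis
  proof eventually_elim
    case (elim k)
    have st: "(u, v @ wpow u k) \<in> standard_pairs" by (rule standard_pair_iterate(2)[OF assms(1)])
    have l1: "slope (v @ wpow u k) < 1" using elim r_range(2)[of \<alpha>] assms(2) by simp
    obtain \<beta> where \<beta>: "0 < \<beta>" "r \<beta> = slope (v @ wpow u k)"
      using r_IVT[OF slope_nonneg l1] standard_pair_slope_bounds(3)[OF st] by metis
    have "\<beta> < \<alpha>" using r_mono[of \<alpha> \<beta>] assms(2) \<beta> elim by (smt (verit))
    have "log_ratio u (v @ wpow u k) \<le> ln \<beta>" by (rule plateau_bounds(1)[OF st \<beta>])
    also have "\<dots> \<le> ln \<alpha>" using \<open>\<beta> < \<alpha>\<close> \<beta>(1) by simp
    finally show ?case .
  qed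
qed

text \<open>One direction evaluates \<open>plateau_bounds\<close> for the pairs
  \<open>(u v^k, v)\<close> at a point where \<open>r\<close> takes the value
  \<open>slope v\<close>; the other is \<open>r_less_slope\<close> in the limit. As an inequality
  the statement includes \<open>slope v = 1\<close>, where the plateau has no right end.\<close>

lemma plateau_left_end:
  assumes "(u, v) \<in> standard_pairs" "(\<lambda>k. log_ratio (u @ wpow v k) v) \<longlonglongrightarrow> L" "0 \<le> \<alpha>"
  shows "slope v \<le> r \<alpha> \<longleftrightarrow> exp L \<le> \<alpha>"
proof
  assume a: "slope v \<le> r \<alpha>"
  have "\<exists>\<beta>>0. \<beta> \<le> \<alpha> \<and> r \<beta> = slope v"
  proof (cases "r \<alpha> = slope v")
    case True
    then have "0 < \<alpha>" using assms(3) r_zero standard_pair_slope_bounds(3)[OF assms(1)] by (cases "\<alpha> = 0") auto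
    then show ?thesis using True by blast
  next
    case False
    then have lt: "slope v < r \<alpha>" "slope v < 1" using a r_range(2)[OF assms(3)] by auto
    obtain \<beta> where \<beta>: "0 < \<beta>" "r \<beta> = slope v"
      using r_IVT[OF slope_nonneg lt(2)] standard_pair_slope_bounds(3)[OF assms(1)] by metis
    then have "\<beta> \<le> \<alpha>" using r_mono[of \<alpha> \<beta>] assms(3) lt(1) by (smt (verit))
    then show ?thesis using \<beta> by blast
  qed
  then obtain \<beta> where \<beta>: "0 < \<beta>" "\<beta> \<le> \<alpha>" "r \<beta> = slope v" by blast
  have "L \<le> ln \<beta>"
    using assms(2) plateau_bounds(1)[OF standard_pair_iterate(1)[OF assms(1)] \<beta>(1,3)]
    by (intro LIMSEQ_le_const2) auto
  then have "exp L \<le> \<beta>" using \<beta>(1) by (metis exp_le_cancel_iff exp_ln)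
  then show "exp L \<le> \<alpha>" using \<beta>(2) by simp
next
  assume a: "exp L \<le> \<alpha>"
  have gt: "slope v \<le> r \<beta>" if "exp L < \<beta>" for \<beta>
  proof (rule ccontr)
    assume "\<not> ?thesis"
    moreover have \<beta>: "0 < \<beta>" using that exp_gt_zero[of L] by linarith
    ultimately have "\<forall>\<^sub>F k in sequentially. ln \<beta> \<le> log_ratio (u @ wpow v k) v"
      by (intro r_less_slope[OF assms(1)]) auto
    then have "ln \<beta> \<le> L" by (intro tendsto_lowerbound[OF assms(2)]) auto
    then show False using that \<beta> by (metis exp_le_cancel_iff exp_ln not_le)
  qed
  \<comment> \<open>The end point itself is reached from the right by continuity.\<close>
  have "(\<lambda>n. exp L + 1 / real (Suc n)) \<longlonglongrightarrow> exp L + 0"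
    by (intro tendsto_add tendsto_const LIMSEQ_Suc lim_const_over_n)
  then have "(\<lambda>n. r (exp L + 1 / real (Suc n))) \<longlonglongrightarrow> r (exp L)"
    using continuous_on_tendsto_compose[OF r_continuous, of "\<lambda>n. exp L + 1 / real (Suc n)" "exp L"] by simp
  then have "slope v \<le> r (exp L)"
    by (intro LIMSEQ_le_const) (auto intro!: gt exI[of _ 0])
  then show "slope v \<le> r \<alpha>" using r_mono[of "exp L" \<alpha>] a by simp
qed

lemma plateau_right_end:
  assumes "(u, v) \<in> standard_pairs" "(\<lambda>k. log_ratio u (v @ wpow u k)) \<longlonglongrightarrow> R" "0 \<le> \<alpha>"
  shows "r \<alpha> \<le> slope u \<longleftrightarrow> \<alpha> \<le> exp R"
proof
  assume a: "r \<alpha> \<le> slope u"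
  show "\<alpha> \<le> exp R"
  proof (cases "\<alpha> = 0")
    case False
    have "\<exists>\<beta>\<ge>\<alpha>. r \<beta> = slope u"
    proof (cases "r \<alpha> = slope u")
      case False
      obtain \<beta> where \<beta>: "0 \<le> \<beta>" "r \<beta> = slope u"
        using r_IVT[OF slope_nonneg standard_pair_slope_bounds(2)[OF assms(1)]] by metis
      then have "\<alpha> \<le> \<beta>" using r_mono[of \<beta> \<alpha>] a False by (smt (verit))
      then show ?thesis using \<beta> by blast
    qed auto
    then obtain \<beta> where \<beta>: "\<alpha> \<le> \<beta>" "r \<beta> = slope u" by blast
    then have b0: "0 < \<beta>" using assms(3) False by simp
    have "ln \<beta> \<le> R"
      using assms(2) plateau_bounds(2)[OF standard_pair_iterate(2)[OF assms(1)] b0 \<beta>(2)]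
      by (intro LIMSEQ_le_const) auto
    then have "\<beta> \<le> exp R" using b0 by (metis exp_le_cancel_iff exp_ln)
    then show ?thesis using \<beta>(1) by simp
  qed simp
next
  assume a: "\<alpha> \<le> exp R"
  have lt: "r \<beta> \<le> slope u" if "\<beta> < exp R" "0 < \<beta>" for \<beta>
  proof (rule ccontr)
    assume "\<not> ?thesis"
    then have "\<forall>\<^sub>F k in sequentially. log_ratio u (v @ wpow u k) \<le> ln \<beta>"
      using that by (intro r_greater_slope[OF assms(1)]) auto
    then have "R \<le> ln \<beta>" by (intro tendsto_upperbound[OF assms(2)]) auto
    then show False using that by (metis exp_le_cancel_iff exp_ln not_le)
  qed
  \<comment> \<open>The points must be positive for \<open>lt\<close> to apply, hence the shift of
    the denominator by two.\<close>
  have "(\<lambda>n. exp R * (1 - 1 / real (Suc (Suc n)))) \<longlonglongrightarrow> exp R * (1 - 0)"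
    by (intro tendsto_mult tendsto_diff tendsto_const LIMSEQ_Suc lim_const_over_n)
  then have "(\<lambda>n. r (exp R * (1 - 1 / real (Suc (Suc n))))) \<longlonglongrightarrow> r (exp R)"
    using continuous_on_tendsto_compose[OF r_continuous, of "\<lambda>n. exp R * (1 - 1 / real (Suc (Suc n)))" "exp R"] by simp
  then have "r (exp R) \<le> slope u"
    by (intro LIMSEQ_le_const2) (auto intro!: lt exI[of _ 0] add_pos_nonneg simp: field_simps)
  then show "r \<alpha> \<le> slope u" using r_mono[of \<alpha> "exp R"] a assms(3) by simp
qed

end

context matrix_pair
begin

text \<open>A scalar matrix would share every eigenvector of the other matrix.\<close>

lemma nonscalar_A: "A0 \<noteq> c *\<^sub>R mat 1" "A1 \<noteq> c *\<^sub>R mat 1"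
proof -
  have sc: "(c *\<^sub>R mat 1) *v x = c *\<^sub>R x" for x :: "real^2" by (rule vec2_eqI) simp_all
  obtain x :: "real^2" where x: "x \<noteq> 0" "A1 *v x = perron A1 *\<^sub>R x"
    using perron_eigenvector[OF nonneg_A(2)] by metis
  show "A0 \<noteq> c *\<^sub>R mat 1" using no_common_eigenvector[of x c, OF _ x(2)] x(1) sc by auto
  obtain y :: "real^2" where y: "y \<noteq> 0" "A0 *v y = perron A0 *\<^sub>R y"
    using perron_eigenvector[OF nonneg_A(1)] by metis
  show "A1 \<noteq> c *\<^sub>R mat 1" using no_common_eigenvector[OF y(2), of c] y(1) sc by auto
qed

lemma diagonalizable_A: "diagonalizable A0 \<longleftrightarrow> 0 < disc2 A0" "diagonalizable A1 \<longleftrightarrow> 0 < disc2 A1"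
  using diagonalizable_imp_disc2[OF _ nonneg_A(1)] disc2_imp_diagonalizable[OF nonneg_A(1)]
        diagonalizable_imp_disc2[OF _ nonneg_A(2)] disc2_imp_diagonalizable[OF nonneg_A(2)] nonscalar_A
  by blast+

lemma W_letter: "W 1 [False] = A0" "W 1 [True] = A1"
  by (simp_all add: word_matrix_single letter_matrix_def)

lemma W_append_wpow: "W 1 (u @ wpow v k) = matrix_power (W 1 v) k ** W 1 u"
  by (simp add: word_matrix_append word_matrix_wpow)

lemma ln_\<rho>_power_limit:
  assumes "0 < disc2 (W 1 v)" "0 < trace (W 1 v)" "0 < num_ones (u @ v)" "num_ones (u @ v) < length (u @ v)"
  shows "(\<lambda>k. ln (perron (matrix_power (W 1 v) k ** W 1 u)) - real k * ln (\<rho> v)) \<longlonglongrightarrow> ln (trace (perron_proj (W 1 v) ** W 1 u))"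
    and "0 < trace (perron_proj (W 1 v) ** W 1 u)"
proof -
  have pos: "pos_mat (W 1 v ** W 1 u)"
    using pos_W[OF assms(3,4)] by (simp add: word_matrix_append)
  have pos': "0 < perron (matrix_power (W 1 v) k ** W 1 u)" for k
    using \<rho>_pos[of "u @ wpow v k"] by (simp add: W_append_wpow)
  show "(\<lambda>k. ln (perron (matrix_power (W 1 v) k ** W 1 u)) - real k * ln (\<rho> v)) \<longlonglongrightarrow> ln (trace (perron_proj (W 1 v) ** W 1 u))"
    using pos pos' assms by (intro ln_perron_power_mult_limit nonneg_W) simp_all
  show "0 < trace (perron_proj (W 1 v) ** W 1 u)"
    using pos assms by (intro trace_perron_proj_mult_pos nonneg_W) simp_all
qed

end

context sturmian_pair
begin

text \<open>The slope of \<open>uv\<close> is the left slope of the pair \<open>(uv, v)\<close> and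
  the right slope of \<open>(u, vu)\<close>, so the two end lemmas for these pairs enclose one and
  the same plateau.\<close>

lemma plateau_interior:
  assumes uv: "(u, v) \<in> standard_pairs"
  defines "B1 \<equiv> W 1 u" and "B2 \<equiv> W 1 v" and "q \<equiv> length (u @ v)"
  defines "A \<equiv> B1 ** B2"
  defines "P \<equiv> perron_proj A"
  shows "is_perron_limit A P"
    and "preimage r {slope (u @ v)} =
      {spectral_radius (B1 ** P) ^ q / spectral_radius A ^ length u .. spectral_radius A ^ length v / spectral_radius (P ** B2) ^ q}"
    and "spectral_radius (B1 ** P) ^ q / spectral_radius A ^ length u < spectral_radius A ^ length v / spectral_radius (P ** B2) ^ q"
    and "\<And>\<alpha>. \<alpha> \<in> preimage r {slope (u @ v)} \<Longrightarrow> jsr A0 A1 \<alpha> = root q (spectral_radius (W \<alpha> (u @ v)))"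
proof -
  define l t1 t2 where "l = perron A" and "t1 = trace (P ** B1)" and "t2 = trace (P ** B2)"
  note b = standard_pair_bounds[OF uv] num_ones_le_length[of u] num_ones_le_length[of v]
  have ne: "u \<noteq> []" "v \<noteq> []" using standard_pair_nonempty[OF uv] .
  \<comment> \<open>Later letters act on the left, so \<open>B1 ** B2\<close> belongs to
    \<open>vu\<close> and not to \<open>uv\<close>.\<close>
  have A: "A = W 1 (v @ u)" by (simp add: A_def B1_def B2_def word_matrix_append)
  have posA: "pos_mat A" unfolding A using b by (intro pos_W) auto
  have nnA: "nonneg_mat A" and nnB: "nonneg_mat B1" "nonneg_mat B2"
    unfolding A B1_def B2_def by (simp_all add: nonneg_W)
  have dA: "0 < disc2 A" "0 < trace A" using disc2_pos_mat[OF posA] trace_pos_mat[OF posA] .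
  have l0: "0 < l" unfolding l_def A by (rule \<rho>_pos)
  show "is_perron_limit A P" unfolding P_def by (rule is_perron_limit_proj[OF nnA dA(2,1)])
  have P: "nonneg_mat P" unfolding P_def by (rule perron_proj_nonneg[OF nnA dA(1)])
  have srA: "spectral_radius A = l" unfolding l_def by (rule spectral_radius_perron[OF nnA])
  have sr1: "spectral_radius (B1 ** P) = t1"
    using spectral_radius_perron[OF nonneg_mat_mult[OF nnB(1) P]] perron_proj_mult(2)[OF nnA dA(1) nnB(1)]
    by (simp add: t1_def P_def)
  have sr2: "spectral_radius (P ** B2) = t2"
    using spectral_radius_perron[OF nonneg_mat_mult[OF P nnB(2)]] perron_proj_mult(1)[OF nnA dA(1) nnB(2)]
    by (simp add: t2_def P_def)
  have lim1: "(\<lambda>k. ln (perron (matrix_power A k ** B1)) - real k * ln l) \<longlonglongrightarrow> ln t1" and t1: "0 < t1"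
    using ln_\<rho>_power_limit[of "v @ u" u] dA b unfolding A[symmetric] B1_def[symmetric] l_def t1_def P_def by auto
  have lim2: "(\<lambda>k. ln (perron (matrix_power A k ** B2)) - real k * ln l) \<longlonglongrightarrow> ln t2" and t2: "0 < t2"
    using ln_\<rho>_power_limit[of "v @ u" v] dA b unfolding A[symmetric] B2_def[symmetric] l_def t2_def P_def by auto
  have \<rho>vu: "\<rho> (v @ u) = l" by (simp add: l_def A)
  have \<rho>uv: "\<rho> (u @ v) = l"
    unfolding l_def A_def B1_def B2_def word_matrix_append by (rule perron_mult_commute)
  have "(\<lambda>k. real q * (ln (perron (matrix_power A k ** B1)) - real k * ln l) - real (length u) * ln l)
      \<longlonglongrightarrow> real q * ln t1 - real (length u) * ln l"
    by (intro tendsto_diff tendsto_mult tendsto_const lim1)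
  moreover have "log_ratio (u @ wpow (v @ u) k) (v @ u) =
      real q * (ln (perron (matrix_power A k ** B1)) - real k * ln l) - real (length u) * ln l" for k
    unfolding log_ratio_def W_append_wpow \<rho>vu A[symmetric] B1_def[symmetric] by (simp add: q_def l_def algebra_simps)
  ultimately have L: "(\<lambda>k. log_ratio (u @ wpow (v @ u) k) (v @ u)) \<longlonglongrightarrow> real q * ln t1 - real (length u) * ln l" by simp
  \<comment> \<open>The word \<open>uv\<close> has the matrix \<open>B2 ** B1\<close>; moving a
    factor around the cycle expresses its powers by those of \<open>A\<close>.\<close>
  have shift: "perron (matrix_power (W 1 (u @ v)) k ** W 1 v) = perron (matrix_power A k ** B2)" for k
  proof -
    have "matrix_power (W 1 (u @ v)) k ** W 1 v = B2 ** matrix_power A k"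
      using matrix_power_shift[of B2 B1 k] by (simp add: word_matrix_append A_def B1_def B2_def)
    then show ?thesis by (simp add: perron_mult_commute)
  qed
  have "(\<lambda>k. real (length v) * ln l - real q * (ln (perron (matrix_power A k ** B2)) - real k * ln l))
      \<longlonglongrightarrow> real (length v) * ln l - real q * ln t2"
    by (intro tendsto_diff tendsto_mult tendsto_const lim2)
  moreover have "log_ratio (u @ v) (v @ wpow (u @ v) k) =
      real (length v) * ln l - real q * (ln (perron (matrix_power A k ** B2)) - real k * ln l)" for k
    unfolding log_ratio_def W_append_wpow \<rho>uv shift by (simp add: q_def algebra_simps)
  ultimately have R: "(\<lambda>k. log_ratio (u @ v) (v @ wpow (u @ v) k)) \<longlonglongrightarrow> real (length v) * ln l - real q * ln t2" by simp
  have expL: "exp (real q * ln t1 - real (length u) * ln l) = t1 ^ q / l ^ length u"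
    using t1 l0 by (simp add: exp_diff exp_of_nat_mult)
  have expR: "exp (real (length v) * ln l - real q * ln t2) = l ^ length v / t2 ^ q"
    using t2 l0 by (simp add: exp_diff exp_of_nat_mult)
  have left: "slope (u @ v) \<le> r \<alpha> \<longleftrightarrow> t1 ^ q / l ^ length u \<le> \<alpha>" if "0 \<le> \<alpha>" for \<alpha>
    using plateau_left_end[OF standard_pairs.right[OF uv] L that] by (simp add: expL slope_append_commute[of v u])
  have right: "r \<alpha> \<le> slope (u @ v) \<longleftrightarrow> \<alpha> \<le> l ^ length v / t2 ^ q" if "0 \<le> \<alpha>" for \<alpha>
    using plateau_right_end[OF standard_pairs.left[OF uv] R that] by (simp add: expR)
  have nnl: "0 \<le> t1 ^ q / l ^ length u" using t1 l0 by simp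
  have pre: "preimage r {slope (u @ v)} = {t1 ^ q / l ^ length u .. l ^ length v / t2 ^ q}" (is "_ = ?I")
  proof (intro set_eqI iffI)
    fix \<alpha> assume "\<alpha> \<in> preimage r {slope (u @ v)}"
    then have "r \<alpha> = slope (u @ v)" "0 \<le> \<alpha>" by auto
    then show "\<alpha> \<in> ?I" using left[of \<alpha>] right[of \<alpha>] by auto
  next
    fix \<alpha> assume a: "\<alpha> \<in> ?I"
    then have "0 \<le> \<alpha>" using nnl by auto
    then show "\<alpha> \<in> preimage r {slope (u @ v)}" using left[of \<alpha>] right[of \<alpha>] a by auto
  qed
  then show "preimage r {slope (u @ v)} =
      {spectral_radius (B1 ** P) ^ q / spectral_radius A ^ length u .. spectral_radius A ^ length v / spectral_radius (P ** B2) ^ q}"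
    by (simp add: srA sr1 sr2)
  have sl: "slope (u @ v) < 1" "0 < slope (u @ v)"
    using standard_pair_slope_bounds(2)[OF standard_pairs.left[OF uv]]
      standard_pair_slope_bounds(3)[OF standard_pairs.right[OF uv]] by (simp_all add: slope_append_commute[of v u])
  obtain \<alpha> where "0 \<le> \<alpha>" "r \<alpha> = slope (u @ v)" using r_IVT[OF slope_nonneg sl(1)] by metis
  then have "\<alpha> \<in> ?I" using pre by auto
  then have le: "t1 ^ q / l ^ length u \<le> l ^ length v / t2 ^ q" by simp
  have "t1 ^ q / l ^ length u \<noteq> l ^ length v / t2 ^ q"
  proof
    assume "t1 ^ q / l ^ length u = l ^ length v / t2 ^ q"
    \<comment> \<open>Here \<open>q = |u| + |v|\<close> combines the two powers of
      \<open>l\<close>.\<close>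
    then have "(t1 * t2) ^ q = l ^ q"
      using t2 l0 by (simp add: field_simps q_def power_add power_mult_distrib)
    moreover have "0 < q" using ne by (simp add: q_def)
    ultimately have "t1 * t2 = l" using t1 t2 l0 by (simp add: power_eq_iff_eq_base)
    then obtain x s t where "x \<noteq> 0" "B1 *v x = s *\<^sub>R x" "B2 *v x = t *\<^sub>R x"
      using trace_product_common_eigenvector[of B1 B2] nnA dA det_W[of u] det_W[of v]
      unfolding t1_def t2_def l_def P_def A_def B1_def B2_def by blast
    then show False using standard_pair_no_common_eigenvector[OF uv] unfolding B1_def B2_def by blast
  qed
  with le show "spectral_radius (B1 ** P) ^ q / spectral_radius A ^ length u < spectral_radius A ^ length v / spectral_radius (P ** B2) ^ q"
    by (simp add: srA sr1 sr2)
  fix \<alpha> assume a: "\<alpha> \<in> preimage r {slope (u @ v)}"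
  then have r: "r \<alpha> = slope (u @ v)" "0 \<le> \<alpha>" by auto
  then have a0: "0 < \<alpha>" using r_zero sl by (cases "\<alpha> = 0") auto
  show "jsr A0 A1 \<alpha> = root q (spectral_radius (W \<alpha> (u @ v)))"
    unfolding q_def spectral_radius_perron[OF nonneg_W[OF r(2)]]
    by (rule jsr_at_word(2)[OF a0 _ standard_pair_per_product(1)[OF uv] r(1)]) (use ne in simp)
qed

text \<open>This is the right end for the pair of letters; the left end is 0 because
  \<open>r\<close> is non-negative.\<close>

lemma plateau_zero_diagonalizable:
  assumes "diagonalizable A0"
  defines "P \<equiv> perron_proj A0"
  shows "is_perron_limit A0 P"
    and "preimage r {0} = {0 .. spectral_radius A0 / spectral_radius (P ** A1)}"
    and "0 < spectral_radius A0 / spectral_radius (P ** A1)"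
proof -
  have d: "0 < disc2 A0" using assms diagonalizable_A by simp
  show "is_perron_limit A0 P" unfolding P_def by (rule is_perron_limit_proj[OF nonneg_A(1) trace_A(1) d])
  have P: "nonneg_mat P" unfolding P_def by (rule perron_proj_nonneg[OF nonneg_A(1) d])
  define t where "t = trace (P ** A1)"
  have sr: "spectral_radius (P ** A1) = t"
    using spectral_radius_perron[OF nonneg_mat_mult[OF P nonneg_A(2)]] perron_proj_mult(1)[OF nonneg_A(1) d nonneg_A(2)]
    by (simp add: t_def P_def)
  have sr0: "spectral_radius A0 = perron A0" by (rule spectral_radius_perron[OF nonneg_A(1)])
  have l0: "0 < perron A0" using \<rho>_pos[of "[False]"] by (simp add: W_letter)
  have lim: "(\<lambda>k. ln (perron (matrix_power A0 k ** A1)) - real k * ln (perron A0)) \<longlonglongrightarrow> ln t" and t: "0 < t"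
    using ln_\<rho>_power_limit[of "[False]" "[True]"] d trace_A(1) by (simp_all add: W_letter t_def P_def)
  have "(\<lambda>k. ln (perron A0) - (ln (perron (matrix_power A0 k ** A1)) - real k * ln (perron A0))) \<longlonglongrightarrow> ln (perron A0) - ln t"
    by (intro tendsto_diff tendsto_const lim)
  moreover have "log_ratio [False] ([True] @ wpow [False] k) = ln (perron A0) - (ln (perron (matrix_power A0 k ** A1)) - real k * ln (perron A0))" for k
    unfolding log_ratio_def W_append_wpow W_letter by (simp add: algebra_simps)
  ultimately have R: "(\<lambda>k. log_ratio [False] ([True] @ wpow [False] k)) \<longlonglongrightarrow> ln (perron A0) - ln t" by simp
  have "r \<alpha> \<le> 0 \<longleftrightarrow> \<alpha> \<le> perron A0 / t" if "0 \<le> \<alpha>" for \<alpha>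
    using plateau_right_end[OF standard_pairs.base R that] l0 t by (simp add: exp_diff slope_def)
  then have "r \<alpha> = 0 \<longleftrightarrow> \<alpha> \<le> perron A0 / t" if "0 \<le> \<alpha>" for \<alpha>
    using r_range(1)[OF that] that by (metis order_antisym order_refl)
  then show "preimage r {0} = {0 .. spectral_radius A0 / spectral_radius (P ** A1)}"
    unfolding sr sr0 by auto
  show "0 < spectral_radius A0 / spectral_radius (P ** A1)" unfolding sr sr0 using l0 t by simp
qed

lemma plateau_one_diagonalizable:
  assumes "diagonalizable A1"
  defines "P \<equiv> perron_proj A1"
  shows "is_perron_limit A1 P"
    and "preimage r {1} = {spectral_radius (P ** A0) / spectral_radius A1 ..}"
proof -
  have d: "0 < disc2 A1" using assms diagonalizable_A by simp
  show "is_perron_limit A1 P" unfolding P_def by (rule is_perron_limit_proj[OF nonneg_A(2) trace_A(2) d])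
  have P: "nonneg_mat P" unfolding P_def by (rule perron_proj_nonneg[OF nonneg_A(2) d])
  define t where "t = trace (P ** A0)"
  have sr: "spectral_radius (P ** A0) = t"
    using spectral_radius_perron[OF nonneg_mat_mult[OF P nonneg_A(1)]] perron_proj_mult(1)[OF nonneg_A(2) d nonneg_A(1)]
    by (simp add: t_def P_def)
  have sr1: "spectral_radius A1 = perron A1" by (rule spectral_radius_perron[OF nonneg_A(2)])
  have l1: "0 < perron A1" using \<rho>_pos[of "[True]"] by (simp add: W_letter)
  have lim: "(\<lambda>k. ln (perron (matrix_power A1 k ** A0)) - real k * ln (perron A1)) \<longlonglongrightarrow> ln t" and t: "0 < t"
    using ln_\<rho>_power_limit[of "[True]" "[False]"] d trace_A(2) by (simp_all add: W_letter t_def P_def)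
  have "(\<lambda>k. (ln (perron (matrix_power A1 k ** A0)) - real k * ln (perron A1)) - ln (perron A1)) \<longlonglongrightarrow> ln t - ln (perron A1)"
    by (intro tendsto_diff tendsto_const lim)
  moreover have "log_ratio ([False] @ wpow [True] k) [True] = (ln (perron (matrix_power A1 k ** A0)) - real k * ln (perron A1)) - ln (perron A1)" for k
    unfolding log_ratio_def W_append_wpow W_letter by (simp add: algebra_simps)
  ultimately have L: "(\<lambda>k. log_ratio ([False] @ wpow [True] k) [True]) \<longlonglongrightarrow> ln t - ln (perron A1)" by simp
  have "1 \<le> r \<alpha> \<longleftrightarrow> t / perron A1 \<le> \<alpha>" if "0 \<le> \<alpha>" for \<alpha>
    using plateau_left_end[OF standard_pairs.base L that] l1 t by (simp add: exp_diff slope_def)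
  then have "r \<alpha> = 1 \<longleftrightarrow> t / perron A1 \<le> \<alpha>" if "0 \<le> \<alpha>" for \<alpha>
    using r_range(2)[OF that] that by (metis order_antisym order_refl)
  moreover have "0 < t / perron A1" using t l1 by simp
  ultimately show "preimage r {1} = {spectral_radius (P ** A0) / spectral_radius A1 ..}"
    unfolding sr sr1 by (auto intro: order_trans[OF less_imp_le])
qed

text \<open>A positive \<open>\<alpha>\<close> on the plateau of the letter 0 bounds rho(A0^k A1) by
  a constant times rho(A0)^k, which a Jordan block would violate.\<close>

lemma plateau_zero_imp_diagonalizable:
  assumes "0 < \<alpha>" "r \<alpha> = 0"
  shows "diagonalizable A0"
proof -
  have l0: "0 < perron A0" using \<rho>_pos[of "[False]"] by (simp add: W_letter)
  have bnd: "perron (matrix_power A0 k ** A1) \<le> perron A0 / \<alpha> * perron A0 ^ k" for k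
  proof -
    have pos: "0 < perron (matrix_power A0 k ** A1)"
      using \<rho>_pos[of "[True] @ wpow [False] k"] unfolding W_append_wpow W_letter .
    have "ln \<alpha> \<le> log_ratio [False] ([True] @ wpow [False] k)"
      using assms by (intro plateau_bounds(2) standard_pair_iterate standard_pairs.base) (simp_all add: slope_def)
    also have "\<dots> = ln (perron A0 ^ Suc k) - ln (perron (matrix_power A0 k ** A1))"
      unfolding log_ratio_def W_append_wpow W_letter ln_realpow by (simp add: algebra_simps)
    finally have "ln (\<alpha> * perron (matrix_power A0 k ** A1)) \<le> ln (perron A0 ^ Suc k)"
      using assms pos by (simp add: ln_mult)
    then have "\<alpha> * perron (matrix_power A0 k ** A1) \<le> perron A0 ^ Suc k"
      using assms pos l0 by (subst (asm) ln_le_cancel_iff) auto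
    then show ?thesis using assms(1) by (simp add: field_simps)
  qed
  show ?thesis
    unfolding diagonalizable_A(1)
    by (rule disc2_pos_if_power_product_bounded[OF nonneg_A(1) trace_A(1) nonscalar_A(1) nonneg_A(2) _ bnd])
       (rule no_common_eigenvector)
qed

lemma plateau_one_imp_diagonalizable:
  assumes "0 < \<alpha>" "r \<alpha> = 1"
  shows "diagonalizable A1"
proof -
  have l1: "0 < perron A1" using \<rho>_pos[of "[True]"] by (simp add: W_letter)
  have bnd: "perron (matrix_power A1 k ** A0) \<le> (perron A1 * \<alpha>) * perron A1 ^ k" for k
  proof -
    have pos: "0 < perron (matrix_power A1 k ** A0)"
      using \<rho>_pos[of "[False] @ wpow [True] k"] unfolding W_append_wpow W_letter .
    have "log_ratio ([False] @ wpow [True] k) [True] \<le> ln \<alpha>"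
      using assms by (intro plateau_bounds(1) standard_pair_iterate standard_pairs.base) (simp_all add: slope_def)
    moreover have "log_ratio ([False] @ wpow [True] k) [True] = ln (perron (matrix_power A1 k ** A0)) - ln (perron A1 ^ Suc k)"
      unfolding log_ratio_def W_append_wpow W_letter ln_realpow by (simp add: algebra_simps)
    ultimately have "ln (perron (matrix_power A1 k ** A0)) \<le> ln (\<alpha> * perron A1 ^ Suc k)"
      using assms(1) l1 by (simp add: ln_mult)
    then have "perron (matrix_power A1 k ** A0) \<le> \<alpha> * perron A1 ^ Suc k"
      using assms(1) pos l1 by (subst (asm) ln_le_cancel_iff) auto
    then show ?thesis by (simp add: ac_simps)
  qed
  show ?thesis
    unfolding diagonalizable_A(2)
    by (rule disc2_pos_if_power_product_bounded[OF nonneg_A(2) trace_A(2) nonscalar_A(2) nonneg_A(1) _ bnd])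
       (rule no_common_eigenvector)
qed

end

section \<open>Null covers and projective contraction\<close>

text \<open>A criterion for vanishing Hausdorff measure in terms of explicit covers, so that finite
  covers and countable unions can be handled directly.\<close>

definition null_cover :: "real \<Rightarrow> 'a::metric_space set \<Rightarrow> bool" where
  "null_cover s E \<longleftrightarrow> (\<forall>\<epsilon>>0. \<forall>\<delta>>0. \<exists>U :: nat \<Rightarrow> 'a set. E \<subseteq> (\<Union>i. U i) \<and>
     (\<forall>i. bounded (U i) \<and> diameter (U i) \<le> \<delta>) \<and> (\<Sum>i. ennreal (diameter_powr s (U i))) \<le> ennreal \<epsilon>)"

lemma hausdorff_measure_null_cover:
  assumes "null_cover s E"
  shows "hausdorff_measure s E = 0"
proof -
  have "hausdorff_premeasure s \<delta> E \<le> 0" if \<delta>: "0 < \<delta>" for \<delta>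
  proof (rule ennreal_le_epsilon)
    fix e :: real assume "0 < e"
    then obtain U :: "nat \<Rightarrow> 'a set" where U: "E \<subseteq> (\<Union>i. U i)" "\<forall>i. bounded (U i) \<and> diameter (U i) \<le> \<delta>"
      "(\<Sum>i. ennreal (diameter_powr s (U i))) \<le> ennreal e"
      using assms[unfolded null_cover_def, rule_format, OF \<open>0 < e\<close> \<delta>] by blast
    have "hausdorff_premeasure s \<delta> E \<le> (\<Sum>i. ennreal (diameter_powr s (U i)))"
      unfolding hausdorff_premeasure_def by (rule INF_lower) (use U in simp)
    then show "hausdorff_premeasure s \<delta> E \<le> 0 + ennreal e" using U(3) by simp
  qed
  then have "hausdorff_measure s E \<le> 0" unfolding hausdorff_measure_def by (intro SUP_least) auto
  then show ?thesis by simp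
qed

text \<open>Small exponents suffice since the dimension is an infimum; \<open>s < 1\<close> serves
  to bound \<open>real m powr s\<close> by \<open>real m\<close> later.\<close>

lemma hausdorff_dimension_zeroI:
  assumes "\<And>s. 0 < s \<Longrightarrow> s < 1 \<Longrightarrow> null_cover s E"
  shows "hausdorff_dimension E = 0"
proof -
  have "hausdorff_dimension E \<le> 0"
  proof (rule ennreal_le_epsilon)
    fix e :: real assume e: "0 < e"
    define s where "s = min e (1/2)"
    have s: "0 < s" "s < 1" "s \<le> e" using e by (auto simp: s_def)
    have "hausdorff_dimension E \<le> ennreal s"
      unfolding hausdorff_dimension_def
      by (rule INF_lower) (use s hausdorff_measure_null_cover[OF assms[of s]] in simp)
    also have "\<dots> \<le> 0 + ennreal e" using s by (simp add: ennreal_leI)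
    finally show "hausdorff_dimension E \<le> 0 + ennreal e" .
  qed
  then show ?thesis by simp
qed

lemma null_cover_finite:
  fixes E :: "'a::metric_space set"
  assumes "\<And>\<epsilon> \<delta>. 0 < \<epsilon> \<Longrightarrow> 0 < \<delta> \<Longrightarrow> \<exists>(I :: 'b set) U. finite I \<and> E \<subseteq> (\<Union>i\<in>I. U i) \<and>
     (\<forall>i\<in>I. bounded (U i) \<and> diameter (U i) \<le> \<delta>) \<and> (\<Sum>i\<in>I. diameter_powr s (U i)) \<le> \<epsilon>"
  shows "null_cover s E"
  unfolding null_cover_def
proof (intro allI impI)
  fix \<epsilon> \<delta> :: real assume e: "0 < \<epsilon>" "0 < \<delta>"
  then obtain I :: "'b set" and U where IU: "finite I" "E \<subseteq> (\<Union>i\<in>I. U i)"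
     "\<forall>i\<in>I. bounded (U i) \<and> diameter (U i) \<le> \<delta>" "(\<Sum>i\<in>I. diameter_powr s (U i)) \<le> \<epsilon>"
    using assms[OF e] by blast
  obtain h where h: "bij_betw h {0..<card I} I" using ex_bij_betw_nat_finite[OF IU(1)] by blast
  \<comment> \<open>Padding with empty sets costs nothing, as \<open>diameter_powr\<close> is 0 on
    them for every exponent.\<close>
  define V where "V i = (if i < card I then U (h i) else {})" for i
  have hI: "h i \<in> I" if "i < card I" for i using h that by (auto simp: bij_betw_def)
  have nn: "0 \<le> diameter_powr s X" for X :: "'a set" by (simp add: diameter_powr_def)
  have "E \<subseteq> (\<Union>i. V i)"
  proof
    fix x assume "x \<in> E"
    then obtain i where "i \<in> I" "x \<in> U i" using IU(2) by blast
    moreover obtain j where "j < card I" "h j = i" using bij_betw_imp_surj_on[OF h] \<open>i \<in> I\<close> by (metis atLeastLessThan_iff imageE)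
    ultimately show "x \<in> (\<Union>i. V i)" by (auto simp: V_def intro!: exI[of _ j])
  qed
  moreover have "bounded (V i) \<and> diameter (V i) \<le> \<delta>" for i
    using IU(3) hI \<open>0 < \<delta>\<close> by (auto simp: V_def)
  moreover have "(\<Sum>i. ennreal (diameter_powr s (V i))) \<le> ennreal \<epsilon>"
  proof -
    have "(\<Sum>i. ennreal (diameter_powr s (V i))) = (\<Sum>i\<in>{0..<card I}. ennreal (diameter_powr s (V i)))"
      by (rule suminf_finite) (auto simp: V_def diameter_powr_def)
    also have "\<dots> = (\<Sum>i\<in>{0..<card I}. ennreal (diameter_powr s (U (h i))))"
      by (rule sum.cong) (auto simp: V_def)
    also have "\<dots> = (\<Sum>i\<in>I. ennreal (diameter_powr s (U i)))"
      by (rule sum.reindex_bij_betw[OF h])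
    also have "\<dots> = ennreal (\<Sum>i\<in>I. diameter_powr s (U i))" by (rule sum_ennreal) (rule nn)
    also have "\<dots> \<le> ennreal \<epsilon>" by (rule ennreal_leI[OF IU(4)])
    finally show ?thesis .
  qed
  ultimately show "\<exists>U. E \<subseteq> (\<Union>i. U i) \<and> (\<forall>i::nat. bounded (U i) \<and> diameter (U i) \<le> \<delta>) \<and>
     (\<Sum>i. ennreal (diameter_powr s (U i))) \<le> ennreal \<epsilon>"
    by (intro exI[of _ V]) simp
qed

lemma null_cover_UN:
  assumes "\<And>n :: nat. null_cover s (E n)"
  shows "null_cover s (\<Union>n. E n)"
  unfolding null_cover_def
proof (intro allI impI)
  fix \<epsilon> \<delta> :: real assume e: "0 < \<epsilon>" "0 < \<delta>"
  define \<eta> where "\<eta> n = \<epsilon> * (1/2) ^ Suc n" for n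
  have \<eta>: "0 < \<eta> n" for n using e by (simp add: \<eta>_def)
  have "\<exists>U :: nat \<Rightarrow> 'a set. E n \<subseteq> (\<Union>i. U i) \<and> (\<forall>i. bounded (U i) \<and> diameter (U i) \<le> \<delta>) \<and>
     (\<Sum>i. ennreal (diameter_powr s (U i))) \<le> ennreal (\<eta> n)" for n
    by (rule assms[unfolded null_cover_def, rule_format, OF \<eta> e(2)])
  then obtain U :: "nat \<Rightarrow> nat \<Rightarrow> 'a set" where U: "\<And>n. E n \<subseteq> (\<Union>i. U n i)"
     "\<And>n i. bounded (U n i)" "\<And>n i. diameter (U n i) \<le> \<delta>"
     "\<And>n. (\<Sum>i. ennreal (diameter_powr s (U n i))) \<le> ennreal (\<eta> n)" by metis
  define V where "V i = (case prod_decode i of (n, j) \<Rightarrow> U n j)" for i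
  have "(\<Union>n. E n) \<subseteq> (\<Union>i. V i)"
  proof
    fix x assume "x \<in> (\<Union>n. E n)"
    then obtain n j where "x \<in> U n j" using U(1) by blast
    then have "x \<in> V (prod_encode (n, j))" by (simp add: V_def)
    then show "x \<in> (\<Union>i. V i)" by blast
  qed
  moreover have "bounded (V i) \<and> diameter (V i) \<le> \<delta>" for i
    using U(2,3) by (simp add: V_def split: prod.split)
  moreover have "(\<Sum>i. ennreal (diameter_powr s (V i))) \<le> ennreal \<epsilon>"
  proof -
    have "(\<Sum>i. ennreal (diameter_powr s (V i))) =
       (\<Sum>i. (\<lambda>(n, j). ennreal (diameter_powr s (U n j))) (prod_decode i))"
      by (simp add: V_def case_prod_beta)
    also have "\<dots> = (\<Sum>n. \<Sum>j. ennreal (diameter_powr s (U n j)))"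
      by (rule suminf_ennreal_2dimen) simp
    also have "\<dots> \<le> (\<Sum>n. ennreal (\<eta> n))" by (intro suminf_le U(4)) auto
    also have "\<dots> = ennreal \<epsilon>"
    proof -
      have "\<eta> sums (\<epsilon> * 1)" unfolding \<eta>_def by (intro sums_mult power_half_series)
      then show ?thesis using \<eta> by (intro suminf_ennreal_eq) (auto simp: less_imp_le)
    qed
    finally show ?thesis .
  qed
  ultimately show "\<exists>U. (\<Union>n. E n) \<subseteq> (\<Union>i. U i) \<and> (\<forall>i::nat. bounded (U i) \<and> diameter (U i) \<le> \<delta>) \<and>
     (\<Sum>i. ennreal (diameter_powr s (U i))) \<le> ennreal \<epsilon>"
    by (intro exI[of _ V]) simp
qed

section \<open>Projective contraction by positive matrices\<close>

definition perm2 :: "real^2^2 \<Rightarrow> real" where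
  "perm2 M = M$1$1 * M$2$2 + M$1$2 * M$2$1"

text \<open>On non-negative matrices the determinant is multiplicative and the permanent is supermultiplicative, so
  this ratio is submultiplicative. It controls the projective diameter of the image of the positive quadrant.\<close>

definition contr :: "real^2^2 \<Rightarrow> real" where
  "contr M = \<bar>det M\<bar> / perm2 M"

lemma abs_det_le_perm2: "nonneg_mat M \<Longrightarrow> \<bar>det M\<bar> \<le> perm2 M"
  using mult_nonneg_nonneg[of "M$1$1" "M$2$2"] mult_nonneg_nonneg[of "M$1$2" "M$2$1"]
  unfolding det_2 perm2_def nonneg_mat_2 abs_le_iff by simp

lemma perm2_mult_ge:
  assumes "nonneg_mat M" "nonneg_mat N"
  shows "perm2 M * perm2 N \<le> perm2 (M ** N)"
proof -
  have "perm2 (M ** N) = perm2 M * perm2 N + 2 * (M$1$1 * M$2$1 * N$1$1 * N$1$2) + 2 * (M$1$2 * M$2$2 * N$2$1 * N$2$2)"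
    by (simp add: perm2_def algebra_simps)
  then show ?thesis using assms by (simp add: nonneg_mat_2)
qed

lemma contr_nonneg: "nonneg_mat M \<Longrightarrow> 0 \<le> contr M"
  using abs_det_le_perm2[of M] by (simp add: contr_def)

lemma contr_le_1: "nonneg_mat M \<Longrightarrow> contr M \<le> 1"
  using abs_det_le_perm2[of M] by (cases "perm2 M = 0") (auto simp: contr_def divide_le_eq_1)

lemma contr_mult:
  assumes "nonneg_mat M" "nonneg_mat N" "det M \<noteq> 0" "det N \<noteq> 0"
  shows "contr (M ** N) \<le> contr M * contr N"
proof -
  have "0 < perm2 M" "0 < perm2 N"
    using abs_det_le_perm2[OF assms(1)] abs_det_le_perm2[OF assms(2)] assms(3,4) by auto
  then have "\<bar>det M * det N\<bar> / perm2 (M ** N) \<le> \<bar>det M * det N\<bar> / (perm2 M * perm2 N)"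
    using perm2_mult_ge[OF assms(1,2)] by (intro divide_left_mono) (auto intro: mult_pos_pos less_le_trans)
  then show ?thesis by (simp add: contr_def det_mul abs_mult)
qed

lemma contr_less_1:
  assumes "pos_mat M"
  shows "contr M < 1"
proof -
  have "0 < M$1$1 * M$2$2" "0 < M$1$2 * M$2$1" using assms by (auto simp: pos_mat_2)
  then show ?thesis by (simp add: contr_def perm2_def det_2 abs_less_iff)
qed

text \<open>Expand both products: the terms in \<open>x$1 * y$1\<close> and \<open>x$2 * y$2\<close>
  agree, while the mixed terms carry the weights \<open>a\<close> and \<open>b\<close> exchanged, so
  the comparison costs at most the larger of \<open>a / b\<close> and \<open>b / a\<close>.\<close>

lemma contr_cone:
  fixes x y :: "real^2"
  assumes M: "pos_mat M" and x: "\<And>i. 0 \<le> x$i" and y: "\<And>i. 0 \<le> y$i"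
  defines "\<kappa> \<equiv> (1 + contr M) / (1 - contr M)"
  shows "(M *v x)$1 * (M *v y)$2 \<le> \<kappa> * ((M *v x)$2 * (M *v y)$1)"
    and "(M *v x)$2 * (M *v y)$1 \<le> \<kappa> * ((M *v x)$1 * (M *v y)$2)"
    and "1 \<le> \<kappa>"
proof -
  define a b where "a = M$1$1 * M$2$2" and "b = M$1$2 * M$2$1"
  have ab: "0 < a" "0 < b" using M by (auto simp: a_def b_def pos_mat_2)
  define s d where "s = a + b" and "d = \<bar>a - b\<bar>"
  have "contr M = d / s" by (simp add: contr_def perm2_def det_2 a_def b_def s_def d_def)
  then have "\<kappa> = ((s + d) / s) / ((s - d) / s)"
    unfolding \<kappa>_def using ab by (simp add: add_divide_distrib diff_divide_distrib s_def)
  also have "\<dots> = (s + d) / (s - d)" using ab by (simp add: s_def)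
  \<comment> \<open>The logarithm of this cross-ratio is Birkhoff's projective diameter of the image
    of the quadrant.\<close>
  finally have k: "\<kappa> = (if b \<le> a then a / b else b / a)" by (auto simp: s_def d_def)
  have k2: "1 \<le> \<kappa>" unfolding k using ab by simp
  have k1: "a \<le> \<kappa> * b" "b \<le> \<kappa> * a"
  proof -
    show "a \<le> \<kappa> * b"
    proof (cases "b \<le> a")
      case False
      then show ?thesis using mult_right_mono[OF k2, of b] ab by linarith
    qed (use k ab in simp)
    show "b \<le> \<kappa> * a"
    proof (cases "b \<le> a")
      case True
      then show ?thesis using mult_right_mono[OF k2, of a] ab by linarith
    qed (use k ab in simp)
  qed
  show "1 \<le> \<kappa>" by (rule k2)
  have le: "p \<le> \<kappa> * p" if "0 \<le> p" for p using mult_right_mono[OF k2 that] by simp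
  have Mnn: "0 \<le> M$i$j" for i j using M by (simp add: pos_mat_def less_imp_le)
  have t1: "M$1$1 * M$2$1 * (x$1 * y$1) \<le> \<kappa> * (M$1$1 * M$2$1 * (x$1 * y$1))" using Mnn x y by (intro le) simp
  have t2: "M$1$2 * M$2$2 * (x$2 * y$2) \<le> \<kappa> * (M$1$2 * M$2$2 * (x$2 * y$2))" using Mnn x y by (intro le) simp
  have t3: "a * (x$1 * y$2) \<le> \<kappa> * b * (x$1 * y$2)" "a * (x$2 * y$1) \<le> \<kappa> * b * (x$2 * y$1)"
    using k1(1) x y by (auto intro: mult_right_mono)
  have t4: "b * (x$1 * y$2) \<le> \<kappa> * a * (x$1 * y$2)" "b * (x$2 * y$1) \<le> \<kappa> * a * (x$2 * y$1)"
    using k1(2) x y by (auto intro: mult_right_mono)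
  have e1: "(M *v x)$1 * (M *v y)$2 = M$1$1 * M$2$1 * (x$1 * y$1) + M$1$2 * M$2$2 * (x$2 * y$2) + a * (x$1 * y$2) + b * (x$2 * y$1)"
    and e2: "(M *v x)$2 * (M *v y)$1 = M$1$1 * M$2$1 * (x$1 * y$1) + M$1$2 * M$2$2 * (x$2 * y$2) + b * (x$1 * y$2) + a * (x$2 * y$1)"
    by (simp_all add: a_def b_def algebra_simps)
  show "(M *v x)$1 * (M *v y)$2 \<le> \<kappa> * ((M *v x)$2 * (M *v y)$1)"
    unfolding e1 e2 using t1 t2 t3(1) t4(2) by (simp add: distrib_left mult.assoc)
  show "(M *v x)$2 * (M *v y)$1 \<le> \<kappa> * ((M *v x)$1 * (M *v y)$2)"
    unfolding e1 e2 using t1 t2 t3(2) t4(1) by (simp add: distrib_left mult.assoc)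
qed

text \<open>With \<open>t\<close> the largest scalar such that \<open>t y \<le> x\<close>, the
  hypotheses give \<open>x \<le> \<kappa> t y\<close>. Apply \<open>B\<close>, use the eigenvector
  equation for \<open>y\<close>, and return to \<open>x\<close>.\<close>

lemma eigenvector_comparison:
  fixes x y :: "real^2"
  assumes B: "nonneg_mat B" and x: "\<And>i. 0 < x$i" and y: "\<And>i. 0 < y$i"
    and k: "x$1 * y$2 \<le> \<kappa> * (x$2 * y$1)" "x$2 * y$1 \<le> \<kappa> * (x$1 * y$2)" and "1 \<le> \<kappa>"
    and e: "B *v y = b *\<^sub>R y" "0 \<le> b"
  shows "(B *v x)$i \<le> \<kappa> * b * x$i"
proof -
  define t where "t = min (x$1 / y$1) (x$2 / y$2)"
  have pos: "0 < x$1" "0 < x$2" "0 < y$1" "0 < y$2" using x y by auto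
  have t0: "0 < t" using pos by (simp add: t_def)
  have tle: "t * y$j \<le> x$j" for j
    using pos exhaust_2[of j] by (auto simp: t_def min_def field_simps)
  have xle: "x$j \<le> \<kappa> * (t * y$j)" for j
  proof (cases "x$1 / y$1 \<le> x$2 / y$2")
    case True
    then have t: "t = x$1 / y$1" by (simp add: t_def)
    have "x$1 \<le> \<kappa> * x$1" using mult_right_mono[OF assms(6), of "x$1"] pos by simp
    then show ?thesis using pos k(2) exhaust_2[of j] by (auto simp: t field_simps)
  next
    case False
    then have t: "t = x$2 / y$2" by (simp add: t_def)
    have "x$2 \<le> \<kappa> * x$2" using mult_right_mono[OF assms(6), of "x$2"] pos by simp
    then show ?thesis using pos k(1) exhaust_2[of j] by (auto simp: t field_simps)
  qed
  have "(B *v x)$i = B$i$1 * x$1 + B$i$2 * x$2" by simp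
  also have "\<dots> \<le> B$i$1 * (\<kappa> * (t * y$1)) + B$i$2 * (\<kappa> * (t * y$2))"
    using B xle by (intro add_mono mult_left_mono) (auto simp: nonneg_mat_def)
  also have "\<dots> = \<kappa> * t * (B *v y)$i" by (simp add: algebra_simps)
  also have "\<dots> = \<kappa> * b * (t * y$i)" unfolding e by simp
  also have "\<dots> \<le> \<kappa> * b * x$i" using tle e(2) assms(6) by (intro mult_left_mono) auto
  finally show ?thesis .
qed

context matrix_pair
begin

text \<open>Finitely many words of length \<open>L\<close> contain both letters, so their
  contraction ratios have a maximum below 1. Cut the word into such blocks and use
  submultiplicativity.\<close>

lemma contr_W_windows:
  assumes "0 < L"
  obtains \<theta> where "0 \<le> \<theta>" "\<theta> < 1"
    "\<And>w k. k * L \<le> length w \<Longrightarrow> (\<And>s. sublist s w \<Longrightarrow> length s = L \<Longrightarrow> 0 < num_ones s \<and> num_ones s < length s) \<Longrightarrow>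
       contr (W 1 w) \<le> \<theta> ^ k"
proof -
  define S where "S = {w. length w = L \<and> 0 < num_ones w \<and> num_ones w < length w}"
  have fin: "finite ((\<lambda>w. contr (W 1 w)) ` S)"
    unfolding S_def by (rule finite_imageI, rule finite_subset[OF _ finite_words[of L]]) auto
  \<comment> \<open>The 0 keeps the set non-empty, since \<open>S\<close> is empty for
    \<open>L = 1\<close>.\<close>
  define \<theta> where "\<theta> = Max (insert 0 ((\<lambda>w. contr (W 1 w)) ` S))"
  have t0: "0 \<le> \<theta>" unfolding \<theta>_def using fin by (intro Max_ge) auto
  have t1: "\<theta> < 1"
  proof -
    have "\<theta> \<in> insert 0 ((\<lambda>w. contr (W 1 w)) ` S)" unfolding \<theta>_def by (rule Max_in) (use fin in auto)
    then show ?thesis using contr_less_1[OF pos_W] by (auto simp: S_def)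
  qed
  have le: "contr (W 1 w) \<le> \<theta>" if "w \<in> S" for w unfolding \<theta>_def using fin that by (intro Max_ge) auto
  have "contr (W 1 w) \<le> \<theta> ^ k"
    if "k * L \<le> length w" "\<And>s. sublist s w \<Longrightarrow> length s = L \<Longrightarrow> 0 < num_ones s \<and> num_ones s < length s" for w k
    using that
  proof (induction k arbitrary: w)
    case 0
    then show ?case by (simp add: contr_le_1 nonneg_W)
  next
    case (Suc k)
    define a b where "a = take L w" and "b = drop L w"
    have w: "w = a @ b" by (simp add: a_def b_def)
    have la: "length a = L" using Suc.prems(1) by (simp add: a_def)
    have "sublist a w" "sublist b w" by (simp_all add: a_def b_def)
    then have "a \<in> S" and sub: "\<And>s. sublist s b \<Longrightarrow> sublist s w"
      using Suc.prems(2)[of a] la by (auto simp: S_def intro: sublist_order.order_trans)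
    have "contr (W 1 b) \<le> \<theta> ^ k"
      by (rule Suc.IH) (use Suc.prems sub in \<open>auto simp: b_def\<close>)
    have "contr (W 1 w) \<le> contr (W 1 b) * contr (W 1 a)"
      unfolding w word_matrix_append by (intro contr_mult nonneg_W det_W) auto
    also have "\<dots> \<le> \<theta> ^ k * \<theta>"
      using \<open>contr (W 1 b) \<le> \<theta> ^ k\<close> le[OF \<open>a \<in> S\<close>] t0 by (intro mult_mono contr_nonneg nonneg_W) auto
    finally show ?case by (simp add: mult.commute)
  qed
  then show ?thesis using that t0 t1 by blast
qed

text \<open>The word \<open>z\<close> is read last in the power of \<open>v\<close>, so its matrix
  acts last and the eigenvector lies in its image.\<close>

lemma perron_vector_in_cone:
  assumes "wpow v m = y @ z" "pos_mat (W 1 z)"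
  shows "\<exists>x' x :: real^2. (\<forall>i. 0 \<le> x'$i) \<and> x = W 1 z *v x' \<and> (\<forall>i. 0 < x$i) \<and> W 1 v *v x = \<rho> v *\<^sub>R x"
proof -
  have nn: "nonneg_mat (W 1 v)" by (simp add: nonneg_W)
  obtain x :: "real^2" where x: "\<And>i. 0 \<le> x$i" "x \<noteq> 0" "W 1 v *v x = \<rho> v *\<^sub>R x"
    using perron_eigenvector[OF nn] by metis
  define x' where "x' = inverse (\<rho> v ^ m) *\<^sub>R (W 1 y *v x)"
  have "\<rho> v ^ m *\<^sub>R x = W 1 (wpow v m) *v x"
    unfolding word_matrix_wpow by (rule matrix_power_eigenvector[OF x(3), symmetric])
  also have "\<dots> = W 1 z *v (W 1 y *v x)"
    by (simp add: assms(1) word_matrix_append matrix_vector_mul_assoc)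
  finally have "inverse (\<rho> v ^ m) *\<^sub>R (\<rho> v ^ m *\<^sub>R x) = W 1 z *v x'"
    by (simp add: x'_def matrix_vector_mult_scaleR)
  then have xz: "x = W 1 z *v x'" using \<rho>_pos[of v] by simp
  have x'0: "0 \<le> x'$i" for i
    using \<rho>_pos[of v] x(1) nonneg_W[of 1 y] by (simp add: x'_def nonneg_mat_def)
  have "0 < x$i" for i
  proof -
    have "x' \<noteq> 0" using xz x(2) by auto
    then have "0 < x'$1 \<or> 0 < x'$2" using x'0[of 1] x'0[of 2] vec2_eqI[of x' 0] by force
    moreover have "0 < W 1 z$i$1" "0 < W 1 z$i$2" using assms(2) by (auto simp: pos_mat_def)
    ultimately have "0 < W 1 z$i$1 * x'$1 + W 1 z$i$2 * x'$2"
      using x'0[of 1] x'0[of 2] by (auto intro: add_pos_nonneg add_nonneg_pos)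
    then show ?thesis unfolding xz by simp
  qed
  then show ?thesis using x'0 xz x(3) by blast
qed

text \<open>The Perron vector of \<open>v\<close> is the test vector in
  \<open>perron_le_collatz\<close>. It is exact for the powers of \<open>v\<close>, so the loss
  \<open>c\<close> does not depend on \<open>k\<close>.\<close>

lemma \<rho>_product_le:
  assumes x: "\<And>i. 0 < x$i" "W 1 v *v x = \<rho> v *\<^sub>R x" and le: "\<And>i. (W 1 u *v x)$i \<le> c * x$i"
  shows "\<rho> (u @ wpow v k) \<le> c * \<rho> v ^ k"
proof (rule perron_le_collatz[OF nonneg_W x(1)])
  fix i
  let ?M = "matrix_power (W 1 v) k"
  have nn: "nonneg_mat ?M" by (intro nonneg_matrix_power nonneg_W) simp
  have "(W 1 (u @ wpow v k) *v x)$i = (?M *v (W 1 u *v x))$i"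
    by (simp only: W_append_wpow matrix_vector_mul_assoc)
  also have "\<dots> = ?M$i$1 * (W 1 u *v x)$1 + ?M$i$2 * (W 1 u *v x)$2" by (rule mult_vec2_entry)
  also have "\<dots> \<le> ?M$i$1 * (c * x$1) + ?M$i$2 * (c * x$2)"
    using nn le by (intro add_mono mult_left_mono) (auto simp: nonneg_mat_def simp del: mult_vec2_entry)
  also have "\<dots> = c * (?M *v x)$i" by (simp add: algebra_simps)
  also have "?M *v x = \<rho> v ^ k *\<^sub>R x" by (rule matrix_power_eigenvector[OF x(2)])
  finally show "(W 1 (u @ wpow v k) *v x)$i \<le> c * \<rho> v ^ k * x$i" by simp
qed simp

text \<open>The Perron vectors of \<open>u\<close> and \<open>v\<close> both lie in the image of the
  quadrant under \<open>W 1 z\<close>, so each satisfies the eigenvector inequality of the other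
  matrix up to the factor \<open>\<kappa>\<close>. The bounds are uniform in \<open>k\<close>, as
  the plateau ends are approached for large \<open>k\<close>.\<close>

lemma log_ratio_bounds:
  assumes uv: "(u, v) \<in> standard_pairs" "u @ v = [a, b] @ z" "v @ u = [b, a] @ z" and z: "pos_mat (W 1 z)"
  defines "\<kappa> \<equiv> (1 + contr (W 1 z)) / (1 - contr (W 1 z))"
  shows "log_ratio (u @ wpow v k) v \<le> log_ratio u v + real (length v) * ln \<kappa>"
    and "log_ratio u v - real (length u) * ln \<kappa> \<le> log_ratio u (v @ wpow u k)"
proof -
  obtain mu yu where su: "wpow u mu = yu @ z" using standard_pair_suffix_powers(1)[OF uv] by blast
  obtain mv yv where sv: "wpow v mv = yv @ z" using standard_pair_suffix_powers(2)[OF uv] by blast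
  obtain x' x :: "real^2" where x_: "\<forall>i. 0 \<le> x'$i" "x = W 1 z *v x'" "\<forall>i. 0 < x$i" "W 1 v *v x = \<rho> v *\<^sub>R x"
    using perron_vector_in_cone[OF sv z] by blast
  note x = x_(1)[rule_format] x_(2) x_(3)[rule_format] x_(4)
  obtain y' y :: "real^2" where y_: "\<forall>i. 0 \<le> y'$i" "y = W 1 z *v y'" "\<forall>i. 0 < y$i" "W 1 u *v y = \<rho> u *\<^sub>R y"
    using perron_vector_in_cone[OF su z] by blast
  note y = y_(1)[rule_format] y_(2) y_(3)[rule_format] y_(4)
  note c = contr_cone[where x = x' and y = y', OF z x(1) y(1), folded \<kappa>_def, folded x(2) y(2)]
  have k0: "0 < \<kappa>" using c(3) by simp
  have p: "0 < \<rho> u" "0 < \<rho> v" by (rule \<rho>_pos)+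
  have ux: "(W 1 u *v x)$i \<le> \<kappa> * \<rho> u * x$i" for i
    by (rule eigenvector_comparison[OF nonneg_W x(3) y(3) c y(4)]) (use p in auto)
  have vy: "(W 1 v *v y)$i \<le> \<kappa> * \<rho> v * y$i" for i
    by (rule eigenvector_comparison[OF nonneg_W y(3) x(3) _ _ c(3) x(4)]) (use p c in \<open>auto simp: mult.commute\<close>)
  have "ln (\<rho> (u @ wpow v k)) \<le> ln (\<kappa> * \<rho> u * \<rho> v ^ k)"
    using \<rho>_product_le[OF x(3,4) ux, of k] \<rho>_pos[of "u @ wpow v k"] by simp
  also have "\<dots> = ln \<kappa> + ln (\<rho> u) + real k * ln (\<rho> v)" using k0 p by (simp add: ln_mult ln_realpow)
  finally have "real (length v) * ln (\<rho> (u @ wpow v k)) \<le> real (length v) * (ln \<kappa> + ln (\<rho> u) + real k * ln (\<rho> v))"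
    by (rule mult_left_mono) simp
  then show "log_ratio (u @ wpow v k) v \<le> log_ratio u v + real (length v) * ln \<kappa>"
    by (simp add: log_ratio_def algebra_simps)
  have "ln (\<rho> (v @ wpow u k)) \<le> ln (\<kappa> * \<rho> v * \<rho> u ^ k)"
    using \<rho>_product_le[OF y(3,4) vy, of k] \<rho>_pos[of "v @ wpow u k"] by simp
  also have "\<dots> = ln \<kappa> + ln (\<rho> v) + real k * ln (\<rho> u)" using k0 p by (simp add: ln_mult ln_realpow)
  finally have "real (length u) * ln (\<rho> (v @ wpow u k)) \<le> real (length u) * (ln \<kappa> + ln (\<rho> v) + real k * ln (\<rho> u))"
    by (rule mult_left_mono) simp
  then show "log_ratio u v - real (length u) * ln \<kappa> \<le> log_ratio u (v @ wpow u k)"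
    by (simp add: log_ratio_def algebra_simps)
qed

end

section \<open>Gap estimate and irrational ratios\<close>

lemma power_times_geometric_limit:
  fixes c :: real
  assumes "0 < c" "c < 1"
  shows "(\<lambda>m. (real m + 1) ^ j * c ^ m) \<longlonglongrightarrow> 0"
proof (cases "j = 0")
  case True
  then show ?thesis using LIMSEQ_power_zero[of c] assms by simp
next
  case False
  \<comment> \<open>Each of the \<open>j\<close> linear factors receives its share \<open>s\<close>
    of the geometric decay.\<close>
  define s where "s = root j c"
  have s: "0 < s" "s < 1" "s ^ j = c" using assms False by (simp_all add: s_def)
  have "(\<lambda>m. real m * s ^ m + s ^ m) \<longlonglongrightarrow> 0 + 0"
    using s by (intro tendsto_add powser_times_n_limit_0 LIMSEQ_power_zero) simp_all
  then have "(\<lambda>m. (real m * s ^ m + s ^ m) ^ j) \<longlonglongrightarrow> 0 ^ j" by (intro tendsto_power) simp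
  moreover have "(real m * s ^ m + s ^ m) ^ j = (real m + 1) ^ j * c ^ m" for m
  proof -
    have "real m * s ^ m + s ^ m = (real m + 1) * s ^ m" by (simp add: algebra_simps)
    then show ?thesis by (simp only: power_mult_distrib s(3)[symmetric] power_mult[symmetric] mult.commute[of j])
  qed
  ultimately show ?thesis using False by (simp add: zero_power)
qed

context sturmian_pair
begin

text \<open>\<open>\<alpha>\<close> lies beyond the plateau of \<open>u\<close> and
  \<open>\<beta>\<close> before that of \<open>v\<close>. For a common large \<open>k\<close> both
  are compared with approximate plateau ends, which exceed or fall below
  \<open>log_ratio u v\<close> by at most a word length times \<open>ln \<kappa>\<close>.\<close>

lemma gap_estimate:
  assumes uv: "(u, v) \<in> standard_pairs" "u @ v = [a, b] @ z" "v @ u = [b, a] @ z" and z: "pos_mat (W 1 z)"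
    and c: "contr (W 1 z) \<le> 1 / 2"
    and \<alpha>: "0 < \<alpha>" "slope u < r \<alpha>" and \<beta>: "0 < \<beta>" "r \<beta> < slope v"
  shows "ln \<beta> - ln \<alpha> \<le> 4 * real (length (u @ v)) * contr (W 1 z)"
proof -
  define \<kappa> where "\<kappa> = (1 + contr (W 1 z)) / (1 - contr (W 1 z))"
  have "\<forall>\<^sub>F k in sequentially. ln \<beta> \<le> log_ratio (u @ wpow v k) v \<and> log_ratio u (v @ wpow u k) \<le> ln \<alpha>"
    using r_less_slope[OF uv(1) \<beta>] r_greater_slope[OF uv(1) \<alpha>] by eventually_elim simp
  then obtain k where k: "ln \<beta> \<le> log_ratio (u @ wpow v k) v" "log_ratio u (v @ wpow u k) \<le> ln \<alpha>"
    using eventually_happens'[OF sequentially_bot] by blast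
  have c0: "0 \<le> contr (W 1 z)" by (intro contr_nonneg nonneg_W) simp
  \<comment> \<open>For the ratio \<open>c = contr (W 1 z)\<close> one has
    \<open>\<kappa> - 1 = 2 c / (1 - c)\<close>, and \<open>c \<le> 1 / 2\<close> gives the constant
    4.\<close>
  have "ln \<kappa> \<le> 4 * contr (W 1 z)"
  proof -
    have "0 < \<kappa>" using c c0 by (simp add: \<kappa>_def)
    then have "ln \<kappa> \<le> \<kappa> - 1" by (rule ln_le_minus_one)
    also have "\<dots> = 2 * contr (W 1 z) / (1 - contr (W 1 z))" using c by (simp add: \<kappa>_def field_simps)
    also have "\<dots> \<le> 2 * contr (W 1 z) / (1 / 2)" using c c0 by (intro divide_left_mono) auto
    finally show ?thesis by simp
  qed
  then have "real (length (u @ v)) * ln \<kappa> \<le> real (length (u @ v)) * (4 * contr (W 1 z))"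
    by (rule mult_left_mono) simp
  moreover have "ln \<beta> - ln \<alpha> \<le> real (length (u @ v)) * ln \<kappa>"
    using k log_ratio_bounds[OF uv z, of k] by (simp add: \<kappa>_def distrib_right)
  ultimately show ?thesis by (simp add: mult.left_commute mult.assoc del: length_append)
qed

text \<open>A named predicate that \<open>eventually\<close> can treat as a unit. The margin is
  imposed on \<open>r \<alpha>\<close> only and passes to the slopes of \<open>u\<close> and
  \<open>v\<close>, which enclose it.\<close>

definition gaps_bounded :: "nat \<Rightarrow> real \<Rightarrow> nat \<Rightarrow> bool" where
  "gaps_bounded N c m \<longleftrightarrow> (\<forall>u v \<alpha> \<beta>. (u, v) \<in> standard_pairs \<longrightarrow>
     length u \<le> m \<longrightarrow> length v \<le> m \<longrightarrow> m < length u + length v \<longrightarrow> 0 < \<alpha> \<longrightarrow> 0 < \<beta> \<longrightarrow>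
     slope u < r \<alpha> \<longrightarrow> r \<alpha> < slope v \<longrightarrow> r \<beta> < slope v \<longrightarrow>
     1 / real N < r \<alpha> \<longrightarrow> r \<alpha> < 1 - 1 / real N \<longrightarrow> ln \<beta> - ln \<alpha> \<le> c)"

lemma gaps_boundedD:
  assumes "gaps_bounded N c m" "(u, v) \<in> standard_pairs" "length u \<le> m" "length v \<le> m" "m < length u + length v"
    "0 < \<alpha>" "0 < \<beta>" "slope u < r \<alpha>" "r \<alpha> < slope v" "r \<beta> < slope v"
    "1 / real N < r \<alpha>" "r \<alpha> < 1 - 1 / real N"
  shows "ln \<beta> - ln \<alpha> \<le> c"
  using assms(1)[unfolded gaps_bounded_def, rule_format, OF assms(2-)] .

lemma uniform_gap_estimate:
  fixes N :: nat
  assumes N: "2 \<le> N"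
  obtains K \<tau> where "0 < K" "0 < \<tau>" "\<tau> < 1"
    "\<forall>\<^sub>F m in sequentially. gaps_bounded N (K * real m * \<tau> ^ m) m"
proof -
  \<comment> \<open>Half of the margin \<open>1 / N\<close> is spent on passing from
    \<open>r \<alpha>\<close> to the slopes of \<open>u\<close> and \<open>v\<close>, which differ
    by at most \<open>1 / L\<close> once \<open>m > L\<close>; the other half leaves room for both
    letters in windows of length \<open>L\<close>.\<close>
  define L where "L = 2 * N"
  have L0: "0 < L" using N by (simp add: L_def)
  obtain \<theta> where \<theta>: "0 \<le> \<theta>" "\<theta> < 1" and
    win: "\<And>w k. k * L \<le> length w \<Longrightarrow> (\<And>s. sublist s w \<Longrightarrow> length s = L \<Longrightarrow> 0 < num_ones s \<and> num_ones s < length s) \<Longrightarrow>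
       contr (W 1 w) \<le> \<theta> ^ k"
    using contr_W_windows[OF L0] by blast
  \<comment> \<open>The bound may be 0; the maximum makes its root \<open>\<tau>\<close>
    positive.\<close>
  define \<theta>' where "\<theta>' = max \<theta> (1/2)"
  have \<theta>': "0 < \<theta>'" "\<theta>' < 1" "\<theta> \<le> \<theta>'" using \<theta> by (auto simp: \<theta>'_def)
  define \<tau> where "\<tau> = root L \<theta>'"
  have \<tau>: "0 < \<tau>" "\<tau> < 1" "\<tau> ^ L = \<theta>'" using \<theta>' L0 by (simp_all add: \<tau>_def)
  have main: "ln \<beta> - ln \<alpha> \<le> 8 / \<theta>' * real m * \<tau> ^ m"
    if m: "L < m" "\<tau> ^ m / \<theta>' \<le> 1 / 2" and uv: "(u, v) \<in> standard_pairs"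
      and len: "length u \<le> m" "length v \<le> m" "m < length u + length v"
      and \<alpha>: "0 < \<alpha>" and \<beta>: "0 < \<beta>" and sl: "slope u < r \<alpha>" "r \<alpha> < slope v" "r \<beta> < slope v"
      and rN: "1 / real N < r \<alpha>" "r \<alpha> < 1 - 1 / real N" for m u v \<alpha> \<beta>
  proof -
    obtain a b z where z: "u @ v = [a, b] @ z" "v @ u = [b, a] @ z"
      using standard_pair_common_suffix[OF uv] by blast
    define p Q where "p = num_ones (u @ v)" and "Q = length (u @ v)"
    have ne: "0 < length u" "0 < length v" using standard_pair_nonempty[OF uv] by auto
    \<comment> \<open>This is \<open>(|u| - 1) (|v| - 1) \<ge> 0\<close>: the product of the lengths
      is at least their sum minus 1, hence at least \<open>m\<close>.\<close>
    have "1 * 1 + length u + length v \<le> length u * length v + 1 * 1 + 1"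
    proof -
      obtain i j where "length u = Suc i" "length v = Suc j" using ne by (metis gr0_implies_Suc)
      then show ?thesis by simp
    qed
    then have "L \<le> length u * length v" using m(1) len(3) by simp
    then have "real L \<le> real (length u) * real (length v)" by (metis of_nat_le_iff of_nat_mult)
    then have small: "1 / (real (length u) * real (length v)) \<le> 1 / real L"
      using L0 by (intro divide_left_mono) auto
    have half: "1 / real L = 1 / real N / 2" by (simp add: L_def)
    have slp: "slope (u @ v) = real p / real Q" by (simp add: slope_def p_def Q_def)
    have Q0: "0 < real Q" unfolding Q_def length_append of_nat_0_less_iff using ne by linarith
    have d: "slope v = slope u + 1 / (real (length u) * real (length v))"
      using standard_pair_slope_less[OF uv] by simp
    have "slope u < slope (u @ v)"
      using standard_pair_slope_bounds(1)[OF standard_pairs.right[OF uv]] by (simp add: slope_append_commute[of v u])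
    moreover have lo: "1 / real L < slope u" "slope v < 1 - 1 / real L"
    proof -
      define e h n where "e = 1 / (real (length u) * real (length v))" and "h = 1 / real L" and "n = 1 / real N"
      have "slope v = slope u + e" "e \<le> h" "h = n / 2" "n < r \<alpha>" "r \<alpha> < 1 - n"
        using d small half rN by (simp_all only: e_def h_def n_def)
      then have "h < slope u" "slope v < 1 - h" using sl by linarith+
      then show "1 / real L < slope u" "slope v < 1 - 1 / real L" by (simp_all only: h_def)
    qed
    ultimately have "1 / real L < real p / real Q" unfolding slp by (metis less_trans)
    then have "real Q < real L * real p" using L0 Q0 by (simp add: field_simps)
    then have "Q < L * p" by (simp only: of_nat_mult[symmetric] of_nat_less_iff)
    then have w1: "Q \<le> L * p" by simp
    have "slope (u @ v) < slope v"
      by (rule standard_pair_slope_bounds(1)[OF standard_pairs.left[OF uv]])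
    then have w2': "1 / real L < 1 - real p / real Q" using lo(2) unfolding slp by linarith
    have pQ: "p \<le> Q" unfolding p_def Q_def by (rule num_ones_le_length)
    then have "1 - real p / real Q = real (Q - p) / real Q" using Q0 by (simp add: of_nat_diff diff_divide_distrib)
    then have "1 / real L < real (Q - p) / real Q" using w2' by (simp del: of_nat_diff)
    then have "real Q < real L * real (Q - p)" using L0 Q0 by (simp add: field_simps del: of_nat_diff)
    then have "Q < L * (Q - p)" by (simp only: of_nat_mult[symmetric] of_nat_less_iff)
    then have w2: "Q \<le> L * (Q - p)" by simp
    have sub: "0 < num_ones s \<and> num_ones s < length s" if s: "sublist s z" "length s = L" for s
    proof -
      have "sublist z (u @ v)" unfolding z(1) sublist_def by (metis append_Nil2)
      with s(1) have "sublist s (u @ v)" by (rule sublist_order.order_trans)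
      from standard_pair_windows[OF uv this, folded p_def Q_def, unfolded s(2), OF w1 w2]
      show ?thesis unfolding s(2) by simp
    qed
    define k where "k = (m - 1) div L"
    \<comment> \<open>\<open>z\<close> lacks the two leading letters of \<open>uv\<close>, whose
      length exceeds \<open>m\<close>.\<close>
    have lz: "m - 1 \<le> length z" using arg_cong[OF z(1), of length] len(3) by simp
    have "k * L \<le> m - 1" unfolding k_def by (rule div_times_less_eq_dividend)
    then have kz: "k * L \<le> length z" using lz by simp
    have "sublist (take L z) z" "length (take L z) = L" using lz m(1) by auto
    then have t: "0 < num_ones (take L z)" "num_ones (take L z) < length (take L z)" using sub by blast+
    have "num_ones z = num_ones (take L z) + num_ones (drop L z)"
      by (metis append_take_drop_id num_ones_append)
    moreover have "length z = length (take L z) + length (drop L z)" by (metis append_take_drop_id length_append)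
    ultimately have "0 < num_ones z" "num_ones z < length z"
      using t num_ones_le_length[of "drop L z"] by linarith+
    then have pz: "pos_mat (W 1 z)" by (rule pos_W)
    have "contr (W 1 z) \<le> \<theta> ^ k" by (rule win[OF kz sub])
    also have "\<dots> \<le> \<theta>' ^ k" using \<theta>(1) \<theta>'(3) by (rule power_mono[rotated])
    also have "\<dots> = \<tau> ^ (L * k)" unfolding \<tau>(3)[symmetric] by (rule power_mult[symmetric])
    \<comment> \<open>Rounding to whole windows leaves an exponent of at least \<open>m - L\<close>,
      and the lost \<open>L\<close> letters cost a factor \<open>1 / \<theta>'\<close>.\<close>
    also have "\<dots> \<le> \<tau> ^ (m - L)"
    proof (rule power_decreasing)
      have "m - 1 = k * L + (m - 1) mod L" unfolding k_def by (rule div_mult_mod_eq[symmetric])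
      moreover have "(m - 1) mod L < L" using L0 by simp
      ultimately show "m - L \<le> L * k" by (simp add: mult.commute)
    qed (use \<tau> in auto)
    also have "\<dots> = \<tau> ^ m / \<theta>'"
      using m(1) \<tau> \<theta>'(1) by (simp add: power_diff)
    finally have ct: "contr (W 1 z) \<le> \<tau> ^ m / \<theta>'" .
    have "ln \<beta> - ln \<alpha> \<le> 4 * real (length (u @ v)) * contr (W 1 z)"
      by (rule gap_estimate[OF uv z pz order_trans[OF ct m(2)] \<alpha> sl(1) \<beta> sl(3)])
    also have "\<dots> \<le> 4 * (2 * real m) * (\<tau> ^ m / \<theta>')"
      using ct len contr_nonneg[OF nonneg_W[of 1 z]] by (intro mult_mono) auto
    finally show ?thesis by simp
  qed
  have "(\<lambda>m. \<tau> ^ m / \<theta>') \<longlonglongrightarrow> 0 / \<theta>'"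
    using \<tau> \<theta>' by (intro tendsto_divide LIMSEQ_power_zero tendsto_const) auto
  then have "\<forall>\<^sub>F m in sequentially. \<tau> ^ m / \<theta>' < 1 / 2" by (rule order_tendstoD(2)) simp
  then have "\<forall>\<^sub>F m in sequentially. gaps_bounded N (8 / \<theta>' * real m * \<tau> ^ m) m"
    using eventually_gt_at_top[of L]
    by eventually_elim (unfold gaps_bounded_def, intro allI impI main, simp_all)
  then show ?thesis using that[of "8 / \<theta>'" \<tau>] \<tau> \<theta>'(1) by simp
qed

section \<open>Preimages of irrational values\<close>

lemma exists_margin:
  assumes "0 < \<gamma>" "\<gamma> < (1::real)"
  shows "\<exists>N\<ge>2. 1 / real N < \<gamma> \<and> \<gamma> < 1 - 1 / real N"
proof -
  obtain n where n: "1 / real (Suc n) < min \<gamma> (1 - \<gamma>)"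
    using nat_approx_posE[of "min \<gamma> (1 - \<gamma>)"] assms by (metis diff_gt_0_iff_gt min_less_iff_conj)
  have "1 / real (n + 2) \<le> 1 / real (Suc n)" by (intro divide_left_mono) auto
  then have "1 / real (n + 2) < \<gamma>" "\<gamma> < 1 - 1 / real (n + 2)" using n by linarith+
  then show ?thesis by (intro exI[of _ "n + 2"]) simp
qed

lemma irrational_preimage_singleton:
  assumes \<gamma>: "\<gamma> \<notin> \<rat>" "0 < \<gamma>" "\<gamma> < 1"
  shows "is_singleton (preimage r {\<gamma>})"
proof -
  obtain N where N: "2 \<le> N" "1 / real N < \<gamma>" "\<gamma> < 1 - 1 / real N" using exists_margin[OF \<gamma>(2,3)] by blast
  obtain K \<tau> where K: "0 < K" "0 < \<tau>" "\<tau> < 1" and gap: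
    "\<forall>\<^sub>F m in sequentially. gaps_bounded N (K * real m * \<tau> ^ m) m"
    by (rule uniform_gap_estimate[OF N(1)])
  have "(\<lambda>m. K * (real m * \<tau> ^ m)) \<longlonglongrightarrow> K * 0"
    using K by (intro tendsto_mult tendsto_const powser_times_n_limit_0) simp
  then have lim: "(\<lambda>m. K * real m * \<tau> ^ m) \<longlonglongrightarrow> 0" by (simp add: mult.assoc)
  \<comment> \<open>The Farey intervals around \<open>\<gamma>\<close> exist for every
    \<open>m\<close>, and the gap bound tends to 0; exchanging \<open>\<alpha>\<close> and
    \<open>\<beta>\<close> gives equality.\<close>
  have le: "ln \<beta> - ln \<alpha> \<le> 0" if ab: "0 < \<alpha>" "0 < \<beta>" "r \<alpha> = \<gamma>" "r \<beta> = \<gamma>" for \<alpha> \<beta>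
  proof (rule tendsto_lowerbound[OF lim])
    show "\<forall>\<^sub>F m in sequentially. ln \<beta> - ln \<alpha> \<le> K * real m * \<tau> ^ m"
      using gap eventually_ge_at_top[of 1]
    proof eventually_elim
      case (elim m)
      obtain u v where uv: "(u, v) \<in> standard_pairs" "slope u < \<gamma>" "\<gamma> < slope v"
        "length u \<le> m" "length v \<le> m" "m < length u + length v"
        using irrational_farey[OF \<gamma> elim(2)] by blast
      show ?case
        by (rule gaps_boundedD[OF elim(1) uv(1,4,5,6) ab(1,2)]) (use uv ab N in simp_all)
    qed
  qed simp
  obtain \<alpha> where \<alpha>: "0 < \<alpha>" "r \<alpha> = \<gamma>" using r_IVT[OF less_imp_le[OF \<gamma>(2)] \<gamma>(3)] \<gamma>(2) by metis
  have "preimage r {\<gamma>} = {\<alpha>}"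
  proof (intro set_eqI iffI)
    fix \<beta> assume "\<beta> \<in> preimage r {\<gamma>}"
    then have b: "r \<beta> = \<gamma>" "0 \<le> \<beta>" by auto
    then have b0: "0 < \<beta>" using r_zero \<gamma>(2) by (cases "\<beta> = 0") auto
    have "ln \<beta> = ln \<alpha>" using le[OF \<alpha>(1) b0 \<alpha>(2) b(1)] le[OF b0 \<alpha>(1) b(1) \<alpha>(2)] by simp
    then show "\<beta> \<in> {\<alpha>}" using b0 \<alpha>(1) by simp
  qed (use \<alpha> in auto)
  then show ?thesis by (simp add: is_singleton_def)
qed

lemma null_cover_irrational_margin:
  fixes N :: nat
  assumes N: "2 \<le> N" and s: "0 < s" "s < 1"
  shows "null_cover s {\<alpha>. 0 \<le> \<alpha> \<and> r \<alpha> \<notin> \<rat> \<and> 1 / real N < r \<alpha> \<and> r \<alpha> < 1 - 1 / real N}"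
    (is "null_cover s ?E")
proof (rule null_cover_finite)
  fix \<epsilon> \<delta> :: real assume \<epsilon>: "0 < \<epsilon>" and \<delta>: "0 < \<delta>"
  obtain K \<tau> where K: "0 < K" "0 < \<tau>" "\<tau> < 1" and gap:
    "\<forall>\<^sub>F m in sequentially. gaps_bounded N (K * real m * \<tau> ^ m) m"
    by (rule uniform_gap_estimate[OF N])
  obtain B where B: "0 < B" "1 - 1 / real N < r B" using r_large[of "1 / real N"] N by auto
  have le_B: "\<alpha> \<le> B" if "r \<alpha> < 1 - 1 / real N" for \<alpha>
    using r_mono[of B \<alpha>] B that by (smt (verit))
  define C where "C = B * K"
  have C: "0 < C" using B K by (simp add: C_def)
  define \<sigma> where "\<sigma> = \<tau> powr s"
  have \<sigma>: "0 < \<sigma>" "\<sigma> < 1" using K s powr_less_mono2[of s \<tau> 1] by (simp_all add: \<sigma>_def)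
  have "(\<lambda>m. C * (real m * \<tau> ^ m)) \<longlonglongrightarrow> C * 0"
    using K by (intro tendsto_mult tendsto_const powser_times_n_limit_0) simp
  then have ev1: "\<forall>\<^sub>F m in sequentially. C * (real m * \<tau> ^ m) < \<delta>" by (rule order_tendstoD(2)) (use \<delta> in simp)
  \<comment> \<open>Four of the five polynomial factors count the classes in \<open>I\<close>; the
    fifth absorbs \<open>real m powr s\<close>.\<close>
  have "(\<lambda>m. C powr s * ((real m + 1) ^ 5 * \<sigma> ^ m)) \<longlonglongrightarrow> C powr s * 0"
    using \<sigma> by (intro tendsto_mult tendsto_const power_times_geometric_limit)
  then have ev2: "\<forall>\<^sub>F m in sequentially. C powr s * ((real m + 1) ^ 5 * \<sigma> ^ m) < \<epsilon>"
    by (rule order_tendstoD(2)) (use \<epsilon> in simp)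
  have "\<forall>\<^sub>F m in sequentially. gaps_bounded N (K * real m * \<tau> ^ m) m \<and>
     C * (real m * \<tau> ^ m) < \<delta> \<and> C powr s * ((real m + 1) ^ 5 * \<sigma> ^ m) < \<epsilon> \<and> 1 \<le> m"
    using gap ev1 ev2 eventually_ge_at_top[of 1] by eventually_elim (intro conjI)
  then obtain m where gap_m: "gaps_bounded N (K * real m * \<tau> ^ m) m"
    and m: "C * (real m * \<tau> ^ m) < \<delta>" "C powr s * ((real m + 1) ^ 5 * \<sigma> ^ m) < \<epsilon>" "1 \<le> m"
    using eventually_happens'[OF sequentially_bot] by blast
  define D where "D = C * (real m * \<tau> ^ m)"
  define I where "I = {..m} \<times> {..m} \<times> {..m} \<times> {..m}"
  \<comment> \<open>Sorting by numbers of ones and lengths instead of by words leaves at most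
    \<open>(m + 1) ^ 4\<close> classes. The slopes, and with them the gap bound, are constant on
    each class.\<close>
  define U where "U = (\<lambda>(p1, q1, p2, q2). {\<alpha>. 0 < \<alpha> \<and> 1 / real N < r \<alpha> \<and> r \<alpha> < 1 - 1 / real N \<and>
     (\<exists>u v. (u, v) \<in> standard_pairs \<and> num_ones u = p1 \<and> length u = q1 \<and> num_ones v = p2 \<and> length v = q2 \<and>
        q1 \<le> m \<and> q2 \<le> m \<and> m < q1 + q2 \<and> slope u < r \<alpha> \<and> r \<alpha> < slope v)})"
  have cover: "?E \<subseteq> (\<Union>i\<in>I. U i)"
  proof
    fix \<alpha> assume "\<alpha> \<in> ?E"
    then have a: "0 \<le> \<alpha>" "r \<alpha> \<notin> \<rat>" "1 / real N < r \<alpha>" "r \<alpha> < 1 - 1 / real N" by auto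
    have "0 < 1 / real N" using N by simp
    then have r01: "0 < r \<alpha>" "r \<alpha> < 1" using a by linarith+
    then have a0: "0 < \<alpha>" using r_zero a(1) by (cases "\<alpha> = 0") auto
    obtain u v where uv: "(u, v) \<in> standard_pairs" "slope u < r \<alpha>" "r \<alpha> < slope v"
        "length u \<le> m" "length v \<le> m" "m < length u + length v"
      using irrational_farey[OF a(2) r01 m(3)] by blast
    have "(num_ones u, length u, num_ones v, length v) \<in> I"
      using uv num_ones_le_length[of u] num_ones_le_length[of v] by (simp add: I_def)
    moreover have "\<alpha> \<in> U (num_ones u, length u, num_ones v, length v)"
      unfolding U_def using uv a a0 by auto
    ultimately show "\<alpha> \<in> (\<Union>i\<in>I. U i)" by blast
  qed
  have diff: "\<beta> - \<alpha> \<le> D" if ab: "\<alpha> \<in> U i" "\<beta> \<in> U i" for \<alpha> \<beta> i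
  proof -
    obtain p1 q1 p2 q2 where i: "i = (p1, q1, p2, q2)" by (cases i)
    have a: "0 < \<alpha>" "1 / real N < r \<alpha>" "r \<alpha> < 1 - 1 / real N" and b: "0 < \<beta>" "r \<beta> < 1 - 1 / real N"
      using ab by (auto simp: U_def i)
    obtain u v where uv: "(u, v) \<in> standard_pairs" "num_ones u = p1" "length u = q1" "num_ones v = p2" "length v = q2"
       "q1 \<le> m" "q2 \<le> m" "m < q1 + q2" "slope u < r \<alpha>" "r \<alpha> < slope v"
      using ab(1)[unfolded U_def i, simplified] by blast
    have "r \<beta> < real p2 / real q2" using ab(2) unfolding U_def i by (auto simp: slope_def)
    then have "r \<beta> < slope v" using uv by (simp add: slope_def)
    then have "ln \<beta> - ln \<alpha> \<le> K * real m * \<tau> ^ m"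
      using uv a b \<open>r \<beta> < slope v\<close> by (intro gaps_boundedD[OF gap_m uv(1)]) simp_all
    \<comment> \<open>Back from logarithms: multiplied by \<open>\<beta> \<le> B\<close>, this
      bounds \<open>\<beta> - \<alpha>\<close> itself.\<close>
    moreover have "1 - \<alpha> / \<beta> \<le> ln \<beta> - ln \<alpha>"
      using ln_le_minus_one[of "\<alpha> / \<beta>"] a b by (simp add: ln_div)
    ultimately have "1 - \<alpha> / \<beta> \<le> K * real m * \<tau> ^ m" by simp
    then have "\<beta> * (1 - \<alpha> / \<beta>) \<le> \<beta> * (K * real m * \<tau> ^ m)" using b(1) by (intro mult_left_mono) auto
    also have "\<dots> \<le> B * (K * real m * \<tau> ^ m)" using le_B[OF b(2)] K by (intro mult_right_mono) auto
    finally show ?thesis using b(1) by (simp add: D_def C_def right_diff_distrib mult.assoc)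
  qed
  have D0: "0 \<le> D" using C K by (simp add: D_def)
  have bdd: "bounded (U i)" for i
  proof (rule bounded_subset[of "{0..B}"])
    show "U i \<subseteq> {0..B}" using le_B by (auto simp: U_def)
  qed simp
  have diam: "diameter (U i) \<le> D" for i
    using diff[of _ i] D0 by (intro diameter_le) (auto simp: abs_le_iff)
  have powD: "diameter_powr s (U i) \<le> D powr s" for i
    using diam[of i] diameter_ge_0[OF bdd[of i]] s by (simp add: diameter_powr_def powr_mono2)
  have "(\<Sum>i\<in>I. diameter_powr s (U i)) \<le> (\<Sum>i\<in>I. D powr s)" by (intro sum_mono powD)
  also have "\<dots> = (real m + 1) ^ 4 * D powr s"
    by (simp add: I_def card_cartesian_product power4_eq_xxxx algebra_simps)
  also have "D powr s \<le> C powr s * ((real m + 1) * \<sigma> ^ m)"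
  proof -
    have "D powr s = C powr s * (real m powr s * (\<tau> ^ m) powr s)"
      using C K by (simp add: D_def powr_mult)
    also have "(\<tau> ^ m) powr s = \<sigma> ^ m"
      using K by (simp add: \<sigma>_def powr_realpow[symmetric] powr_powr mult.commute)
    also have "real m powr s \<le> real m + 1"
    proof -
      have "real m powr s \<le> real m powr 1" using m(3) s by (intro powr_mono) auto
      then show ?thesis by simp
    qed
    finally show ?thesis using \<sigma>(1) by (simp add: mult_left_mono mult_right_mono)
  qed
  also have "(real m + 1) ^ 4 * (C powr s * ((real m + 1) * \<sigma> ^ m)) = C powr s * ((real m + 1) ^ 5 * \<sigma> ^ m)"
    by (simp add: power_Suc[of _ 4, simplified] mult.left_commute mult.assoc)
  also have "\<dots> \<le> \<epsilon>" using m(2) by simp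
  finally have sum: "(\<Sum>i\<in>I. diameter_powr s (U i)) \<le> \<epsilon>" by simp
  have "finite I" by (simp add: I_def)
  moreover have "\<forall>i\<in>I. bounded (U i) \<and> diameter (U i) \<le> \<delta>"
    using bdd order_trans[OF diam less_imp_le[OF m(1)[folded D_def]]] by blast
  ultimately show "\<exists>(I :: (nat \<times> nat \<times> nat \<times> nat) set) U. finite I \<and> ?E \<subseteq> (\<Union>i\<in>I. U i) \<and>
     (\<forall>i\<in>I. bounded (U i) \<and> diameter (U i) \<le> \<delta>) \<and> (\<Sum>i\<in>I. diameter_powr s (U i)) \<le> \<epsilon>"
    using cover sum by (intro exI[of _ I] exI[of _ U] conjI)
qed

lemma hausdorff_dimension_irrational_preimage: "hausdorff_dimension (preimage r ({0..<1} - \<rat>)) = 0"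
proof (rule hausdorff_dimension_zeroI)
  fix s :: real assume s: "0 < s" "s < 1"
  define E where "E n = {\<alpha>. 0 \<le> \<alpha> \<and> r \<alpha> \<notin> \<rat> \<and> 1 / real (n + 2) < r \<alpha> \<and> r \<alpha> < 1 - 1 / real (n + 2)}" for n
  have "preimage r ({0..<1} - \<rat>) = (\<Union>n. E n)"
  proof (intro set_eqI iffI)
    fix \<alpha> assume "\<alpha> \<in> preimage r ({0..<1} - \<rat>)"
    then have a: "0 \<le> \<alpha>" "r \<alpha> \<notin> \<rat>" "0 \<le> r \<alpha>" "r \<alpha> < 1" by auto
    then have "0 < r \<alpha>" by (metis Rats_0 order_le_less)
    then obtain N where N: "2 \<le> N" "1 / real N < r \<alpha>" "r \<alpha> < 1 - 1 / real N"
      using exists_margin[OF _ a(4)] by blast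
    then have "\<alpha> \<in> E (N - 2)" using a by (simp add: E_def)
    then show "\<alpha> \<in> (\<Union>n. E n)" by blast
  next
    fix \<alpha> assume "\<alpha> \<in> (\<Union>n. E n)"
    then obtain n where a: "0 \<le> \<alpha>" "r \<alpha> \<notin> \<rat>" "1 / real (n + 2) < r \<alpha>" "r \<alpha> < 1 - 1 / real (n + 2)"
      by (auto simp: E_def)
    have "0 < 1 / real (n + 2)" by simp
    then have "0 \<le> r \<alpha>" "r \<alpha> < 1" using a by linarith+
    then show "\<alpha> \<in> preimage r ({0..<1} - \<rat>)" using a by auto
  qed
  moreover have "null_cover s (E n)" for n
    unfolding E_def by (rule null_cover_irrational_margin[OF _ s]) simp
  ultimately show "null_cover s (preimage r ({0..<1} - \<rat>))" by (simp add: null_cover_UN)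
qed

end


theorem theorem2p3:
  fixes A0 A1 :: "real^2^2" and r :: "real \<Rightarrow> real"
  assumes "technical_hypotheses A0 A1"
    and "is_ratio_function A0 A1 r"
  shows
    "(continuous_on {0..} r \<and> mono_on {0..} r \<and> r 0 = 0 \<and> (r \<longlongrightarrow> 1) at_top)
     \<and>
     ((\<forall>\<gamma>\<in>\<rat>. 0 < \<gamma> \<and> \<gamma> < 1 \<longrightarrow> (\<exists>a b. a < b \<and> preimage r {\<gamma>} = {a..b})) \<and>
      is_interval (preimage r {0} \<inter> {0<..}) \<and>
      (preimage r {0} \<inter> {0<..} \<noteq> {} \<longleftrightarrow> diagonalizable A0) \<and>
      (preimage r {1} \<noteq> {} \<longleftrightarrow> diagonalizable A1) \<and>
      (diagonalizable A0 \<longrightarrow>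
        (\<exists>P0. is_perron_limit A0 P0 \<and>
           preimage r {0} = {0 .. spectral_radius A0 / spectral_radius (P0 ** A1)})) \<and>
      (diagonalizable A1 \<longrightarrow>
        (\<exists>P1. is_perron_limit A1 P1 \<and>
           preimage r {1} = {spectral_radius (P1 ** A0) / spectral_radius A1 ..})) \<and>
      (\<forall>p q :: nat. 0 < p \<and> p < q \<and> coprime p q \<longrightarrow>
        (\<exists>u v. (u, v) \<in> standard_pairs \<and> slope (u @ v) = real p / real q) \<and>
        (\<forall>u v. (u, v) \<in> standard_pairs \<and> slope (u @ v) = real p / real q \<longrightarrow>
          (let q1 = length u; q2 = length v;
               B1 = word_matrix A0 A1 1 u; B2 = word_matrix A0 A1 1 v; A = B1 ** B2
           in \<exists>P. is_perron_limit A P \<and>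
                preimage r {real p / real q} =
                  {spectral_radius (B1 ** P) ^ q / spectral_radius A ^ q1 ..
                   spectral_radius A ^ q2 / spectral_radius (P ** B2) ^ q} \<and>
                (\<forall>\<alpha> \<in> preimage r {real p / real q}.
                   jsr A0 A1 \<alpha> = root q (spectral_radius (word_matrix A0 A1 \<alpha> (u @ v))))))))
     \<and>
     (hausdorff_dimension (preimage r ({0..<1} - \<rat>)) = 0 \<and>
      (\<forall>\<gamma>. \<gamma> \<notin> \<rat> \<and> 0 < \<gamma> \<and> \<gamma> < 1 \<longrightarrow> is_singleton (preimage r {\<gamma>})))"
proof -
  interpret sturmian_pair A0 A1 r
    using assms by unfold_locales
  have part_i: "continuous_on {0..} r \<and> mono_on {0..} r \<and> r 0 = 0 \<and> (r \<longlongrightarrow> 1) at_top"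
    using r_continuous r_zero r_tendsto_1 r_mono by (auto intro!: mono_onI)
  have rational: "\<exists>a b. a < b \<and> preimage r {\<gamma>} = {a..b}" if \<gamma>: "\<gamma> \<in> \<rat>" "0 < \<gamma>" "\<gamma> < 1" for \<gamma>
  proof -
    obtain p q :: nat where pq: "q \<noteq> 0" "\<bar>\<gamma>\<bar> = real p / real q" "coprime p q"
      using Rats_abs_nat_div_natE[OF \<gamma>(1)] by metis
    then have g: "\<gamma> = real p / real q" using \<gamma>(2) by simp
    then have "0 < p" "p < q" using \<gamma> pq(1) by (auto simp: zero_less_divide_iff)
    then obtain u v where uv: "(u, v) \<in> standard_pairs" "num_ones (u @ v) = p" "length (u @ v) = q"
      using exists_standard_pair[OF _ _ pq(3)] by blast
    have "slope (u @ v) = \<gamma>" unfolding slope_def uv(2,3) g ..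
    then show ?thesis using plateau_interior(2,3)[OF uv(1)] by blast
  qed
  have interval: "is_interval (preimage r {0} \<inter> {0<..})"
    unfolding is_interval_1
  proof (intro ballI allI impI)
    fix a b x assume "a \<in> preimage r {0} \<inter> {0<..}" "b \<in> preimage r {0} \<inter> {0<..}" "a \<le> x \<and> x \<le> b"
    then show "x \<in> preimage r {0} \<inter> {0<..}"
      using r_mono[of a x] r_mono[of x b] by auto
  qed
  have zero: "preimage r {0} \<inter> {0<..} \<noteq> {} \<longleftrightarrow> diagonalizable A0"
  proof
    assume "diagonalizable A0"
    from plateau_zero_diagonalizable(2,3)[OF this]
    have "spectral_radius A0 / spectral_radius (perron_proj A0 ** A1) \<in> preimage r {0} \<inter> {0<..}" by simp
    then show "preimage r {0} \<inter> {0<..} \<noteq> {}" by blast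
  qed (use plateau_zero_imp_diagonalizable in auto)
  have one: "preimage r {1} \<noteq> {} \<longleftrightarrow> diagonalizable A1"
  proof
    assume "preimage r {1} \<noteq> {}"
    then obtain \<alpha> where "0 \<le> \<alpha>" "r \<alpha> = 1" by auto
    moreover from this have "\<alpha> \<noteq> 0" using r_zero by auto
    ultimately show "diagonalizable A1" using plateau_one_imp_diagonalizable[of \<alpha>] by simp
  next
    assume "diagonalizable A1"
    from plateau_one_diagonalizable(2)[OF this] show "preimage r {1} \<noteq> {}" by auto
  qed
  have formula: "let q1 = length u; q2 = length v;
               B1 = word_matrix A0 A1 1 u; B2 = word_matrix A0 A1 1 v; A = B1 ** B2
           in \<exists>P. is_perron_limit A P \<and>
                preimage r {real p / real q} =
                  {spectral_radius (B1 ** P) ^ q / spectral_radius A ^ q1 ..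
                   spectral_radius A ^ q2 / spectral_radius (P ** B2) ^ q} \<and>
                (\<forall>\<alpha> \<in> preimage r {real p / real q}.
                   jsr A0 A1 \<alpha> = root q (spectral_radius (word_matrix A0 A1 \<alpha> (u @ v))))"
    if pq: "0 < p" "p < q" "coprime p q" and uv: "(u, v) \<in> standard_pairs" "slope (u @ v) = real p / real q"
    for p q :: nat and u v
  proof -
    have q: "length (u @ v) = q" using standard_pair_of_slope(2)[OF uv pq(3)] pq by simp
    show ?thesis
      unfolding Let_def using plateau_interior(1,2,4)[OF uv(1), unfolded uv(2) q] by blast
  qed
  have existence: "\<exists>u v. (u, v) \<in> standard_pairs \<and> slope (u @ v) = real p / real q"
    if pq: "0 < p" "p < q" "coprime p q" for p q :: nat
  proof -
    obtain u v where uv: "(u, v) \<in> standard_pairs" "num_ones (u @ v) = p" "length (u @ v) = q"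
      using exists_standard_pair[OF pq] by blast
    then show ?thesis unfolding slope_def by metis
  qed
  show ?thesis
  proof (intro conjI)
    show "\<forall>\<gamma>\<in>\<rat>. 0 < \<gamma> \<and> \<gamma> < 1 \<longrightarrow> (\<exists>a b. a < b \<and> preimage r {\<gamma>} = {a..b})"
      by (intro ballI impI, elim conjE, rule rational)
    show "diagonalizable A0 \<longrightarrow> (\<exists>P0. is_perron_limit A0 P0 \<and>
        preimage r {0} = {0 .. spectral_radius A0 / spectral_radius (P0 ** A1)})"
      using plateau_zero_diagonalizable(1,2) by blast
    show "diagonalizable A1 \<longrightarrow> (\<exists>P1. is_perron_limit A1 P1 \<and>
        preimage r {1} = {spectral_radius (P1 ** A0) / spectral_radius A1 ..})"
      using plateau_one_diagonalizable by blast
    show "\<forall>p q :: nat. 0 < p \<and> p < q \<and> coprime p q \<longrightarrow>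
        (\<exists>u v. (u, v) \<in> standard_pairs \<and> slope (u @ v) = real p / real q) \<and>
        (\<forall>u v. (u, v) \<in> standard_pairs \<and> slope (u @ v) = real p / real q \<longrightarrow>
          (let q1 = length u; q2 = length v;
               B1 = word_matrix A0 A1 1 u; B2 = word_matrix A0 A1 1 v; A = B1 ** B2
           in \<exists>P. is_perron_limit A P \<and>
                preimage r {real p / real q} =
                  {spectral_radius (B1 ** P) ^ q / spectral_radius A ^ q1 ..
                   spectral_radius A ^ q2 / spectral_radius (P ** B2) ^ q} \<and>
                (\<forall>\<alpha> \<in> preimage r {real p / real q}.
                   jsr A0 A1 \<alpha> = root q (spectral_radius (word_matrix A0 A1 \<alpha> (u @ v))))))"
    proof (intro allI impI conjI)
      fix p q :: nat
      assume pq: "0 < p \<and> p < q \<and> coprime p q"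
      then show "\<exists>u v. (u, v) \<in> standard_pairs \<and> slope (u @ v) = real p / real q"
        by (elim conjE) (rule existence)
    qed (elim conjE, rule formula)
    show "\<forall>\<gamma>. \<gamma> \<notin> \<rat> \<and> 0 < \<gamma> \<and> \<gamma> < 1 \<longrightarrow> is_singleton (preimage r {\<gamma>})"
      by (intro allI impI, elim conjE, rule irrational_preimage_singleton)
  qed (use part_i interval zero one hausdorff_dimension_irrational_preimage in simp_all)
qed

end
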